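(* Let $p\in(\frac{10}{3},6)$ and $c>0$. Then $$\gamma(c)=\inf_{u\in V(c)}F(u).$$
   Context: Functions are complex-valued and $\|\cdot\|_s$ is the $L^s(\mathbb{R}^3)$ norm. For $u\in H^1(\mathbb{R}^3)$ set $A(u)=\int_{\mathbb{R}^3}|\nabla u|^2dx$, $B(u)=\int_{\mathbb{R}^3}\int_{\mathbb{R}^3}\frac{|u(x)|^2|u(y)|^2}{|x-y|}dxdy$, $$F(u)=\frac12A(u)+\frac14B(u)-\frac1p\|u\|_p^p,\qquad Q(u)=A(u)+\frac14B(u)-\frac{3(p-2)}{2p}\|u\|_p^p.$$ For $c>0$: $S(c)=\{u\in H^1(\mathbb{R}^3):\|u\|_2^2=c\}$ and $V(c)=\{u\in S(c):Q(u)=0\}$. Mountain pass level: for every $c>0$ and $p\in(\frac{10}{3},6)$ there exists $K_c>0$ such that $$\gamma(c)=\inf_{g\in\Gamma_c}\max_{t\in[0,1]}F(g(t))>\max\{F(g(0)),F(g(1))\}$$ for every $g$ in the nonempty set $\Gamma_c=\{g\in C([0,1],S(c)):\ g(0)\in A_{K_c},\ F(g(1))<0\}$, where $A_{K_c}=\{u\in S(c):\|\nabla u\|_2^2\le K_c\}$. With such a $K_c$ fixed, $\gamma(c)$ is the mountain pass level. *)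

theory Defs
  imports "HOL-Analysis.Analysis"
begin

text \<open>
  Elements of function spaces are represented by Borel functions instead of classes modulo
  equality almost everywhere; every Lebesgue class has a Borel representative, and all the
  quantities below are invariant under changes on null sets.
\<close>

type_synonym space3 = "real ^ 3"

subsection \<open>The Sobolev space $H^1$ of complex-valued functions on $R^3$\<close>

definition Lnorm :: "real \<Rightarrow> (space3 \<Rightarrow> 'b::euclidean_space) \<Rightarrow> real" where
  "Lnorm s u = (LINT x|lborel. norm (u x) powr s) powr (1 / s)"

definition L2 :: "(space3 \<Rightarrow> 'b::euclidean_space) set" where
  "L2 = {u \<in> borel_measurable lborel. integrable lborel (\<lambda>x. (norm (u x))\<^sup>2)}"

primrec C_k :: "nat \<Rightarrow> (space3 \<Rightarrow> real) \<Rightarrow> bool" where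
  "C_k 0 \<phi> \<longleftrightarrow> continuous_on UNIV \<phi>"
| "C_k (Suc k) \<phi> \<longleftrightarrow> \<phi> differentiable_on UNIV \<and>
     (\<forall>h. C_k k (\<lambda>x. frechet_derivative \<phi> (at x) h))"

definition test_function :: "(space3 \<Rightarrow> real) \<Rightarrow> bool" where
  "test_function \<phi> \<longleftrightarrow> (\<forall>k. C_k k \<phi>) \<and> compact (closure {x. \<phi> x \<noteq> 0})"

definition locally_integrable :: "(space3 \<Rightarrow> 'b::euclidean_space) \<Rightarrow> bool" where
  "locally_integrable u \<longleftrightarrow>
     u \<in> borel_measurable lborel \<and> (\<forall>K. compact K \<longrightarrow> set_integrable lborel K u)"

definition is_weak_gradient :: "(space3 \<Rightarrow> complex) \<Rightarrow> (space3 \<Rightarrow> complex ^ 3) \<Rightarrow> bool" where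
  "is_weak_gradient u v \<longleftrightarrow> locally_integrable u \<and> locally_integrable v \<and>
     (\<forall>\<phi> i. test_function \<phi> \<longrightarrow>
        (LINT x|lborel. frechet_derivative \<phi> (at x) (axis i 1) *\<^sub>R u x) =
        - (LINT x|lborel. \<phi> x *\<^sub>R (v x $ i)))"

text \<open>The weak gradient is unique only almost everywhere; the choice of representative
  is immaterial as it is used only under integrals.\<close>

definition weak_grad :: "(space3 \<Rightarrow> complex) \<Rightarrow> space3 \<Rightarrow> complex ^ 3" where
  "weak_grad u = (SOME v. is_weak_gradient u v)"

definition H1 :: "(space3 \<Rightarrow> complex) set" where
  "H1 = {u \<in> L2. \<exists>v \<in> L2. is_weak_gradient u v}"

definition H1_norm :: "(space3 \<Rightarrow> complex) \<Rightarrow> real" where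
  "H1_norm u = sqrt ((Lnorm 2 u)\<^sup>2 + (Lnorm 2 (weak_grad u))\<^sup>2)"

subsection \<open>The functionals and the constraint sets\<close>

definition A_fun :: "(space3 \<Rightarrow> complex) \<Rightarrow> real" where
  "A_fun u = (LINT x|lborel. (norm (weak_grad u x))\<^sup>2)"

text \<open>On the null set \<open>x = y\<close> the integrand is \<open>0\<close>, by the convention for division by zero.\<close>

definition B_fun :: "(space3 \<Rightarrow> complex) \<Rightarrow> real" where
  "B_fun u = (LINT x|lborel. LINT y|lborel. (cmod (u x))\<^sup>2 * (cmod (u y))\<^sup>2 / norm (x - y))"

definition F_fun :: "real \<Rightarrow> (space3 \<Rightarrow> complex) \<Rightarrow> real" where
  "F_fun p u = 1 / 2 * A_fun u + 1 / 4 * B_fun u - 1 / p * Lnorm p u powr p"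

definition Q_fun :: "real \<Rightarrow> (space3 \<Rightarrow> complex) \<Rightarrow> real" where
  "Q_fun p u = A_fun u + 1 / 4 * B_fun u - 3 * (p - 2) / (2 * p) * Lnorm p u powr p"

definition S_set :: "real \<Rightarrow> (space3 \<Rightarrow> complex) set" where
  "S_set c = {u \<in> H1. (Lnorm 2 u)\<^sup>2 = c}"

definition V_set :: "real \<Rightarrow> real \<Rightarrow> (space3 \<Rightarrow> complex) set" where
  "V_set p c = {u \<in> S_set c. Q_fun p u = 0}"

definition A_set :: "real \<Rightarrow> real \<Rightarrow> (space3 \<Rightarrow> complex) set" where
  "A_set c K = {u \<in> S_set c. (Lnorm 2 (weak_grad u))\<^sup>2 \<le> K}"

subsection \<open>The mountain pass level\<close>

text \<open>Continuity of paths refers to the \<open>H1\<close> norm. Only the values on \<open>{0..1}\<close> matter.\<close>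

definition C01 :: "(space3 \<Rightarrow> complex) set \<Rightarrow> (real \<Rightarrow> space3 \<Rightarrow> complex) set" where
  "C01 X = {g. (\<forall>t\<in>{0..1}. g t \<in> X) \<and>
     (\<forall>t\<in>{0..1}. ((\<lambda>s. H1_norm (\<lambda>x. g s x - g t x)) \<longlongrightarrow> 0) (at t within {0..1}))}"

definition Gamma_set :: "real \<Rightarrow> real \<Rightarrow> real \<Rightarrow> (real \<Rightarrow> space3 \<Rightarrow> complex) set" where
  "Gamma_set p c K = {g \<in> C01 (S_set c). g 0 \<in> A_set c K \<and> F_fun p (g 1) < 0}"

text \<open>Extrema are taken in the extended reals, so that they do not presuppose boundedness or
  nonemptiness. The supremum over \<open>{0..1}\<close> is a maximum, since \<open>F_fun p\<close> is continuous
  along the path.\<close>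

definition gamma_level :: "real \<Rightarrow> real \<Rightarrow> real \<Rightarrow> ereal" where
  "gamma_level p c K = (INF g\<in>Gamma_set p c K. SUP t\<in>{0..1}. ereal (F_fun p (g t)))"

text \<open>The constants \<open>K\<close> that may serve as $K_c$ in the definition of the level.\<close>

definition mountain_pass_constant :: "real \<Rightarrow> real \<Rightarrow> real \<Rightarrow> bool" where
  "mountain_pass_constant p c K \<longleftrightarrow> K > 0 \<and> Gamma_set p c K \<noteq> {} \<and>
     (\<forall>g\<in>Gamma_set p c K. gamma_level p c K > ereal (max (F_fun p (g 0)) (F_fun p (g 1))))"

end

theory Submission
  imports Defs
begin

text \<open>
  The proof moves along dilations \<open>u\<^sub>t(x) = t powr (3/2) * u(t x)\<close>, which preserve the \<open>L2\<close> norm. With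
  \<open>q = 3 (p - 2) / 2 > 2\<close> and \<open>N\<close> the integral of \<open>|u| powr p\<close>,
  \<open>F(u\<^sub>t) = t^2 A / 2 + t B / 4 - t powr q N / p\<close>, and \<open>t\<close> times the derivative in \<open>t\<close> is \<open>Q(u\<^sub>t)\<close>.
  Since \<open>q > 2\<close>, a zero of \<open>Q\<close> is the maximum of \<open>F\<close> on its fibre.

  Upper bound (\<open>gamma_level_le_F_on_V\<close>): for \<open>u\<close> in \<open>V\<close> the dilations of \<open>u\<close>, run from a small factor to a
  large one, form an admissible path whose maximum is \<open>F(u)\<close>.

  Lower bound (\<open>path_meets_V\<close>): every admissible path meets \<open>V\<close>. At its end \<open>F < 0\<close>, which forces \<open>Q < 0\<close>.
  At its start \<open>Q \<ge> 0\<close>: otherwise \<open>F\<close> would decrease along the dilations of the starting point with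
  factors \<open>t \<ge> 1\<close>, and this ray would be an admissible path with its maximum at the starting point,
  against the strict mountain pass inequality. As \<open>Q\<close> is continuous along the path, it has a zero.

  The analysis behind this consists of three facts about \<open>H1\<close>.
   \<^item> Dilations act strongly continuously on \<open>L2\<close> (\<open>rescale_continuous\<close>). This is clear on test functions,
    and test functions are dense (\<open>test_functions_dense_L2\<close>).
   \<^item> \<open>H1\<close> embeds into \<open>Lp\<close> for \<open>2 < p < 6\<close> (\<open>H1_embedding_Lp\<close>). The weak gradient enters only through the
    bound \<open>|h| |grad u|\<close> for the \<open>L2\<close> distance between \<open>u\<close> and its translate by \<open>h\<close>
    (\<open>H1_translation_estimate\<close>). This bound limits how far averages over balls can move when the radius
    shrinks by a factor \<open>4\<close>, so averages over radius \<open>4^(-k)\<close> are \<open>O(2^k)\<close>. On the set where \<open>|u|\<close> exceeds twice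
    that size, \<open>|u|\<close> is dominated by its oscillation at scale \<open>4^(-k)\<close>, whose \<open>L2\<close> mass is \<open>O(16^(-k))\<close>.
    Summation over the dyadic layers of \<open>|u|\<close> converges exactly for \<open>p < 6\<close>.
   \<^item> \<open>A\<close>, \<open>B\<close> and \<open>N\<close> are continuous along paths in the sphere \<open>S(c)\<close>
    (\<open>uniformly_usc_continuous_along_path\<close>). For \<open>B\<close> this rests on a uniform bound of the Coulomb
    potential of \<open>|u|^2\<close> by the \<open>H1\<close> norm (\<open>coulomb_potential_bound\<close>), a consequence of the embedding
    for \<open>p = 4\<close>.
\<close>

section \<open>Affine changes of variables\<close>

abbreviation sq_mass :: "('a::euclidean_space \<Rightarrow> real) \<Rightarrow> ennreal" where
  "sq_mass f \<equiv> (\<integral>\<^sup>+x. ennreal ((f x)^2) \<partial>lborel)"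

lemma nn_integral_lborel_affine:
  fixes f :: "'a::euclidean_space \<Rightarrow> ennreal"
  assumes [measurable]: "f \<in> borel_measurable borel" and c: "c \<noteq> 0"
  shows "(\<integral>\<^sup>+x. f x \<partial>lborel) = ennreal (\<bar>c\<bar> ^ DIM('a)) * (\<integral>\<^sup>+x. f (a + c *\<^sub>R x) \<partial>lborel)"
  by (subst lborel_affine[OF c, of a])
     (simp add: nn_integral_density nn_integral_distr nn_integral_cmult)

lemma integrable_lborel_affine:
  fixes f :: "'a::euclidean_space \<Rightarrow> 'b::{banach, second_countable_topology}"
  assumes [measurable]: "f \<in> borel_measurable borel" and c: "c \<noteq> 0"
  shows "integrable lborel (\<lambda>x. f (a + c *\<^sub>R x)) \<longleftrightarrow> integrable lborel f"
proof -
  have "integrable lborel f \<longleftrightarrow>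
      integrable (density (distr lborel borel (\<lambda>x. a + c *\<^sub>R x)) (\<lambda>_. \<bar>c\<bar>^DIM('a))) f"
    using lborel_affine[OF c, of a] by (simp add: ennreal_power)
  also have "\<dots> \<longleftrightarrow> integrable lborel (\<lambda>x. (\<bar>c\<bar>^DIM('a)) *\<^sub>R f (a + c *\<^sub>R x))"
    by (subst integrable_density) (auto simp: integrable_distr_eq)
  also have "\<dots> \<longleftrightarrow> integrable lborel (\<lambda>x. f (a + c *\<^sub>R x))"
  proof
    assume "integrable lborel (\<lambda>x. (\<bar>c\<bar>^DIM('a)) *\<^sub>R f (a + c *\<^sub>R x))"
    then have "integrable lborel (\<lambda>x. (1 / \<bar>c\<bar>^DIM('a)) *\<^sub>R (\<bar>c\<bar>^DIM('a)) *\<^sub>R f (a + c *\<^sub>R x))"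
      by (rule integrable_scaleR_right)
    then show "integrable lborel (\<lambda>x. f (a + c *\<^sub>R x))"
      using c by simp
  qed simp
  finally show ?thesis by simp
qed

lemma integral_lborel_affine:
  fixes f :: "'a::euclidean_space \<Rightarrow> 'b::{banach, second_countable_topology}"
  assumes [measurable]: "f \<in> borel_measurable borel" and c: "c \<noteq> 0"
  shows "(LINT x|lborel. f x) = \<bar>c\<bar> ^ DIM('a) *\<^sub>R (LINT x|lborel. f (a + c *\<^sub>R x))"
proof -
  have "(LINT x|lborel. f x) =
      integral\<^sup>L (density (distr lborel borel (\<lambda>x. a + c *\<^sub>R x)) (\<lambda>_. \<bar>c\<bar>^DIM('a))) f"
    using lborel_affine[OF c, of a] by (simp add: ennreal_power)
  also have "\<dots> = (LINT x|lborel. (\<bar>c\<bar>^DIM('a)) *\<^sub>R f (a + c *\<^sub>R x))"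
    by (subst integral_density) (auto simp: integral_distr)
  finally show ?thesis by simp
qed

section \<open>Test functions\<close>

text \<open>
  The functions \<open>P(1/t) exp(-1/t)\<close>, extended by zero to \<open>t \<le> 0\<close>, form a class that is closed under
  differentiation. Hence all of them are smooth, and \<open>exp(-1/t)\<close> is the case \<open>P = 1\<close>.
\<close>

definition flat :: "real poly \<Rightarrow> real \<Rightarrow> real" where
  "flat P t = (if t > 0 then poly P (1 / t) * exp (- (1 / t)) else 0)"

lemma poly_times_exp_minus_tendsto_0:
  "((\<lambda>s::real. poly P s * exp (- s)) \<longlongrightarrow> 0) at_top"
proof -
  have "((\<lambda>s. \<Sum>i\<le>degree P. coeff P i * (s ^ i / exp s)) \<longlongrightarrow> (\<Sum>i\<le>degree P. coeff P i * 0)) at_top"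
    by (intro tendsto_sum tendsto_mult tendsto_const tendsto_power_div_exp_0)
  then show ?thesis
    by (simp add: poly_altdef sum_distrib_left exp_minus divide_inverse mult_ac)
qed

lemma flat_tendsto_0: "(flat P \<longlongrightarrow> 0) (at 0)"
proof (rule filterlim_split_at)
  have "((\<lambda>t. 0) \<longlongrightarrow> 0) (at_left (0::real))" by simp
  moreover have "eventually (\<lambda>t. flat P t = 0) (at_left 0)"
    unfolding eventually_at_filter by (auto simp: flat_def)
  ultimately show "(flat P \<longlongrightarrow> 0) (at_left 0)"
    by (simp add: tendsto_cong)
next
  have "((\<lambda>t. poly P (inverse t) * exp (- inverse t)) \<longlongrightarrow> 0) (at_right 0)"
    using filterlim_compose[OF poly_times_exp_minus_tendsto_0[of P] filterlim_inverse_at_top_right] .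
  moreover have "eventually (\<lambda>t. flat P t = poly P (inverse t) * exp (- inverse t)) (at_right 0)"
    unfolding eventually_at_filter by (auto simp: flat_def divide_inverse)
  ultimately show "(flat P \<longlongrightarrow> 0) (at_right 0)"
    by (simp add: tendsto_cong)
qed

definition flat_deriv :: "real poly \<Rightarrow> real poly" where
  "flat_deriv P = [:0, 0, 1:] * (P - pderiv P)"

lemma has_real_derivative_flat: "(flat P has_real_derivative flat (flat_deriv P) t) (at t)"
proof -
  consider "t > 0" | "t < 0" | "t = 0" by linarith
  then show ?thesis
  proof cases
    case 1
    have "((\<lambda>t. poly P (1 / t) * exp (- (1 / t))) has_real_derivative flat (flat_deriv P) t) (at t)"
      using 1 by (auto intro!: derivative_eq_intros
        simp: flat_def flat_deriv_def field_simps power2_eq_square)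
    then show ?thesis
      by (rule has_field_derivative_transform_within_open[where S="{0<..}"])
         (use 1 in \<open>auto simp: flat_def\<close>)
  next
    case 2
    have "((\<lambda>t. 0) has_real_derivative flat (flat_deriv P) t) (at t)"
      using 2 by (auto simp: flat_def)
    then show ?thesis
      by (rule has_field_derivative_transform_within_open[where S="{..<0}"])
         (use 2 in \<open>auto simp: flat_def\<close>)
  next
    case 3
    \<comment> \<open>The difference quotient at \<open>0\<close> has the same shape, for the polynomial \<open>X * P\<close>.\<close>
    have "(\<lambda>y. (flat P y - flat P 0) / (y - 0)) = flat (pCons 0 P)"
      by (rule ext) (auto simp: flat_def)
    then show ?thesis
      using flat_tendsto_0[of "pCons 0 P"] 3
      by (simp add: has_field_derivative_iff flat_def[of _ 0])
  qed
qed

text \<open>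
  A class that is closed under directional derivatives by the product and chain rules, so that its
  members have derivatives of all orders. It contains \<open>exp\<close> for the sake of \<open>box_cutoff\<close>.
\<close>

inductive elem_smooth :: "(space3 \<Rightarrow> real) \<Rightarrow> bool" where
  smooth_const: "elem_smooth (\<lambda>x. c)"
| smooth_flat: "elem_smooth (\<lambda>x. flat P (h \<bullet> x + c))"
| smooth_add: "elem_smooth f \<Longrightarrow> elem_smooth g \<Longrightarrow> elem_smooth (\<lambda>x. f x + g x)"
| smooth_mult: "elem_smooth f \<Longrightarrow> elem_smooth g \<Longrightarrow> elem_smooth (\<lambda>x. f x * g x)"
| smooth_exp: "elem_smooth f \<Longrightarrow> elem_smooth (\<lambda>x. exp (f x))"

lemma elem_smooth_derivative:
  "elem_smooth f \<Longrightarrow>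
    \<exists>f'. (\<forall>x. (f has_derivative f' x) (at x)) \<and> (\<forall>h. elem_smooth (\<lambda>x. f' x h))"
proof (induction rule: elem_smooth.induct)
  case (smooth_const c)
  show ?case
    by (intro exI[of _ "\<lambda>x h. 0"] conjI allI has_derivative_const elem_smooth.smooth_const)
next
  case (smooth_flat P h c)
  have "((\<lambda>x. flat P (h \<bullet> x + c)) has_derivative (\<lambda>k. (h \<bullet> k) * flat (flat_deriv P) (h \<bullet> x + c))) (at x)" for x
  proof -
    have 1: "((\<lambda>x. h \<bullet> x + c) has_derivative (\<lambda>k. h \<bullet> k)) (at x)"
      by (auto intro!: derivative_eq_intros)
    show ?thesis
      using has_derivative_compose[OF 1
          has_real_derivative_flat[of P "h \<bullet> x + c", unfolded has_field_derivative_def]]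
      by (simp add: mult.commute)
  qed
  then show ?case
    by (intro exI[of _ "\<lambda>x k. (h \<bullet> k) * flat (flat_deriv P) (h \<bullet> x + c)"] conjI allI
          elem_smooth.smooth_mult elem_smooth.smooth_const elem_smooth.smooth_flat)
next
  case (smooth_add f g)
  then obtain f' g' where "\<forall>x. (f has_derivative f' x) (at x)" "\<forall>h. elem_smooth (\<lambda>x. f' x h)"
    "\<forall>x. (g has_derivative g' x) (at x)" "\<forall>h. elem_smooth (\<lambda>x. g' x h)" by blast
  then show ?case
    by (intro exI[of _ "\<lambda>x h. f' x h + g' x h"] conjI allI
          elem_smooth.smooth_add has_derivative_add) blast+
next
  case (smooth_mult f g)
  then obtain f' g' where "\<forall>x. (f has_derivative f' x) (at x)" "\<forall>h. elem_smooth (\<lambda>x. f' x h)"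
    "\<forall>x. (g has_derivative g' x) (at x)" "\<forall>h. elem_smooth (\<lambda>x. g' x h)" by blast
  with smooth_mult.hyps show ?case
    by (intro exI[of _ "\<lambda>x h. f x * g' x h + f' x h * g x"] conjI allI
          elem_smooth.smooth_add elem_smooth.smooth_mult has_derivative_mult) blast+
next
  case (smooth_exp f)
  then obtain f' where f': "\<forall>x. (f has_derivative f' x) (at x)" "\<forall>h. elem_smooth (\<lambda>x. f' x h)"
    by blast
  have "((\<lambda>x. exp (f x)) has_derivative (\<lambda>h. f' x h * exp (f x))) (at x)" for x
    using has_derivative_compose[OF f'(1)[rule_format]
        DERIV_exp[of "f x", unfolded has_field_derivative_def]]
    by (simp add: mult.commute)
  with f' smooth_exp.hyps show ?case
    by (intro exI[of _ "\<lambda>x h. f' x h * exp (f x)"] conjI allI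
          elem_smooth.smooth_mult elem_smooth.smooth_exp) blast+
qed

lemma elem_smooth_C_k: "elem_smooth f \<Longrightarrow> C_k k f"
proof (induction k arbitrary: f)
  case 0
  from elem_smooth_derivative[OF this] obtain f' where
    f': "\<forall>x. (f has_derivative f' x) (at x)" by blast
  then have "isCont f x" for x by (auto intro: has_derivative_continuous)
  then show ?case by (simp add: continuous_at_imp_continuous_on)
next
  case (Suc k)
  from elem_smooth_derivative[OF Suc.prems] obtain f' where
    f': "\<forall>x. (f has_derivative f' x) (at x)" "\<forall>h. elem_smooth (\<lambda>x. f' x h)" by blast
  have "frechet_derivative f (at x) = f' x" for x
    using frechet_derivative_at[OF f'(1)[rule_format]] by simp
  moreover have "f differentiable_on UNIV"
    using f'(1) by (intro differentiable_at_imp_differentiable_on) (auto simp: differentiable_def)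
  ultimately show ?case
    using f'(2) Suc.IH by simp
qed

definition box_bump :: "space3 \<Rightarrow> space3 \<Rightarrow> space3 \<Rightarrow> real" where
  "box_bump a b x = (\<Prod>i\<in>Basis. flat 1 (x \<bullet> i - a \<bullet> i) * flat 1 (b \<bullet> i - x \<bullet> i))"

lemma elem_smooth_prod:
  "finite I \<Longrightarrow> (\<And>i. i \<in> I \<Longrightarrow> elem_smooth (f i)) \<Longrightarrow> elem_smooth (\<lambda>x. \<Prod>i\<in>I. f i x)"
  by (induction I rule: finite_induct) (simp_all add: smooth_const smooth_mult)

lemma elem_smooth_box_bump: "elem_smooth (box_bump a b)"
proof -
  have "elem_smooth (\<lambda>x. flat 1 (x \<bullet> i - a \<bullet> i))" for i
    using smooth_flat[of 1 i "- (a \<bullet> i)"] by (simp add: inner_commute)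
  moreover have "elem_smooth (\<lambda>x. flat 1 (b \<bullet> i - x \<bullet> i))" for i
    using smooth_flat[of 1 "- i" "b \<bullet> i"] by (simp add: inner_commute)
  ultimately show ?thesis
    unfolding box_bump_def[abs_def] by (intro elem_smooth_prod smooth_mult) (simp_all add: finite_Basis)
qed

lemma box_bump_nonneg: "box_bump a b x \<ge> 0"
  by (auto simp: box_bump_def flat_def intro!: prod_nonneg)

lemma box_bump_eq_0_iff: "box_bump a b x = 0 \<longleftrightarrow> x \<notin> box a b"
  by (auto simp: box_bump_def flat_def mem_box)

text \<open>
  For growing \<open>n\<close> these functions increase to the indicator of the open box, because \<open>box_bump\<close> is positive
  exactly there, and their supports stay inside the closed box.
\<close>

definition box_cutoff :: "space3 \<Rightarrow> space3 \<Rightarrow> nat \<Rightarrow> space3 \<Rightarrow> real" where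
  "box_cutoff a b n x = 1 - exp (- real n * box_bump a b x)"

lemma test_function_box_cutoff: "test_function (box_cutoff a b n)"
proof -
  have "elem_smooth (\<lambda>x. 1 + (-1) * exp ((- real n) * box_bump a b x))"
    by (intro smooth_add smooth_mult smooth_exp smooth_const elem_smooth_box_bump)
  then have "elem_smooth (box_cutoff a b n)"
    by (simp add: box_cutoff_def[abs_def])
  moreover have "box_cutoff a b n x = 0" if "x \<notin> box a b" for x
    using that by (simp add: box_cutoff_def box_bump_eq_0_iff[THEN iffD2])
  then have "{x. box_cutoff a b n x \<noteq> 0} \<subseteq> box a b" by blast
  then have "bounded {x. box_cutoff a b n x \<noteq> 0}"
    using bounded_box bounded_subset by blast
  then have "compact (closure {x. box_cutoff a b n x \<noteq> 0})"
    by (simp add: compact_closure)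
  ultimately show ?thesis
    by (simp add: test_function_def elem_smooth_C_k)
qed

lemma box_cutoff_tendsto: "(\<lambda>n. box_cutoff a b n x) \<longlonglongrightarrow> indicator (box a b) x"
proof (cases "x \<in> box a b")
  case True
  then have "box_bump a b x > 0"
    using box_bump_nonneg[of a b x] box_bump_eq_0_iff[of a b x] by linarith
  then have "(\<lambda>n. exp (- box_bump a b x) ^ n) \<longlonglongrightarrow> 0"
    by (intro LIMSEQ_realpow_zero) auto
  then have "(\<lambda>n. exp (- real n * box_bump a b x)) \<longlonglongrightarrow> 0"
    by (simp add: exp_of_nat_mult[symmetric])
  from tendsto_diff[OF tendsto_const[of 1] this] show ?thesis
    using True by (simp add: box_cutoff_def)
next
  case False
  then show ?thesis by (simp add: box_cutoff_def box_bump_eq_0_iff[THEN iffD2])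
qed

lemma box_cutoff_bounds: "0 \<le> box_cutoff a b n x" "box_cutoff a b n x \<le> indicator (box a b) x"
  using box_bump_nonneg[of a b x] box_bump_eq_0_iff[of a b x]
  by (auto simp: box_cutoff_def indicator_def)

lemma C_k_add_affine: "C_k k f \<Longrightarrow> C_k k g \<Longrightarrow> C_k k (\<lambda>x. f x + r * g (a + c *\<^sub>R x))"
proof (induction k arbitrary: f g)
  case 0
  then show ?case
    by (auto intro!: continuous_intros intro: continuous_on_compose2[of UNIV g])
next
  case (Suc k)
  then have d: "f differentiable at x" "g differentiable at x" for x
    by (auto simp: differentiable_on_def)
  have D: "((\<lambda>x. f x + r * g (a + c *\<^sub>R x)) has_derivative (\<lambda>h. frechet_derivative f (at x) h +
      r * frechet_derivative g (at (a + c *\<^sub>R x)) (c *\<^sub>R h))) (at x)" for x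
  proof -
    have "((\<lambda>x. a + c *\<^sub>R x) has_derivative (\<lambda>h. c *\<^sub>R h)) (at x)"
      by (auto intro!: derivative_eq_intros)
    from has_derivative_compose[OF this d(2)[unfolded frechet_derivative_works]]
    show ?thesis
      by (intro has_derivative_add d(1)[unfolded frechet_derivative_works] has_derivative_mult_right)
  qed
  have "frechet_derivative (\<lambda>x. f x + r * g (a + c *\<^sub>R x)) (at x) = (\<lambda>h. frechet_derivative f (at x) h +
      r * frechet_derivative g (at (a + c *\<^sub>R x)) (c *\<^sub>R h))" for x
    using frechet_derivative_at[OF D[of x]] by simp
  moreover have "C_k k (\<lambda>x. frechet_derivative f (at x) h +
      r * frechet_derivative g (at (a + c *\<^sub>R x)) (c *\<^sub>R h))" for h
    using Suc.prems by (intro Suc.IH[of _ "\<lambda>y. frechet_derivative g (at y) (c *\<^sub>R h)"]) simp_all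
  moreover have "(\<lambda>x. f x + r * g (a + c *\<^sub>R x)) differentiable_on UNIV"
    using D by (intro differentiable_at_imp_differentiable_on) (auto simp: differentiable_def)
  ultimately show ?case by simp
qed

lemma C_k_add: "C_k k f \<Longrightarrow> C_k k g \<Longrightarrow> C_k k (\<lambda>x. f x + g x)"
  using C_k_add_affine[of k f g 1 0 1] by simp

lemma C_k_affine: "C_k k f \<Longrightarrow> C_k k (\<lambda>x. r * f (a + c *\<^sub>R x))"
  using C_k_add_affine[OF elem_smooth_C_k[OF smooth_const[of 0]], of k f r a c] by simp

lemma test_function_add:
  assumes "test_function f" "test_function g"
  shows "test_function (\<lambda>x. f x + g x)"
proof -
  have "bounded ({x. f x \<noteq> 0} \<union> {x. g x \<noteq> 0})"
    using assms by (simp add: test_function_def)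
  then have "bounded {x. f x + g x \<noteq> 0}"
    by (rule bounded_subset) auto
  then show ?thesis
    using assms by (simp add: test_function_def C_k_add)
qed

lemma test_function_affine:
  assumes f: "test_function f" and c: "c \<noteq> 0"
  shows "test_function (\<lambda>x. r * f (a + c *\<^sub>R x))"
proof -
  have "bounded ((\<lambda>y. (1 / c) *\<^sub>R (y - a)) ` {x. f x \<noteq> 0})"
    using bounded_scaling[OF bounded_translation_minus[of "{x. f x \<noteq> 0}" a], of "1 / c"] f
    by (simp add: test_function_def image_image)
  moreover have "{x. r * f (a + c *\<^sub>R x) \<noteq> 0} \<subseteq> (\<lambda>y. (1 / c) *\<^sub>R (y - a)) ` {x. f x \<noteq> 0}"
    using c by (auto intro!: image_eqI[where x="a + c *\<^sub>R _"])
  ultimately have "bounded {x. r * f (a + c *\<^sub>R x) \<noteq> 0}"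
    using bounded_subset by blast
  then show ?thesis
    using f by (simp add: test_function_def C_k_affine)
qed

lemma test_function_scale: "test_function f \<Longrightarrow> test_function (\<lambda>x. r * f x)"
  using test_function_affine[of f 1 r 0] by simp

lemma test_function_zero: "test_function (\<lambda>x. 0)"
  using test_function_scale[OF test_function_box_cutoff, of 0] by simp

lemma test_function_continuous: "test_function f \<Longrightarrow> continuous_on UNIV f"
  by (auto simp: test_function_def dest: spec[of _ 0])

lemma test_function_measurable [measurable_dest]: "test_function f \<Longrightarrow> f \<in> borel_measurable borel"
  by (simp add: test_function_continuous borel_measurable_continuous_onI)

lemma test_function_has_derivative:
  assumes "test_function f"
  shows "(f has_derivative frechet_derivative f (at x)) (at x)"
proof -
  have "C_k (Suc 0) f" using assms by (simp add: test_function_def)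
  then have "f differentiable at x" by (auto simp: differentiable_on_def)
  then show ?thesis by (simp add: frechet_derivative_works[symmetric])
qed

lemma test_function_derivative_continuous:
  assumes "test_function f"
  shows "continuous_on UNIV (\<lambda>x. frechet_derivative f (at x) h)"
proof -
  have "C_k (Suc 0) f" using assms by (simp add: test_function_def)
  then show ?thesis by simp
qed

lemma frechet_derivative_outside_support:
  assumes "test_function f" and x: "x \<notin> closure {x. f x \<noteq> 0}"
  shows "frechet_derivative f (at x) = (\<lambda>h. 0)"
proof -
  have "((\<lambda>x. 0) has_derivative (\<lambda>h. 0)) (at x)" by simp
  then have "(f has_derivative (\<lambda>h. 0)) (at x)"
  proof (rule has_derivative_transform_within_open[where s="- closure {x. f x \<noteq> 0}"])
    show "0 = f y" if "y \<in> - closure {x. f x \<noteq> 0}" for y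
      using that closure_subset[of "{x. f x \<noteq> 0}"] by auto
  qed (use x in auto)
  then show ?thesis using frechet_derivative_at by metis
qed

lemma continuous_compact_support_bounded:
  fixes g :: "space3 \<Rightarrow> real"
  assumes "continuous_on UNIV g" "compact K" "\<And>x. x \<notin> K \<Longrightarrow> g x = 0"
  obtains M where "M > 0" "\<And>x. \<bar>g x\<bar> \<le> M"
proof -
  have "bounded (g ` K)"
    using assms by (intro compact_imp_bounded compact_continuous_image) (auto intro: continuous_on_subset)
  then obtain M where M: "M > 0" "\<forall>y\<in>g ` K. norm y \<le> M"
    by (auto simp: bounded_pos)
  have "\<bar>g x\<bar> \<le> M" for x
    using M assms(3)[of x] by (cases "x \<in> K") auto
  with M that show ?thesis by blast
qed

lemma test_function_bounded:
  assumes "test_function \<phi>"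
  obtains M where "M > 0" "\<And>x. \<bar>\<phi> x\<bar> \<le> M"
  by (rule continuous_compact_support_bounded[OF test_function_continuous[OF assms], of "closure {x. \<phi> x \<noteq> 0}"])
     (use assms closure_subset[of "{x. \<phi> x \<noteq> 0}"] in \<open>auto simp: test_function_def\<close>)

lemma test_function_support_bounded:
  assumes "test_function \<phi>"
  obtains R where "\<And>x. \<phi> x \<noteq> 0 \<Longrightarrow> norm x \<le> R"
proof -
  have "bounded {x. \<phi> x \<noteq> 0}" using assms by (simp add: test_function_def)
  then show ?thesis using that by (auto simp: bounded_iff)
qed

lemma integrable_compact_support_scaleR:
  fixes f :: "space3 \<Rightarrow> 'b::euclidean_space"
  assumes "continuous_on UNIV g" "compact K" "\<And>x. x \<notin> K \<Longrightarrow> g x = 0" "locally_integrable f"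
  shows "integrable lborel (\<lambda>x. g x *\<^sub>R f x)"
proof -
  obtain M where M: "M > 0" "\<And>x. \<bar>g x\<bar> \<le> M"
    using continuous_compact_support_bounded[OF assms(1-3)] by blast
  have [measurable]: "g \<in> borel_measurable borel" "f \<in> borel_measurable borel"
    using assms by (auto simp: locally_integrable_def intro: borel_measurable_continuous_onI)
  have "integrable lborel (\<lambda>x. M *\<^sub>R (indicator K x *\<^sub>R f x))"
    using assms by (intro integrable_scaleR_right)
      (auto simp: locally_integrable_def set_integrable_def)
  then show ?thesis
  proof (rule Bochner_Integration.integrable_bound)
    show "AE x in lborel. norm (g x *\<^sub>R f x) \<le> norm (M *\<^sub>R indicator K x *\<^sub>R f x)"
      using M assms(3) by (intro AE_I2) (auto simp: indicator_def intro!: mult_right_mono)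
  qed measurable
qed

lemma integrable_test_function_scaleR:
  fixes f :: "space3 \<Rightarrow> 'b::euclidean_space"
  assumes "test_function \<phi>" "locally_integrable f"
  shows "integrable lborel (\<lambda>x. \<phi> x *\<^sub>R f x)"
    and "integrable lborel (\<lambda>x. frechet_derivative \<phi> (at x) h *\<^sub>R f x)"
proof -
  have K: "compact (closure {x. \<phi> x \<noteq> 0})" using assms by (simp add: test_function_def)
  show "integrable lborel (\<lambda>x. \<phi> x *\<^sub>R f x)"
    by (rule integrable_compact_support_scaleR[OF test_function_continuous[OF assms(1)] K _ assms(2)])
       (use closure_subset[of "{x. \<phi> x \<noteq> 0}"] in auto)
  show "integrable lborel (\<lambda>x. frechet_derivative \<phi> (at x) h *\<^sub>R f x)"
    by (rule integrable_compact_support_scaleR[OF test_function_derivative_continuous[OF assms(1)] K _ assms(2)])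
       (use frechet_derivative_outside_support[OF assms(1)] in auto)
qed

lemma locally_integrable_L2:
  fixes f :: "space3 \<Rightarrow> 'b::euclidean_space"
  assumes "f \<in> L2"
  shows "locally_integrable f"
  unfolding locally_integrable_def
proof (intro conjI allI impI)
  show [measurable]: "f \<in> borel_measurable lborel" using assms by (simp add: L2_def)
  fix K :: "space3 set" assume K: "compact K"
  then have [measurable]: "K \<in> sets borel" by (simp add: borel_closed compact_imp_closed)
  have "integrable lborel (\<lambda>x. indicator K x + (norm (f x))^2)"
    using assms K by (intro Bochner_Integration.integrable_add)
      (auto simp: L2_def emeasure_lborel_cbox_finite intro!: integrable_real_indicator emeasure_compact_finite)
  then show "set_integrable lborel K f"
    unfolding set_integrable_def
  proof (rule Bochner_Integration.integrable_bound)
    have "norm (f x) \<le> 1 + (norm (f x))^2" for x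
      by (smt (verit) power2_eq_square self_le_power power_le_one zero_le_power2 mult_left_le norm_ge_zero one_le_power pos2)
    then show "AE x in lborel. norm (indicator K x *\<^sub>R f x) \<le> norm (indicator K x + (norm (f x))^2)"
      by (intro AE_I2) (auto simp: indicator_def)
  qed measurable
qed

section \<open>The fundamental lemma and density of test functions\<close>

text \<open>
  The pi-lambda theorem for the generator of all open boxes, which is stable under intersection.
\<close>

lemma borel_induct_box [consumes 1, case_names box empty compl union]:
  fixes P :: "space3 set \<Rightarrow> bool"
  assumes A: "A \<in> sets borel"
    and box: "\<And>a b. P (box a b)"
    and empty: "P {}"
    and compl: "\<And>A. A \<in> sets borel \<Longrightarrow> P A \<Longrightarrow> P (- A)"
    and union: "\<And>A. disjoint_family A \<Longrightarrow> range A \<subseteq> sets borel \<Longrightarrow> (\<And>i. P (A i))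
        \<Longrightarrow> P (\<Union>i::nat. A i)"
  shows "P A"
proof -
  let ?G = "range (\<lambda>(a, b). box a b) :: space3 set set"
  have sets: "sets borel = sigma_sets UNIV ?G"
    by (subst borel_eq_box) simp
  have "Int_stable ?G"
    by (auto simp: Int_stable_def box_Int_box)
  from this _ A[unfolded sets] show ?thesis
  proof (rule sigma_sets_induct_disjoint)
    fix A assume "A \<in> sigma_sets UNIV ?G" "P A"
    then show "P (UNIV - A)"
      using compl[of A] by (simp add: sets Compl_eq_Diff_UNIV)
  qed (use box empty union in \<open>auto simp: sets\<close>)
qed

lemma integral_box_eq_0:
  fixes f :: "space3 \<Rightarrow> 'b::euclidean_space"
  assumes f: "locally_integrable f"
    and 0: "\<And>\<phi>. test_function \<phi> \<Longrightarrow> (LINT x|lborel. \<phi> x *\<^sub>R f x) = 0"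
  shows "(LINT x|lborel. indicator (box a b) x *\<^sub>R f x) = 0"
proof -
  have [measurable]: "f \<in> borel_measurable borel" using f by (simp add: locally_integrable_def)
  have "(\<lambda>n. LINT x|lborel. box_cutoff a b n x *\<^sub>R f x)
      \<longlonglongrightarrow> (LINT x|lborel. indicator (box a b) x *\<^sub>R f x)"
  proof (rule integral_dominated_convergence)
    show "integrable lborel (\<lambda>x. norm (indicator (cbox a b) x *\<^sub>R f x))"
      using f by (intro integrable_norm) (auto simp: locally_integrable_def set_integrable_def)
    show "AE x in lborel. (\<lambda>n. box_cutoff a b n x *\<^sub>R f x) \<longlonglongrightarrow> indicator (box a b) x *\<^sub>R f x"
      by (intro AE_I2 tendsto_intros box_cutoff_tendsto)
    show "AE x in lborel. norm (box_cutoff a b n x *\<^sub>R f x) \<le> norm (indicator (cbox a b) x *\<^sub>R f x)" for n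
    proof (rule AE_I2)
      fix x
      have "\<bar>box_cutoff a b n x\<bar> \<le> indicator (cbox a b) x"
        using box_cutoff_bounds[of a b n x] box_subset_cbox[of a b]
        by (auto simp: indicator_def split: if_splits) (auto simp: of_bool_def subset_iff split: if_splits)
      then show "norm (box_cutoff a b n x *\<^sub>R f x) \<le> norm (indicator (cbox a b) x *\<^sub>R f x)"
        by (auto intro!: mult_right_mono)
    qed
    show "(\<lambda>x. box_cutoff a b n x *\<^sub>R f x) \<in> borel_measurable lborel" for n
      using test_function_measurable[OF test_function_box_cutoff[of a b n]] by measurable
  qed measurable
  moreover have "(LINT x|lborel. box_cutoff a b n x *\<^sub>R f x) = 0" for n
    by (rule 0[OF test_function_box_cutoff])
  ultimately show ?thesis
    using LIMSEQ_unique[OF _ tendsto_const] by simp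
qed

abbreviation centred_box :: "nat \<Rightarrow> space3 set" where
  "centred_box n \<equiv> box (- (real n *\<^sub>R One)) (real n *\<^sub>R One)"

lemma UN_centred_box: "(\<Union>n. centred_box n) = UNIV"
  using UN_box_eq_UNIV by simp

text \<open>
  The fundamental lemma of the calculus of variations. The cutoffs show that the integral of \<open>f\<close> vanishes
  over every box; by the pi-lambda theorem it vanishes over every Borel subset of a fixed box.
\<close>

lemma AE_zero_of_test_integrals:
  fixes f :: "space3 \<Rightarrow> 'b::euclidean_space"
  assumes f: "locally_integrable f"
    and 0: "\<And>\<phi>. test_function \<phi> \<Longrightarrow> (LINT x|lborel. \<phi> x *\<^sub>R f x) = 0"
  shows "AE x in lborel. f x = 0"
proof -
  have [measurable]: "f \<in> borel_measurable borel" using f by (simp add: locally_integrable_def)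
  note box = integral_box_eq_0[OF f 0]
  have "AE x in lborel. indicator (centred_box n) x *\<^sub>R f x = 0" for n
  proof -
    define g where "g x = indicator (centred_box n) x *\<^sub>R f x" for x
    have g: "integrable lborel g"
    proof (rule Bochner_Integration.integrable_bound)
      show "integrable lborel (\<lambda>x. indicator (cbox (- (real n *\<^sub>R One)) (real n *\<^sub>R One)) x *\<^sub>R f x)"
        using f by (auto simp: locally_integrable_def set_integrable_def)
      show "AE x in lborel. norm (g x) \<le> norm (indicator (cbox (- (real n *\<^sub>R One)) (real n *\<^sub>R One)) x *\<^sub>R f x)"
        using box_subset_cbox[of "- (real n *\<^sub>R One)" "real n *\<^sub>R One"]
        by (intro AE_I2) (auto simp: g_def indicator_def)
    qed (simp add: g_def[abs_def])
    have gi: "set_integrable lborel A g" if "A \<in> sets borel" for A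
      using integrable_mult_indicator[OF _ g, of A] that by (simp add: set_integrable_def)
    have "set_lebesgue_integral lborel A g = 0" if "A \<in> sets borel" for A
      using that
    proof (induction rule: borel_induct_box)
      case (box a b)
      have "indicator (box a b) x *\<^sub>R g x = indicator (box a b \<inter> centred_box n) x *\<^sub>R f x" for x
        by (auto simp: g_def indicator_def)
      then show ?case
        using integral_box_eq_0[OF f 0] by (simp add: set_lebesgue_integral_def box_Int_box)
    next
      case empty
      show ?case by (simp add: set_lebesgue_integral_def)
    next
      case (compl A)
      have "integral\<^sup>L lborel g = 0"
        using integral_box_eq_0[OF f 0] by (simp add: g_def[abs_def])
      moreover have "indicator (- A) x *\<^sub>R g x = g x - indicator A x *\<^sub>R g x" for x
        by (auto simp: indicator_def)
      then have "set_lebesgue_integral lborel (- A) g = integral\<^sup>L lborel g - set_lebesgue_integral lborel A g"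
        using g gi[OF compl(1)] by (simp add: set_lebesgue_integral_def set_integrable_def)
      ultimately show ?case using compl by simp
    next
      case (union A)
      then have "set_lebesgue_integral lborel (\<Union>i. A i) g = (\<Sum>i. set_lebesgue_integral lborel (A i) g)"
        by (intro lebesgue_integral_countable_add gi) (auto simp: disjoint_family_on_def)
      then show ?case using union by simp
    qed
    then have "AE x in lborel. g x = 0"
      using g by (intro sigma_finite_measure.density_zero[OF sigma_finite_lborel]) auto
    then show ?thesis by (simp add: g_def)
  qed
  then have "AE x in lborel. \<forall>n. indicator (centred_box n) x *\<^sub>R f x = 0"
    by (subst AE_all_countable) blast
  then show ?thesis
  proof eventually_elim
    case (elim x)
    obtain n where "x \<in> centred_box n" using UN_centred_box by blast
    with elim[rule_format, of n] show ?case by simp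
  qed
qed

text \<open>
  Membership in the closure of the test functions in \<open>L2\<close>.
\<close>

definition approximable :: "(space3 \<Rightarrow> real) \<Rightarrow> bool" where
  "approximable f \<longleftrightarrow> f \<in> borel_measurable borel \<and>
     (\<forall>e>0. \<exists>\<phi>. test_function \<phi> \<and> sq_mass (\<lambda>x. f x - \<phi> x) < ennreal e)"

lemma approximableE:
  assumes "approximable f" "e > 0"
  obtains \<phi> where "test_function \<phi>" "sq_mass (\<lambda>x. f x - \<phi> x) < ennreal e"
  using assms unfolding approximable_def by blast

text \<open>
  This takes the place of the triangle inequality of the \<open>L2\<close> norm; the factor \<open>2\<close> is the price for
  staying with squares.
\<close>

lemma nn_integral_sq_diff_triangle:
  fixes f g h :: "'a::euclidean_space \<Rightarrow> real"
  assumes [measurable]: "f \<in> borel_measurable borel" "g \<in> borel_measurable borel" "h \<in> borel_measurable borel"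
  shows "sq_mass (\<lambda>x. f x - h x) \<le>
    2 * sq_mass (\<lambda>x. f x - g x) + 2 * sq_mass (\<lambda>x. g x - h x)"
proof -
  have *: "(a - c)^2 \<le> 2 * (a - b)^2 + 2 * (b - c)^2" for a b c :: real
    using zero_le_power2[of "(a - b) - (b - c)"] by (simp add: power2_eq_square algebra_simps)
  have "ennreal ((f x - h x)^2) \<le> 2 * ennreal ((f x - g x)^2) + 2 * ennreal ((g x - h x)^2)" for x
  proof -
    have "ennreal ((f x - h x)^2) \<le> ennreal (2 * (f x - g x)^2 + 2 * (g x - h x)^2)"
      by (intro ennreal_leI *)
    then show ?thesis by (simp add: ennreal_plus ennreal_mult)
  qed
  then have "sq_mass (\<lambda>x. f x - h x) \<le>
      (\<integral>\<^sup>+x. 2 * ennreal ((f x - g x)^2) + 2 * ennreal ((g x - h x)^2) \<partial>lborel)"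
    by (intro nn_integral_mono)
  also have "\<dots> = 2 * sq_mass (\<lambda>x. f x - g x) + 2 * sq_mass (\<lambda>x. g x - h x)"
    by (simp add: nn_integral_add nn_integral_cmult)
  finally show ?thesis .
qed

lemma ennreal_twice_quarter_add:
  fixes a b :: ennreal
  assumes "a < ennreal (e / 4)" "b < ennreal (e / 4)"
  shows "2 * a + 2 * b < ennreal e"
proof -
  obtain r s where rs: "a = ennreal r" "b = ennreal s" "r \<ge> 0" "s \<ge> 0"
    using assms by (cases a; cases b) auto
  with assms have "r < e / 4" "s < e / 4" by (simp_all add: ennreal_less_iff)
  then have "ennreal (2 * r + 2 * s) < ennreal e"
    using rs by (intro ennreal_lessI) auto
  then show ?thesis
    using rs by (simp add: ennreal_plus ennreal_mult)
qed

lemma approximable_closed: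
  assumes [measurable]: "f \<in> borel_measurable borel"
    and *: "\<And>e. e > 0 \<Longrightarrow> \<exists>g. approximable g \<and> sq_mass (\<lambda>x. f x - g x) < ennreal e"
  shows "approximable f"
  unfolding approximable_def
proof (intro conjI allI impI)
  fix e :: real assume "e > 0"
  then obtain g where g: "approximable g" "sq_mass (\<lambda>x. f x - g x) < ennreal (e / 4)"
    using *[of "e / 4"] by auto
  from approximableE[OF g(1), of "e / 4"] \<open>e > 0\<close> obtain \<phi>
    where \<phi>: "test_function \<phi>" "sq_mass (\<lambda>x. g x - \<phi> x) < ennreal (e / 4)"
    by auto
  have [measurable]: "g \<in> borel_measurable borel" "\<phi> \<in> borel_measurable borel"
    using g(1) \<phi>(1) by (auto simp: approximable_def test_function_measurable)
  have "sq_mass (\<lambda>x. f x - \<phi> x) \<le>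
      2 * sq_mass (\<lambda>x. f x - g x) + 2 * sq_mass (\<lambda>x. g x - \<phi> x)"
    by (rule nn_integral_sq_diff_triangle) measurable
  also have "\<dots> < ennreal e"
    using g(2) \<phi>(2) by (rule ennreal_twice_quarter_add)
  finally show "\<exists>\<phi>. test_function \<phi> \<and> sq_mass (\<lambda>x. f x - \<phi> x) < ennreal e"
    using \<phi>(1) by blast
qed fact

text \<open>
  Dominated convergence turns pointwise limits into limits in \<open>L2\<close>. Boxes, Borel sets and monotone limits
  of functions are all reached in this way.
\<close>

lemma approximable_dominated:
  assumes U: "\<And>i. approximable (U i)"
    and [measurable]: "f \<in> borel_measurable borel" "w \<in> borel_measurable borel"
    and lim: "\<And>x. (\<lambda>i. U i x) \<longlonglongrightarrow> f x"
    and bound: "\<And>i x. (f x - U i x)^2 \<le> w x"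
    and w: "(\<integral>\<^sup>+x. ennreal (w x) \<partial>lborel) < \<infinity>"
  shows "approximable f"
proof (rule approximable_closed)
  have [measurable]: "U i \<in> borel_measurable borel" for i
    using U[of i] by (simp add: approximable_def)
  have "(\<lambda>i. sq_mass (\<lambda>x. f x - U i x)) \<longlonglongrightarrow> (\<integral>\<^sup>+x. 0 \<partial>(lborel :: space3 measure))"
  proof (rule nn_integral_dominated_convergence[where w="\<lambda>x. ennreal (w x)"])
    show "AE x in lborel. (\<lambda>i. ennreal ((f x - U i x)^2)) \<longlonglongrightarrow> 0"
    proof (rule AE_I2)
      fix x
      have "(\<lambda>i. ennreal ((f x - U i x)^2)) \<longlonglongrightarrow> ennreal ((f x - f x)^2)"
        by (intro tendsto_intros lim)
      then show "(\<lambda>i. ennreal ((f x - U i x)^2)) \<longlonglongrightarrow> 0" by simp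
    qed
  qed (use bound w in \<open>auto intro!: ennreal_leI\<close>)
  then have lim0: "(\<lambda>i. sq_mass (\<lambda>x. f x - U i x)) \<longlonglongrightarrow> 0" by simp
  fix e :: real assume "e > 0"
  then have "eventually (\<lambda>i. sq_mass (\<lambda>x. f x - U i x) < ennreal e) sequentially"
    using lim0 by (intro order_tendstoD(2)) auto
  then obtain i where "sq_mass (\<lambda>x. f x - U i x) < ennreal e"
    by (auto simp: eventually_sequentially)
  with U show "\<exists>g. approximable g \<and> sq_mass (\<lambda>x. f x - g x) < ennreal e" by blast
qed fact

lemma approximable_test_function: "test_function \<phi> \<Longrightarrow> approximable \<phi>"
  unfolding approximable_def
  by (auto intro!: exI[of _ \<phi>] test_function_measurable)

lemma approximable_add_cmult:
  assumes "approximable f" "approximable g"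
  shows "approximable (\<lambda>x. f x + c * g x)"
  unfolding approximable_def
proof (intro conjI allI impI)
  have [measurable]: "f \<in> borel_measurable borel" "g \<in> borel_measurable borel"
    using assms by (auto simp: approximable_def)
  show "(\<lambda>x. f x + c * g x) \<in> borel_measurable borel" by measurable
  fix e :: real assume "e > 0"
  define k where "k = c^2 + 1"
  define \<eta> where "\<eta> = e / 4 / k"
  have k: "k > 0" by (auto simp: k_def intro: add_nonneg_pos)
  then have \<eta>: "e / 4 > 0" "\<eta> > 0" using \<open>e > 0\<close> by (auto simp: \<eta>_def)
  obtain \<phi> where \<phi>: "test_function \<phi>" "sq_mass (\<lambda>x. f x - \<phi> x) < ennreal (e / 4)"
    using approximableE[OF assms(1) \<eta>(1)] .
  obtain \<psi> where \<psi>: "test_function \<psi>" "sq_mass (\<lambda>x. g x - \<psi> x) < ennreal \<eta>"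
    using approximableE[OF assms(2) \<eta>(2)] .
  have [measurable]: "\<phi> \<in> borel_measurable borel" "\<psi> \<in> borel_measurable borel"
    using \<phi>(1) \<psi>(1) by (auto simp: test_function_measurable)
  have "sq_mass (\<lambda>x. c * (g x - \<psi> x)) = ennreal (c^2) * sq_mass (\<lambda>x. g x - \<psi> x)"
    by (simp add: power_mult_distrib ennreal_mult nn_integral_cmult)
  also have "\<dots> \<le> ennreal (c^2) * ennreal \<eta>"
    using \<psi>(2) by (intro mult_left_mono) auto
  also have "\<dots> = ennreal (c^2 * \<eta>)" using \<eta> by (simp add: ennreal_mult)
  also have "\<dots> < ennreal (e / 4)"
  proof (rule ennreal_lessI[OF \<eta>(1)])
    have "k * \<eta> = e / 4" using k by (simp add: \<eta>_def)
    with \<eta>(2) show "c^2 * \<eta> < e / 4" by (simp add: k_def distrib_right)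
  qed
  finally have g: "sq_mass (\<lambda>x. c * (g x - \<psi> x)) < ennreal (e / 4)" .
  have "sq_mass (\<lambda>x. f x + c * g x - (\<phi> x + c * \<psi> x)) \<le>
      2 * sq_mass (\<lambda>x. f x + c * g x - (\<phi> x + c * g x)) +
      2 * sq_mass (\<lambda>x. \<phi> x + c * g x - (\<phi> x + c * \<psi> x))"
    by (rule nn_integral_sq_diff_triangle) measurable
  also have "\<dots> = 2 * sq_mass (\<lambda>x. f x - \<phi> x) + 2 * sq_mass (\<lambda>x. c * (g x - \<psi> x))"
    by (simp add: right_diff_distrib)
  also have "\<dots> < ennreal e"
    using \<phi>(2) g by (rule ennreal_twice_quarter_add)
  finally show "\<exists>\<phi>. test_function \<phi> \<and> sq_mass (\<lambda>x. f x + c * g x - \<phi> x) < ennreal e"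
    using test_function_add[OF \<phi>(1) test_function_scale[OF \<psi>(1)]] by blast
qed

lemma approximable_zero: "approximable (\<lambda>x. 0)"
  by (rule approximable_test_function[OF test_function_zero])

lemma approximable_add:
  "approximable f \<Longrightarrow> approximable g \<Longrightarrow> approximable (\<lambda>x. f x + g x)"
  using approximable_add_cmult[of f g 1] by simp

lemma approximable_cmult: "approximable f \<Longrightarrow> approximable (\<lambda>x. c * f x)"
  using approximable_add_cmult[OF approximable_zero, of f c] by simp

lemma approximable_diff:
  "approximable f \<Longrightarrow> approximable g \<Longrightarrow> approximable (\<lambda>x. f x - g x)"
  using approximable_add_cmult[of f g "- 1"] by simp

lemma approximable_box: "approximable (indicator (box a b))"
proof (rule approximable_dominated[where U="box_cutoff a b" and w="indicator (box a b)"])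
  show "approximable (box_cutoff a b i)" for i
    by (intro approximable_test_function test_function_box_cutoff)
  show "(\<lambda>i. box_cutoff a b i x) \<longlonglongrightarrow> indicator (box a b) x" for x
    by (rule box_cutoff_tendsto)
  show "(indicator (box a b) x - box_cutoff a b i x)^2 \<le> indicator (box a b) x" for i x
    using box_cutoff_bounds[of a b i x] by (auto simp: indicator_def power_le_one split: if_splits)
qed (auto simp: ennreal_indicator emeasure_lborel_box_finite[unfolded infinity_ennreal_def])

lemma approximable_indicator_box:
  assumes "A \<in> sets borel"
  shows "approximable (indicator (A \<inter> centred_box n))"
  using assms
proof (induction rule: borel_induct_box)
  case (box a b)
  then show ?case by (simp add: box_Int_box approximable_box)
next
  case empty
  then show ?case
    using approximable_zero by (simp add: indicator_def)
next
  case (compl A)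
  have "indicator (- A \<inter> centred_box n) =
      (\<lambda>x. indicator (centred_box n) x - indicator (A \<inter> centred_box n) x :: real)"
    by (auto simp: indicator_def)
  with compl approximable_diff[OF approximable_box] show ?case by simp
next
  case (union A)
  have [measurable]: "A i \<in> sets borel" for i using union(2) by auto
  have fin: "approximable (indicator (\<Union>i<k. A i \<inter> centred_box n))" for k :: nat
  proof (induction k)
    case 0
    then show ?case
      using approximable_zero by (simp add: indicator_def)
  next
    case (Suc k)
    have disj: "x \<notin> A i" if "x \<in> A k" "i < k" for x i
      using union(1) that unfolding disjoint_family_on_def by (metis UNIV_I disjoint_iff less_irrefl)
    have "indicator (\<Union>i<Suc k. A i \<inter> centred_box n) = (\<lambda>x.
        indicator (\<Union>i<k. A i \<inter> centred_box n) x + indicator (A k \<inter> centred_box n) x :: real)"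
      using disj by (auto simp: indicator_def lessThan_Suc fun_eq_iff)
    with approximable_add[OF Suc union(3)[of k]] show ?case by simp
  qed
  show ?case
  proof (rule approximable_dominated[OF fin, where w="indicator (centred_box n)"])
    show "(\<lambda>k. indicator (\<Union>i<k. A i \<inter> centred_box n) x :: real) \<longlonglongrightarrow> indicator ((\<Union>i. A i) \<inter> centred_box n) x" for x
    proof -
      have "(\<Union>i. A i \<inter> centred_box n) = (\<Union>i. A i) \<inter> centred_box n" by blast
      then show ?thesis
        using LIMSEQ_indicator_UN[of "\<lambda>i. A i \<inter> centred_box n" x] by (simp only:)
    qed
    show "(indicator ((\<Union>i. A i) \<inter> centred_box n) x - indicator (\<Union>i<k. A i \<inter> centred_box n) x)^2
        \<le> (indicator (centred_box n) x :: real)" for k x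
      by (auto simp: indicator_def)
  qed (auto simp: ennreal_indicator emeasure_lborel_box_finite[unfolded infinity_ennreal_def])
qed

lemma approximable_indicator:
  assumes [measurable]: "A \<in> sets borel" and "emeasure lborel A < \<infinity>"
  shows "approximable (indicator A)"
proof (rule approximable_dominated[OF approximable_indicator_box[OF assms(1)], where w="indicator A"])
  fix x
  obtain N where N: "x \<in> centred_box N" using UN_centred_box by blast
  have "eventually (\<lambda>n. indicator (A \<inter> centred_box n) x = (indicator A x :: real)) sequentially"
  proof (rule eventually_sequentiallyI)
    fix n assume "N \<le> n"
    then have "x \<in> centred_box n"
      using N \<open>N \<le> n\<close> by (force simp: mem_box inner_sum_left inner_Basis)
    then show "indicator (A \<inter> centred_box n) x = (indicator A x :: real)"
      by (auto simp: indicator_def)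
  qed
  then show "(\<lambda>n. indicator (A \<inter> centred_box n) x :: real) \<longlonglongrightarrow> indicator A x"
    by (rule tendsto_eventually)
  show "(indicator A x - indicator (A \<inter> centred_box n) x)^2 \<le> (indicator A x :: real)" for n
    by (auto simp: indicator_def)
qed (use assms in \<open>auto simp: ennreal_indicator\<close>)

lemma approximable_nonneg:
  assumes "f \<in> borel_measurable lborel" "\<And>x. 0 \<le> f x" "integrable lborel (\<lambda>x. (f x)^2)"
  shows "approximable f"
  using assms
proof (induction rule: borel_measurable_induct_real)
  case (set A)
  have "(\<lambda>x. (indicator A x :: real)^2) = indicator A"
    by (auto simp: indicator_def)
  with set.prems have "emeasure lborel A < \<infinity>"
    by (simp add: integrable_indicator_iff)
  with set show ?case by (intro approximable_indicator) auto
next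
  case (mult u c)
  show ?case
  proof (cases "c = 0")
    case True
    then show ?thesis using approximable_zero by simp
  next
    case False
    then have "integrable lborel (\<lambda>x. (u x)^2)"
      using mult.prems by (simp add: power_mult_distrib)
    then show ?thesis by (intro approximable_cmult mult.IH)
  qed
next
  case (add u v)
  have "integrable lborel (\<lambda>x. (u x)^2)" "integrable lborel (\<lambda>x. (v x)^2)"
    using add.hyps by (auto intro!: Bochner_Integration.integrable_bound[OF add.prems] AE_I2 power_mono)
  with add.IH show ?case by (intro approximable_add)
next
  case (seq U)
  have le: "U i x \<le> f x" for i x
    using seq.hyps(3,4) by (intro incseq_le[of "\<lambda>i. U i x"]) (auto simp: incseq_def le_fun_def)
  have "integrable lborel (\<lambda>x. (U i x)^2)" for i
    by (rule Bochner_Integration.integrable_bound[OF seq.prems])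
       (use seq.hyps(1,2) le in \<open>auto intro!: AE_I2 power_mono\<close>)
  then have U: "approximable (U i)" for i by (rule seq.IH)
  have m: "f \<in> borel_measurable borel"
    by (rule borel_measurable_LIMSEQ_real[of _ U]) (use seq.hyps(1,4) in auto)
  show ?case
  proof (rule approximable_dominated[OF U m, where w="\<lambda>x. (f x)^2"])
    show "(\<lambda>x. (f x)^2) \<in> borel_measurable borel" using m by measurable
    show "(f x - U i x)^2 \<le> (f x)^2" for i x
      using le[of i x] seq.hyps(2)[of i x] by (intro power_mono) auto
    show "sq_mass f < \<infinity>"
      using seq.prems by (simp add: nn_integral_eq_integral)
  qed (use seq.hyps(4) in auto)
qed

text \<open>
  Approximability passes from boxes to Borel subsets of a box by the pi-lambda theorem, from there to
  sets of finite measure by exhaustion, and to nonnegative functions by monotone approximation.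
\<close>

theorem test_functions_dense_L2:
  fixes f :: "space3 \<Rightarrow> real"
  assumes [measurable]: "f \<in> borel_measurable borel" and f: "integrable lborel (\<lambda>x. (f x)^2)"
  shows "approximable f"
proof -
  have "approximable (\<lambda>x. max 0 (f x))" "approximable (\<lambda>x. max 0 (- f x))"
    by (auto intro!: approximable_nonneg Bochner_Integration.integrable_bound[OF f] AE_I2
        simp: max_def)
  then have "approximable (\<lambda>x. max 0 (f x) - max 0 (- f x))"
    by (rule approximable_diff)
  moreover have "max 0 (f x) - max 0 (- f x) = f x" for x by (simp add: max_def)
  ultimately show ?thesis by simp
qed

section \<open>Weak gradients and translations\<close>

lemma locally_integrable_diff:
  fixes f g :: "space3 \<Rightarrow> 'b::euclidean_space"
  assumes "locally_integrable f" "locally_integrable g"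
  shows "locally_integrable (\<lambda>x. f x - g x)"
  using assms by (auto simp: locally_integrable_def intro: set_integral_diff)

lemma locally_integrable_nth:
  fixes v :: "space3 \<Rightarrow> complex ^ 3"
  assumes "locally_integrable v"
  shows "locally_integrable (\<lambda>x. v x $ i)"
  unfolding locally_integrable_def
proof (intro conjI allI impI)
  have [measurable]: "v \<in> borel_measurable borel" using assms by (simp add: locally_integrable_def)
  have "(\<lambda>y::complex^3. y $ i) \<in> borel_measurable borel"
    by (intro borel_measurable_continuous_onI continuous_intros)
  then show "(\<lambda>x. v x $ i) \<in> borel_measurable lborel" by measurable
  fix K :: "space3 set" assume "compact K"
  then have "integrable lborel (\<lambda>x. indicator K x *\<^sub>R v x)"
    using assms by (auto simp: locally_integrable_def set_integrable_def)
  from integrable_bounded_linear[OF bounded_linear_vec_nth[of i] this]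
  show "set_integrable lborel K (\<lambda>x. v x $ i)"
    by (simp add: set_integrable_def)
qed

lemma weak_gradient_diff:
  assumes "is_weak_gradient u v" "is_weak_gradient u' v'"
  shows "is_weak_gradient (\<lambda>x. u x - u' x) (\<lambda>x. v x - v' x)"
  unfolding is_weak_gradient_def
proof (intro conjI allI impI)
  have l: "locally_integrable u" "locally_integrable u'" "locally_integrable v" "locally_integrable v'"
    using assms by (auto simp: is_weak_gradient_def)
  then show "locally_integrable (\<lambda>x. u x - u' x)" "locally_integrable (\<lambda>x. v x - v' x)"
    by (auto intro: locally_integrable_diff)
  fix \<phi> i assume \<phi>: "test_function \<phi>"
  note i = integrable_test_function_scaleR[OF \<phi>]
  have "(LINT x|lborel. frechet_derivative \<phi> (at x) (axis i 1) *\<^sub>R u x) = - (LINT x|lborel. \<phi> x *\<^sub>R (v x $ i))"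
    "(LINT x|lborel. frechet_derivative \<phi> (at x) (axis i 1) *\<^sub>R u' x) = - (LINT x|lborel. \<phi> x *\<^sub>R (v' x $ i))"
    using assms \<phi> by (auto simp: is_weak_gradient_def)
  then show "(LINT x|lborel. frechet_derivative \<phi> (at x) (axis i 1) *\<^sub>R (u x - u' x)) =
      - (LINT x|lborel. \<phi> x *\<^sub>R ((v x - v' x) $ i))"
    using l by (simp add: scaleR_diff_right i locally_integrable_nth)
qed

lemma weak_gradient_unique:
  assumes "is_weak_gradient u v" "is_weak_gradient u v'"
  shows "AE x in lborel. v x = v' x"
proof -
  have d: "is_weak_gradient (\<lambda>x. 0) (\<lambda>x. v x - v' x)"
    using weak_gradient_diff[OF assms] by simp
  have "AE x in lborel. (v x - v' x) $ i = 0" for i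
  proof (rule AE_zero_of_test_integrals)
    show "locally_integrable (\<lambda>x. (v x - v' x) $ i)"
      using d by (intro locally_integrable_nth) (simp add: is_weak_gradient_def)
    show "(LINT x|lborel. \<phi> x *\<^sub>R ((v x - v' x) $ i)) = 0" if "test_function \<phi>" for \<phi>
      using d that by (simp add: is_weak_gradient_def)
  qed
  then have "AE x in lborel. \<forall>i. (v x - v' x) $ i = 0"
    by (subst AE_all_countable) blast
  then show ?thesis by eventually_elim (simp add: vec_eq_iff)
qed

text \<open>
  The choice made by \<open>weak_grad\<close> only promises local integrability. Uniqueness transfers square
  integrability to it from the weak gradient that membership in \<open>H1\<close> provides.
\<close>

lemma H1_weak_grad:
  assumes "u \<in> H1"
  shows "is_weak_gradient u (weak_grad u)" "weak_grad u \<in> L2"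
proof -
  obtain v where v: "v \<in> L2" "is_weak_gradient u v" using assms by (auto simp: H1_def)
  then show *: "is_weak_gradient u (weak_grad u)"
    unfolding weak_grad_def by (metis someI)
  then have [measurable]: "weak_grad u \<in> borel_measurable borel" "v \<in> borel_measurable borel"
    using v by (auto simp: is_weak_gradient_def locally_integrable_def)
  have "AE x in lborel. v x = weak_grad u x" by (rule weak_gradient_unique[OF v(2) *])
  then have "integrable lborel (\<lambda>x. (norm (v x))^2) \<longleftrightarrow> integrable lborel (\<lambda>x. (norm (weak_grad u x))^2)"
    by (intro integrable_cong_AE) auto
  then show "weak_grad u \<in> L2" using v(1) by (simp add: L2_def)
qed

lemma H1I:
  assumes "u \<in> L2" "v \<in> L2" "is_weak_gradient u v"
  shows "u \<in> H1" "AE x in lborel. weak_grad u x = v x"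
proof -
  show "u \<in> H1" using assms by (auto simp: H1_def)
  from weak_gradient_unique[OF H1_weak_grad(1)[OF this] assms(3)]
  show "AE x in lborel. weak_grad u x = v x" .
qed

lemma A_fun_eq:
  assumes "u \<in> L2" "v \<in> L2" "is_weak_gradient u v"
  shows "A_fun u = (LINT x|lborel. (norm (v x))^2)"
  unfolding A_fun_def
proof (rule integral_cong_AE)
  show "(\<lambda>x. (norm (weak_grad u x))^2) \<in> borel_measurable lborel"
    using H1_weak_grad(2)[OF H1I(1)[OF assms]] by (auto simp: L2_def)
  show "(\<lambda>x. (norm (v x))^2) \<in> borel_measurable lborel"
    using assms by (auto simp: L2_def)
qed (use H1I(2)[OF assms] in auto)

lemma Lnorm_powr:
  assumes "s > 0"
  shows "Lnorm s u powr s = (LINT x|lborel. norm (u x) powr s)"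
  using assms by (simp add: Lnorm_def powr_powr)

lemma Lnorm_2_sq: "(Lnorm 2 u)^2 = (LINT x|lborel. (norm (u x))^2)"
proof -
  have "(Lnorm 2 u)^2 = Lnorm 2 u powr 2"
    by (subst powr_numeral) (auto simp: Lnorm_def)
  also have "\<dots> = (LINT x|lborel. norm (u x) powr 2)" by (rule Lnorm_powr) simp
  finally show ?thesis by (simp add: powr_numeral)
qed

lemma H1_norm_sq: "(H1_norm u)^2 = (LINT x|lborel. (norm (u x))^2) + A_fun u"
  by (simp add: H1_norm_def Lnorm_2_sq A_fun_def)

lemma H1_norm_nonneg: "H1_norm u \<ge> 0"
  by (simp add: H1_norm_def)

lemma A_fun_nonneg: "A_fun u \<ge> 0"
  by (simp add: A_fun_def)

lemma norm_diff_sq_le: "(norm (a - b))^2 \<le> 2 * (norm a)^2 + 2 * (norm (b :: 'a::real_normed_vector))^2"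
proof -
  have "(norm (a - b))^2 \<le> (norm a + norm b)^2"
    by (intro power_mono norm_triangle_ineq4) auto
  also have "\<dots> \<le> 2 * (norm a)^2 + 2 * (norm b)^2"
    using zero_le_power2[of "norm a - norm b"] by (simp add: power2_eq_square algebra_simps)
  finally show ?thesis .
qed

lemma L2_diff:
  fixes f g :: "space3 \<Rightarrow> 'b::euclidean_space"
  assumes "f \<in> L2" "g \<in> L2"
  shows "(\<lambda>x. f x - g x) \<in> L2"
proof -
  have [measurable]: "f \<in> borel_measurable borel" "g \<in> borel_measurable borel"
    using assms by (auto simp: L2_def)
  have "integrable lborel (\<lambda>x. 2 * (norm (f x))^2 + 2 * (norm (g x))^2)"
    using assms by (auto simp: L2_def)
  then have "integrable lborel (\<lambda>x. (norm (f x - g x))^2)"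
    by (rule Bochner_Integration.integrable_bound) (auto intro!: AE_I2 norm_diff_sq_le[THEN order_trans])
  then show ?thesis by (simp add: L2_def)
qed

lemma H1_L2: "u \<in> H1 \<Longrightarrow> u \<in> L2" by (simp add: H1_def)

lemma H1_measurable: "u \<in> H1 \<Longrightarrow> u \<in> borel_measurable borel"
  by (simp add: H1_def L2_def)

lemma H1_diff:
  assumes "u \<in> H1" "w \<in> H1"
  shows "(\<lambda>x. u x - w x) \<in> H1"
    and "A_fun (\<lambda>x. u x - w x) = (LINT x|lborel. (norm (weak_grad u x - weak_grad w x))^2)"
proof -
  note d = weak_gradient_diff[OF H1_weak_grad(1)[OF assms(1)] H1_weak_grad(1)[OF assms(2)]]
  note L = L2_diff[OF H1_L2[OF assms(1)] H1_L2[OF assms(2)]]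
    L2_diff[OF H1_weak_grad(2)[OF assms(1)] H1_weak_grad(2)[OF assms(2)]]
  show "(\<lambda>x. u x - w x) \<in> H1" by (rule H1I(1)[OF L d])
  show "A_fun (\<lambda>x. u x - w x) = (LINT x|lborel. (norm (weak_grad u x - weak_grad w x))^2)"
    by (rule A_fun_eq[OF L d])
qed

lemma H1_norm_minus_commute:
  assumes "u \<in> H1" "w \<in> H1"
  shows "H1_norm (\<lambda>x. u x - w x) = H1_norm (\<lambda>x. w x - u x)"
proof -
  have "(H1_norm (\<lambda>x. u x - w x))^2 = (H1_norm (\<lambda>x. w x - u x))^2"
    by (simp add: H1_norm_sq H1_diff assms norm_minus_commute)
  then show ?thesis by (simp add: H1_norm_nonneg power2_eq_iff_nonneg)
qed

lemma frechet_derivative_translate: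
  assumes "test_function \<phi>"
  shows "frechet_derivative (\<lambda>x. \<phi> (x - a)) (at x) = frechet_derivative \<phi> (at (x - a))"
proof -
  have "((\<lambda>x. x - a) has_derivative (\<lambda>h. h)) (at x)"
    by (auto intro!: derivative_eq_intros)
  from has_derivative_compose[OF this test_function_has_derivative[OF assms]]
  have D: "((\<lambda>x. \<phi> (x - a)) has_derivative frechet_derivative \<phi> (at (x - a))) (at x)" .
  show ?thesis using frechet_derivative_at[OF D] by simp
qed

lemma test_function_translate: "test_function \<phi> \<Longrightarrow> test_function (\<lambda>x. \<phi> (x - a))"
  using test_function_affine[of \<phi> 1 1 "- a"] by (simp add: algebra_simps)

lemma test_function_line_derivative:
  assumes "test_function \<phi>"
  shows "((\<lambda>s. \<phi> (x - s *\<^sub>R h)) has_real_derivative - frechet_derivative \<phi> (at (x - s *\<^sub>R h)) h) (at s)"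
proof -
  have 1: "((\<lambda>s. x - s *\<^sub>R h) has_derivative (\<lambda>r. - (r *\<^sub>R h))) (at s)"
    by (auto intro!: derivative_eq_intros)
  have lin: "linear (frechet_derivative \<phi> (at y))" for y
    using test_function_has_derivative[OF assms] has_derivative_linear by blast
  show ?thesis
    unfolding has_field_derivative_def
    by (rule has_derivative_eq_rhs[OF has_derivative_compose[OF 1 test_function_has_derivative[OF assms]]])
       (simp add: fun_eq_iff linear_neg[OF lin] linear_scale[OF lin])
qed

text \<open>
  Differentiation under the integral sign. The difference quotients are dominated by \<open>M |u|\<close> on a fixed
  ball, where \<open>M\<close> bounds the derivative of \<open>\<phi>\<close> in direction \<open>h\<close>.
\<close>

lemma translated_pairing_derivative:
  fixes u :: "space3 \<Rightarrow> real"
  assumes \<phi>: "test_function \<phi>" and u: "locally_integrable u"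
  shows "((\<lambda>s. LINT x|lborel. \<phi> (x - s *\<^sub>R h) *\<^sub>R u x) has_real_derivative
      - (LINT x|lborel. frechet_derivative \<phi> (at (x - s *\<^sub>R h)) h *\<^sub>R u x)) (at s)"
proof -
  define D where "D x = frechet_derivative \<phi> (at x) h" for x
  define G where "G s = (LINT x|lborel. \<phi> (x - s *\<^sub>R h) *\<^sub>R u x)" for s
  have [measurable]: "\<phi> \<in> borel_measurable borel" "u \<in> borel_measurable borel"
    using \<phi> u by (auto simp: test_function_measurable locally_integrable_def)
  have "D \<in> borel_measurable borel"
    using test_function_derivative_continuous[OF \<phi>, of h]
    by (auto simp: D_def[abs_def] intro: borel_measurable_continuous_onI)
  note [measurable] = this
  let ?K = "closure {x. \<phi> x \<noteq> 0}"
  have K: "compact ?K" using \<phi> by (simp add: test_function_def)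
  obtain M where M: "M > 0" "\<bar>D x\<bar> \<le> M" for x
  proof (rule continuous_compact_support_bounded[of D, OF _ K])
    show "continuous_on UNIV D"
      using test_function_derivative_continuous[OF \<phi>, of h] by (simp add: D_def[abs_def])
    show "D x = 0" if "x \<notin> ?K" for x
      using frechet_derivative_outside_support[OF \<phi> that] by (simp add: D_def)
  qed blast
  obtain R where R: "\<And>x. \<phi> x \<noteq> 0 \<Longrightarrow> norm x \<le> R"
    using test_function_support_bounded[OF \<phi>] by blast
  have lip: "\<bar>\<phi> (x - t *\<^sub>R h) - \<phi> (x - s *\<^sub>R h)\<bar> \<le> M * \<bar>t - s\<bar>" for x t s
    using field_differentiable_bound[of UNIV "\<lambda>s. \<phi> (x - s *\<^sub>R h)" "\<lambda>s. - D (x - s *\<^sub>R h)" M t s]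
      test_function_line_derivative[OF \<phi>] M(2)
    by (auto simp: D_def)
  have int: "integrable lborel (\<lambda>x. \<phi> (x - s *\<^sub>R h) *\<^sub>R u x)" for s
    by (rule integrable_test_function_scaleR[OF test_function_translate[OF \<phi>] u])
  have "((\<lambda>t. (G t - G s) / (t - s)) \<longlongrightarrow> (LINT x|lborel. - D (x - s *\<^sub>R h) *\<^sub>R u x)) (at s)"
    unfolding tendsto_at_iff_sequentially comp_def
  proof (intro allI impI)
    fix t :: "nat \<Rightarrow> real" assume ts: "\<forall>i. t i \<in> UNIV - {s}" and lim: "t \<longlonglongrightarrow> s"
    then have "Bseq t" by (intro convergent_imp_Bseq convergentI)
    then obtain T where T: "\<And>n. \<bar>t n\<bar> \<le> T" by (auto simp: Bseq_def)
    \<comment> \<open>This ball contains the supports of all translates that occur.\<close>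
    define B where "B = cball (0::space3) (R + (T + \<bar>s\<bar>) * norm h)"
    let ?q = "\<lambda>n x. (\<phi> (x - t n *\<^sub>R h) - \<phi> (x - s *\<^sub>R h)) / (t n - s)"
    have "(G (t n) - G s) / (t n - s) =
        (LINT x|lborel. ?q n x *\<^sub>R u x)" for n
    proof -
      have "G (t n) - G s = (LINT x|lborel. (\<phi> (x - t n *\<^sub>R h) - \<phi> (x - s *\<^sub>R h)) *\<^sub>R u x)"
        unfolding G_def by (subst Bochner_Integration.integral_diff[symmetric])
          (use int[of "t n"] int[of s] in \<open>simp_all add: left_diff_distrib\<close>)
      then show ?thesis by simp
    qed
    moreover have "(\<lambda>n. LINT x|lborel. ?q n x *\<^sub>R u x)
        \<longlonglongrightarrow> (LINT x|lborel. - D (x - s *\<^sub>R h) *\<^sub>R u x)"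
    proof (rule integral_dominated_convergence)
      show "integrable lborel (\<lambda>x. norm (M *\<^sub>R (indicator B x *\<^sub>R u x)))"
        using u by (intro integrable_norm integrable_scaleR_right)
          (auto simp: locally_integrable_def set_integrable_def B_def)
      show "AE x in lborel. (\<lambda>n. ?q n x *\<^sub>R u x)
          \<longlonglongrightarrow> - D (x - s *\<^sub>R h) *\<^sub>R u x"
      proof (intro AE_I2 tendsto_scaleR tendsto_const)
        fix x
        have "((\<lambda>t. (\<phi> (x - t *\<^sub>R h) - \<phi> (x - s *\<^sub>R h)) / (t - s)) \<longlongrightarrow> - D (x - s *\<^sub>R h)) (at s)"
          using test_function_line_derivative[OF \<phi>, of x h s]
          by (simp add: has_field_derivative_iff D_def)
        then show "(\<lambda>n. ?q n x) \<longlonglongrightarrow> - D (x - s *\<^sub>R h)"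
          using ts lim unfolding tendsto_at_iff_sequentially comp_def by blast
      qed
      show "AE x in lborel. norm (?q n x *\<^sub>R u x)
          \<le> norm (M *\<^sub>R (indicator B x *\<^sub>R u x))" for n
      proof (rule AE_I2)
        fix x
        have q: "\<bar>?q n x\<bar> \<le> M"
          using lip[of x "t n" s] ts by (auto simp: abs_divide field_simps)
        have "\<bar>?q n x\<bar> \<le> M * indicator B x"
        proof (cases "x \<in> B")
          case True
          with q show ?thesis by simp
        next
          case False
          have far: "\<phi> (x - r *\<^sub>R h) = 0" if "\<bar>r\<bar> \<le> T + \<bar>s\<bar>" for r
          proof (rule ccontr)
            assume "\<phi> (x - r *\<^sub>R h) \<noteq> 0"
            then have "norm (x - r *\<^sub>R h) \<le> R" by (rule R)
            then have "norm x \<le> R + \<bar>r\<bar> * norm h"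
              using norm_triangle_ineq[of "x - r *\<^sub>R h" "r *\<^sub>R h"] by simp
            also have "\<dots> \<le> R + (T + \<bar>s\<bar>) * norm h"
              using that by (intro add_left_mono mult_right_mono) auto
            finally show False using False by (simp add: B_def)
          qed
          have "T \<ge> 0" using T[of 0] by linarith
          then show ?thesis
            using far[of "t n"] far[of s] T[of n] False by simp
        qed
        then have "\<bar>?q n x\<bar> * norm (u x) \<le> M * indicator B x * norm (u x)"
          by (rule mult_right_mono) auto
        then show "norm (?q n x *\<^sub>R u x)
          \<le> norm (M *\<^sub>R (indicator B x *\<^sub>R u x))"
          using M(1) by (simp add: abs_mult abs_divide mult.assoc)
      qed
    qed measurable
    ultimately show "(\<lambda>n. (G (t n) - G s) / (t n - s)) \<longlonglongrightarrow> (LINT x|lborel. - D (x - s *\<^sub>R h) *\<^sub>R u x)"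
      by (simp only:)
  qed
  then show ?thesis
    by (simp add: has_field_derivative_iff G_def D_def)
qed

lemma test_function_sq_integrable:
  assumes "test_function \<phi>"
  shows "integrable lborel (\<lambda>x. (\<phi> x)^2)"
proof -
  have [measurable]: "\<phi> \<in> borel_measurable borel" using assms by (rule test_function_measurable)
  obtain M where M: "M > 0" "\<bar>\<phi> x\<bar> \<le> M" for x
    using test_function_bounded[OF assms] by blast
  let ?K = "closure {x. \<phi> x \<noteq> 0}"
  have "emeasure lborel ?K < \<infinity>"
    using assms by (intro emeasure_compact_finite) (simp add: test_function_def)
  then have "integrable lborel (\<lambda>x. M^2 * indicator ?K x)"
    by (intro integrable_mult_right integrable_real_indicator) auto
  then show ?thesis
  proof (rule Bochner_Integration.integrable_bound)
    have "(\<phi> x)^2 \<le> M^2 * indicator ?K x" for x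
      using M(2)[of x] closure_subset[of "{x. \<phi> x \<noteq> 0}"]
      by (cases "\<phi> x = 0") (auto simp: indicator_def abs_le_square_iff[symmetric])
    then show "AE x in lborel. norm ((\<phi> x)^2) \<le> norm (M^2 * indicator ?K x)"
      by (intro AE_I2) auto
  qed measurable
qed

text \<open>
  The weak gradient identifies the derivative of \<open>s \<mapsto> \<integral> \<phi>(x - s h) f(x)\<close> with the integral of
  \<open>\<phi>(x - s h) (h \<bullet> w(x))\<close>. Young's inequality then gives a bound that is additive in the two squared norms,
  which is the form of the hypothesis in \<open>sq_integral_le_by_duality\<close>.
\<close>

lemma translation_pairing_bound:
  fixes f :: "space3 \<Rightarrow> real" and w :: "space3 \<Rightarrow> real ^ 3"
  assumes f: "locally_integrable f" and w: "w \<in> L2"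
    and weak: "\<And>\<phi> i. test_function \<phi> \<Longrightarrow>
      (LINT x|lborel. frechet_derivative \<phi> (at x) (axis i 1) * f x) = - (LINT x|lborel. \<phi> x * (w x $ i))"
    and \<phi>: "test_function \<phi>"
  shows "\<bar>(LINT x|lborel. \<phi> (x - h) * f x) - (LINT x|lborel. \<phi> x * f x)\<bar> \<le>
    (LINT x|lborel. (\<phi> x)^2) / 2 + (norm h)^2 * (LINT x|lborel. (norm (w x))^2) / 2"
proof -
  let ?B = "(LINT x|lborel. (\<phi> x)^2) / 2 + (norm h)^2 * (LINT x|lborel. (norm (w x))^2) / 2"
  define G where "G s = (LINT x|lborel. \<phi> (x - s *\<^sub>R h) * f x)" for s
  have [measurable]: "\<phi> \<in> borel_measurable borel" "f \<in> borel_measurable borel" "w \<in> borel_measurable borel"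
    using \<phi> f w by (auto simp: test_function_measurable locally_integrable_def L2_def)
  have \<phi>2: "integrable lborel (\<lambda>x. (\<phi> x)^2)"
    using test_function_sq_integrable[OF \<phi>] .
  have wint: "integrable lborel (\<lambda>x. \<psi> x * (w x $ i))" if "test_function \<psi>" for \<psi> i
  proof -
    have "integrable lborel (\<lambda>x. \<psi> x *\<^sub>R w x)"
      by (rule integrable_test_function_scaleR[OF that locally_integrable_L2[OF w]])
    from integrable_bounded_linear[OF bounded_linear_vec_nth[of i] this]
    show ?thesis by simp
  qed
  have "\<bar>(LINT x|lborel. - frechet_derivative \<phi> (at (x - s *\<^sub>R h)) h * f x)\<bar> \<le> ?B" for s
  proof -
    define \<psi> where "\<psi> x = \<phi> (x - s *\<^sub>R h)" for x
    have \<psi>: "test_function \<psi>" unfolding \<psi>_def by (rule test_function_translate[OF \<phi>])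
    have lin: "linear (frechet_derivative \<psi> (at y))" for y
      using test_function_has_derivative[OF \<psi>] has_derivative_linear by blast
    have "frechet_derivative \<psi> (at x) h = (\<Sum>i\<in>UNIV. h $ i * frechet_derivative \<psi> (at x) (axis i 1))" for x
    proof -
      have "frechet_derivative \<psi> (at x) h = frechet_derivative \<psi> (at x) (\<Sum>i\<in>UNIV. (h $ i) *\<^sub>R axis i 1)"
        by (simp add: basis_expansion scalar_mult_eq_scaleR[symmetric])
      then show ?thesis
        by (simp add: linear_sum[OF lin] linear_scale[OF lin])
    qed
    then have "(LINT x|lborel. - frechet_derivative \<phi> (at (x - s *\<^sub>R h)) h * f x) =
        - (LINT x|lborel. (\<Sum>i\<in>UNIV. h $ i * (frechet_derivative \<psi> (at x) (axis i 1) * f x)))"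
      unfolding \<psi>_def frechet_derivative_translate[OF \<phi>, symmetric]
      by (simp add: sum_distrib_right mult.assoc flip: Bochner_Integration.integral_minus sum_negf)
    also have "\<dots> = - (\<Sum>i\<in>UNIV. h $ i * (LINT x|lborel. frechet_derivative \<psi> (at x) (axis i 1) * f x))"
      using integrable_test_function_scaleR(2)[OF \<psi> f] by (subst Bochner_Integration.integral_sum) auto
    also have "\<dots> = (\<Sum>i\<in>UNIV. h $ i * (LINT x|lborel. \<psi> x * (w x $ i)))"
      by (simp add: weak[OF \<psi>] sum_negf)
    also have "\<dots> = (LINT x|lborel. (\<Sum>i\<in>UNIV. h $ i * (\<psi> x * (w x $ i))))"
      using wint[OF \<psi>] by (subst Bochner_Integration.integral_sum) auto
    also have "\<dots> = (LINT x|lborel. \<psi> x * (h \<bullet> w x))"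
      by (simp add: inner_vec_def sum_distrib_left mult_ac)
    finally have eq: "(LINT x|lborel. - frechet_derivative \<phi> (at (x - s *\<^sub>R h)) h * f x) = (LINT x|lborel. \<psi> x * (h \<bullet> w x))" .
    have \<psi>2: "integrable lborel (\<lambda>x. (\<psi> x)^2)" "(LINT x|lborel. (\<psi> x)^2) = (LINT x|lborel. (\<phi> x)^2)"
      using integrable_lborel_affine[of "\<lambda>x. (\<phi> x)^2" 1 "- (s *\<^sub>R h)"]
        integral_lborel_affine[of "\<lambda>x. (\<phi> x)^2" 1 "- (s *\<^sub>R h)"] \<phi>2
      by (simp_all add: \<psi>_def)
    have w2: "integrable lborel (\<lambda>x. (norm (w x))^2)" using w by (simp add: L2_def)
    have "\<bar>LINT x|lborel. \<psi> x * (h \<bullet> w x)\<bar> \<le> (LINT x|lborel. \<bar>\<psi> x * (h \<bullet> w x)\<bar>)"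
      by (rule integral_abs_bound)
    also have "\<dots> \<le> (LINT x|lborel. (\<psi> x)^2 / 2 + (norm h)^2 * (norm (w x))^2 / 2)"
    proof (rule integral_mono')
      show "integrable lborel (\<lambda>x. (\<psi> x)^2 / 2 + (norm h)^2 * (norm (w x))^2 / 2)"
        using \<psi>2(1) w2 by simp
      fix x
      have "\<bar>\<psi> x * (h \<bullet> w x)\<bar> \<le> \<bar>\<psi> x\<bar> * (norm h * norm (w x))"
        unfolding abs_mult by (intro mult_left_mono Cauchy_Schwarz_ineq2) auto
      also have "\<dots> \<le> (\<psi> x)^2 / 2 + (norm h)^2 * (norm (w x))^2 / 2"
        using zero_le_power2[of "\<bar>\<psi> x\<bar> - norm h * norm (w x)"]
        by (simp add: power2_eq_square algebra_simps)
      finally show "\<bar>\<psi> x * (h \<bullet> w x)\<bar> \<le> (\<psi> x)^2 / 2 + (norm h)^2 * (norm (w x))^2 / 2" .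
    qed auto
    also have "\<dots> = ?B"
      using \<psi>2 w2 by simp
    finally show ?thesis unfolding eq .
  qed
  moreover have "(G has_real_derivative (LINT x|lborel. - frechet_derivative \<phi> (at (x - s *\<^sub>R h)) h * f x)) (at s)" for s
    using translated_pairing_derivative[OF \<phi> f, of h s] by (simp add: G_def[abs_def])
  ultimately have "norm (G 1 - G 0) \<le> ?B * norm (1 - 0 :: real)"
    by (intro field_differentiable_bound[of UNIV G]) auto
  then show ?thesis by (simp add: G_def)
qed

text \<open>
  Take \<open>\<phi>\<close> close to \<open>f\<close>. By polarization \<open>\<phi> f = (f^2 + \<phi>^2 - (f - \<phi>)^2) / 2\<close>, so the terms in \<open>\<phi>^2\<close>
  cancel and the hypothesis bounds the integral of \<open>f^2\<close> up to the approximation error.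
\<close>

lemma sq_integral_le_by_duality:
  fixes f :: "space3 \<Rightarrow> real"
  assumes [measurable]: "f \<in> borel_measurable borel" and f: "integrable lborel (\<lambda>x. (f x)^2)"
    and *: "\<And>\<phi>. test_function \<phi> \<Longrightarrow> (LINT x|lborel. \<phi> x * f x) \<le> (LINT x|lborel. (\<phi> x)^2) / 2 + W / 2"
  shows "(LINT x|lborel. (f x)^2) \<le> W"
proof (rule field_le_epsilon)
  fix e :: real assume "e > 0"
  obtain \<phi> where \<phi>: "test_function \<phi>" "sq_mass (\<lambda>x. f x - \<phi> x) < ennreal e"
    using approximableE[OF test_functions_dense_L2[OF assms(1,2)] \<open>e > 0\<close>] .
  have [measurable]: "\<phi> \<in> borel_measurable borel" using \<phi>(1) by (rule test_function_measurable)
  have \<phi>2: "integrable lborel (\<lambda>x. (\<phi> x)^2)" by (rule test_function_sq_integrable[OF \<phi>(1)])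
  have d: "integrable lborel (\<lambda>x. (f x - \<phi> x)^2)"
    using \<phi>(2) by (intro integrableI_nonneg) (auto intro: less_trans)
  have lt: "(LINT x|lborel. (f x - \<phi> x)^2) < e"
    using \<phi>(2) \<open>e > 0\<close> by (simp add: nn_integral_eq_integral[OF d] ennreal_less_iff)
  have "\<phi> x * f x = ((f x)^2 + (\<phi> x)^2 - (f x - \<phi> x)^2) / 2" for x
    by (simp add: power2_eq_square algebra_simps)
  then have eq: "(LINT x|lborel. \<phi> x * f x) =
      ((LINT x|lborel. (f x)^2) + (LINT x|lborel. (\<phi> x)^2) - (LINT x|lborel. (f x - \<phi> x)^2)) / 2"
    by (simp only:) (simp add: f \<phi>2 d)
  have "a \<le> W + e" if "P = (a + b - I) / 2" "P \<le> b / 2 + W / 2" "I < e" for P a b I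
    using that by (simp add: field_simps)
  from this[OF eq *[OF \<phi>(1)] lt] show "(LINT x|lborel. (f x)^2) \<le> W + e" .
qed

lemma translation_estimate_real:
  fixes f :: "space3 \<Rightarrow> real" and w :: "space3 \<Rightarrow> real ^ 3"
  assumes f: "f \<in> L2" and w: "w \<in> L2"
    and weak: "\<And>\<phi> i. test_function \<phi> \<Longrightarrow>
      (LINT x|lborel. frechet_derivative \<phi> (at x) (axis i 1) * f x) = - (LINT x|lborel. \<phi> x * (w x $ i))"
  shows "(LINT x|lborel. (f (x + h) - f x)^2) \<le> (norm h)^2 * (LINT x|lborel. (norm (w x))^2)"
proof (rule sq_integral_le_by_duality)
  have [measurable]: "f \<in> borel_measurable borel" using f by (simp add: L2_def)
  show "(\<lambda>x. f (x + h) - f x) \<in> borel_measurable borel" by measurable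
  have "(\<lambda>x. f (h + 1 *\<^sub>R x)) \<in> L2"
    using f integrable_lborel_affine[of "\<lambda>x. (norm (f x))^2" 1 h] by (simp add: L2_def)
  then have fh: "(\<lambda>x. f (x + h)) \<in> L2" by (simp add: add.commute)
  from L2_diff[OF this f] show "integrable lborel (\<lambda>x. (f (x + h) - f x)^2)"
    by (simp add: L2_def)
  fix \<phi> assume \<phi>: "test_function \<phi>"
  then have [measurable]: "\<phi> \<in> borel_measurable borel" by (rule test_function_measurable)
  have "(LINT x|lborel. \<phi> (x - h) * f x) = (LINT x|lborel. \<phi> x * f (x + h))"
    using integral_lborel_affine[of "\<lambda>x. \<phi> (x - h) * f x" 1 h] by (simp add: add.commute)
  moreover have "(LINT x|lborel. \<phi> x * (f (x + h) - f x)) =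
      (LINT x|lborel. \<phi> x * f (x + h)) - (LINT x|lborel. \<phi> x * f x)"
    using integrable_test_function_scaleR(1)[OF \<phi> locally_integrable_L2[OF fh]]
      integrable_test_function_scaleR(1)[OF \<phi> locally_integrable_L2[OF f]]
    by (simp add: right_diff_distrib)
  ultimately show "(LINT x|lborel. \<phi> x * (f (x + h) - f x))
      \<le> (LINT x|lborel. (\<phi> x)^2) / 2 + (norm h)^2 * (LINT x|lborel. (norm (w x))^2) / 2"
    using translation_pairing_bound[OF locally_integrable_L2[OF f] w weak \<phi>, of h] by linarith
qed

lemma L2_compose_contraction:
  fixes v :: "space3 \<Rightarrow> 'b::euclidean_space" and T :: "'b \<Rightarrow> 'c::euclidean_space"
  assumes "v \<in> L2" "T \<in> borel_measurable borel" "\<And>y. norm (T y) \<le> norm y"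
  shows "(\<lambda>x. T (v x)) \<in> L2"
proof -
  have [measurable]: "v \<in> borel_measurable borel" using assms by (simp add: L2_def)
  note [measurable] = assms(2)
  have "integrable lborel (\<lambda>x. (norm (T (v x)))^2)"
    by (rule Bochner_Integration.integrable_bound[of _ "\<lambda>x. (norm (v x))^2"])
       (use assms in \<open>auto simp: L2_def intro!: power_mono\<close>)
  then show ?thesis by (simp add: L2_def)
qed

definition Re_vec :: "complex ^ 3 \<Rightarrow> real ^ 3" where "Re_vec y = (\<chi> i. Re (y $ i))"
definition Im_vec :: "complex ^ 3 \<Rightarrow> real ^ 3" where "Im_vec y = (\<chi> i. Im (y $ i))"

lemma norm_sq_Re_vec_Im_vec: "(norm (Re_vec y))^2 + (norm (Im_vec y))^2 = (norm y)^2"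
  by (simp add: norm_vec_def L2_set_def Re_vec_def Im_vec_def sum_nonneg cmod_power2 sum.distrib)

lemma Re_vec_measurable: "Re_vec \<in> borel_measurable borel" "Im_vec \<in> borel_measurable borel"
  by (auto simp: Re_vec_def[abs_def] Im_vec_def[abs_def]
      intro!: borel_measurable_continuous_onI continuous_intros continuous_on_vec_lambda)

text \<open>
  Real and imaginary parts are treated separately; their gradients add up to the full gradient by
  \<open>norm_sq_Re_vec_Im_vec\<close>.
\<close>

proposition H1_translation_estimate:
  assumes u: "u \<in> H1"
  shows "integrable lborel (\<lambda>x. (cmod (u (x + h) - u x))^2)"
    and "(LINT x|lborel. (cmod (u (x + h) - u x))^2) \<le> (norm h)^2 * A_fun u"
proof -
  define v where "v = weak_grad u"
  have v: "v \<in> L2" "is_weak_gradient u v" using H1_weak_grad[OF u] by (auto simp: v_def)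
  have uL: "u \<in> L2" using u by (rule H1_L2)
  have [measurable]: "u \<in> borel_measurable borel" using uL by (simp add: L2_def)
  have Re_u: "(\<lambda>x. Re (u x)) \<in> L2" and Im_u: "(\<lambda>x. Im (u x)) \<in> L2"
    by (auto intro!: L2_compose_contraction[OF uL] abs_Re_le_cmod abs_Im_le_cmod)
  have le: "norm (Re_vec y) \<le> norm y" "norm (Im_vec y) \<le> norm y" for y
  proof -
    have "(norm (Re_vec y))^2 \<le> (norm y)^2" "(norm (Im_vec y))^2 \<le> (norm y)^2"
      using norm_sq_Re_vec_Im_vec[of y] by (smt (verit) zero_le_power2)+
    then show "norm (Re_vec y) \<le> norm y" "norm (Im_vec y) \<le> norm y"
      by (auto intro: power2_le_imp_le)
  qed
  have Re_v: "(\<lambda>x. Re_vec (v x)) \<in> L2" and Im_v: "(\<lambda>x. Im_vec (v x)) \<in> L2"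
    by (auto intro!: L2_compose_contraction[OF v(1)] Re_vec_measurable le)
  have I: "integrable lborel (\<lambda>x. frechet_derivative \<phi> (at x) k *\<^sub>R u x)"
      "integrable lborel (\<lambda>x. \<phi> x *\<^sub>R (v x $ i))" if "test_function \<phi>" for \<phi> k i
    using v(2) by (auto intro!: integrable_test_function_scaleR[OF that] locally_integrable_nth
        simp: is_weak_gradient_def)
  have weak: "(LINT x|lborel. frechet_derivative \<phi> (at x) (axis i 1) *\<^sub>R u x) = - (LINT x|lborel. \<phi> x *\<^sub>R (v x $ i))"
    if "test_function \<phi>" for \<phi> i
    using v(2) that by (simp add: is_weak_gradient_def)
  have "(LINT x|lborel. frechet_derivative \<phi> (at x) (axis i 1) * Re (u x)) = - (LINT x|lborel. \<phi> x * (Re_vec (v x) $ i))"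
    if "test_function \<phi>" for \<phi> i
    using arg_cong[OF weak[OF that, of i], of Re] integral_Re[OF I(1)[OF that, of "axis i 1"]] integral_Re[OF I(2)[OF that, of i]]
    by (simp add: Re_vec_def)
  note R = translation_estimate_real[OF Re_u Re_v this, of h]
  have "(LINT x|lborel. frechet_derivative \<phi> (at x) (axis i 1) * Im (u x)) = - (LINT x|lborel. \<phi> x * (Im_vec (v x) $ i))"
    if "test_function \<phi>" for \<phi> i
    using arg_cong[OF weak[OF that, of i], of Im] integral_Im[OF I(1)[OF that, of "axis i 1"]] integral_Im[OF I(2)[OF that, of i]]
    by (simp add: Im_vec_def)
  note J = translation_estimate_real[OF Im_u Im_v this, of h]
  have "(\<lambda>x. u (h + 1 *\<^sub>R x)) \<in> L2"
    using uL integrable_lborel_affine[of "\<lambda>x. (norm (u x))^2" 1 h] by (simp add: L2_def)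
  then have "(\<lambda>x. u (x + h)) \<in> L2" by (simp add: add.commute)
  from L2_diff[OF this uL] have d: "(\<lambda>x. u (x + h) - u x) \<in> L2" .
  then show "integrable lborel (\<lambda>x. (cmod (u (x + h) - u x))^2)" by (simp add: L2_def)
  have "(\<lambda>x. Re (u (x + h) - u x)) \<in> L2" "(\<lambda>x. Im (u (x + h) - u x)) \<in> L2"
    by (auto intro!: L2_compose_contraction[OF d] abs_Re_le_cmod abs_Im_le_cmod simp del: minus_complex.sel)
  then have "(LINT x|lborel. (cmod (u (x + h) - u x))^2) =
      (LINT x|lborel. (Re (u (x + h)) - Re (u x))^2) + (LINT x|lborel. (Im (u (x + h)) - Im (u x))^2)"
    by (simp add: cmod_power2 L2_def)
  also have "\<dots> \<le> (norm h)^2 * (LINT x|lborel. (norm (Re_vec (v x)))^2) + (norm h)^2 * (LINT x|lborel. (norm (Im_vec (v x)))^2)"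
    using R J by (rule add_mono)
  also have "\<dots> = (norm h)^2 * (LINT x|lborel. (norm (Re_vec (v x)))^2 + (norm (Im_vec (v x)))^2)"
    using Re_v Im_v by (simp add: L2_def distrib_left)
  also have "\<dots> = (norm h)^2 * A_fun u"
    by (simp add: norm_sq_Re_vec_Im_vec A_fun_def v_def)
  finally show "(LINT x|lborel. (cmod (u (x + h) - u x))^2) \<le> (norm h)^2 * A_fun u" .
qed

section \<open>The subcritical Sobolev embedding\<close>

definition ball_vol :: "real \<Rightarrow> real" where
  "ball_vol r = unit_ball_vol 3 * r ^ 3"

lemma ball_vol_pos: "r > 0 \<Longrightarrow> ball_vol r > 0"
  by (simp add: ball_vol_def)

lemma unit_ball_vol_3_pos: "unit_ball_vol 3 > 0"
  by (rule unit_ball_vol_pos) simp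

lemma unit_ball_vol_3_nonzero [simp]: "unit_ball_vol 3 \<noteq> 0"
  using unit_ball_vol_3_pos by (rule less_imp_neq[symmetric])

lemma emeasure_ball_vol: "r \<ge> 0 \<Longrightarrow> emeasure lborel (ball (a::space3) r) = ennreal (ball_vol r)"
  by (simp add: emeasure_ball ball_vol_def)

lemma ball_borel [measurable]: "ball (a :: 'a::real_normed_vector) r \<in> sets borel"
  by (intro borel_open open_ball)

text \<open>
  Averages take values in the extended nonnegative reals, so that they can be formed, added and
  interchanged before anything is known about integrability.
\<close>

definition ball_avg :: "real \<Rightarrow> (space3 \<Rightarrow> ennreal) \<Rightarrow> ennreal" where
  "ball_avg r f = ennreal (1 / ball_vol r) * (\<integral>\<^sup>+h. f h * indicator (ball 0 r) h \<partial>lborel)"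

lemma ball_avg_mono: "(\<And>h. f h \<le> g h) \<Longrightarrow> ball_avg r f \<le> ball_avg r g"
  unfolding ball_avg_def by (intro mult_left_mono nn_integral_mono mult_right_mono) auto

lemma ball_avg_add:
  assumes [measurable]: "f \<in> borel_measurable borel" "g \<in> borel_measurable borel"
  shows "ball_avg r (\<lambda>h. f h + g h) = ball_avg r f + ball_avg r g"
  unfolding ball_avg_def distrib_right by (subst nn_integral_add) (simp_all add: distrib_left)

lemma ball_avg_cmult:
  assumes [measurable]: "f \<in> borel_measurable borel"
  shows "ball_avg r (\<lambda>h. c * f h) = c * ball_avg r f"
  unfolding ball_avg_def mult.assoc by (subst nn_integral_cmult) (simp_all add: mult.left_commute)

lemma ball_avg_const:
  assumes "r > 0"
  shows "ball_avg r (\<lambda>h. c) = c"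
proof -
  have "ball_avg r (\<lambda>h. c) = ennreal (1 / ball_vol r) * (c * ennreal (ball_vol r))"
    using assms by (simp add: ball_avg_def nn_integral_cmult_indicator emeasure_ball_vol)
  also have "\<dots> = c * ennreal ((1 / ball_vol r) * ball_vol r)"
    using ball_vol_pos[OF assms] by (subst ennreal_mult) (auto simp: mult_ac)
  also have "\<dots> = c" using ball_vol_pos[OF assms] by simp
  finally show ?thesis .
qed

lemma nn_integral_translate:
  fixes f :: "'a::euclidean_space \<Rightarrow> ennreal"
  assumes [measurable]: "f \<in> borel_measurable borel"
  shows "(\<integral>\<^sup>+x. f (a + x) \<partial>lborel) = (\<integral>\<^sup>+x. f x \<partial>lborel)"
  using nn_integral_lborel_affine[of f 1 a] by simp

text \<open>
  The normalized situation of the embedding, with \<open>w = |u|\<close> divided by a bound of the \<open>H1\<close> norm. The modulus of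
  continuity passes from \<open>u\<close> to \<open>|u|\<close> by the triangle inequality.
\<close>

locale translation_bounded =
  fixes w :: "space3 \<Rightarrow> real"
  assumes w_measurable [measurable]: "w \<in> borel_measurable borel"
    and w_nonneg: "w x \<ge> 0"
    and w_L2: "sq_mass w \<le> 1"
    and w_modulus: "sq_mass (\<lambda>x. w x - w (x + h)) \<le> ennreal ((norm h)^2)"
begin

abbreviation mean :: "real \<Rightarrow> space3 \<Rightarrow> ennreal" where
  "mean r x \<equiv> ball_avg r (\<lambda>h. ennreal (w (x + h)))"

abbreviation oscillation :: "real \<Rightarrow> space3 \<Rightarrow> ennreal" where
  "oscillation r x \<equiv> ball_avg r (\<lambda>h. ennreal ((w x - w (x + h))^2))"

abbreviation near_sq :: "real \<Rightarrow> space3 \<Rightarrow> space3 \<Rightarrow> ennreal" where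
  "near_sq r x h \<equiv> ball_avg r (\<lambda>k. ennreal ((w (x + h) - w (x + k))^2))"

lemma local_modulus:
  assumes r: "r > 0"
  shows "(\<integral>\<^sup>+h. (\<integral>\<^sup>+x. ennreal ((w x - w (x + h))^2) * indicator (ball 0 r) h \<partial>lborel) \<partial>lborel)
    \<le> ennreal (ball_vol r * r^2)"
proof -
  have "(\<integral>\<^sup>+h. (\<integral>\<^sup>+x. ennreal ((w x - w (x + h))^2) * indicator (ball 0 r) h \<partial>lborel) \<partial>lborel)
      \<le> (\<integral>\<^sup>+h. ennreal (r^2) * indicator (ball (0::space3) r) h \<partial>lborel)"
  proof (rule nn_integral_mono)
    fix h :: space3
    have "(\<integral>\<^sup>+x. ennreal ((w x - w (x + h))^2) * indicator (ball 0 r) h \<partial>lborel) =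
        sq_mass (\<lambda>x. w x - w (x + h)) * indicator (ball 0 r) h"
      by (rule nn_integral_multc) measurable
    also have "\<dots> \<le> ennreal ((norm h)^2) * indicator (ball 0 r) h"
      by (intro mult_right_mono w_modulus) auto
    also have "\<dots> \<le> ennreal (r^2) * indicator (ball 0 r) h"
      by (auto simp: indicator_def intro!: ennreal_leI power_mono)
    finally show "(\<integral>\<^sup>+x. ennreal ((w x - w (x + h))^2) * indicator (ball 0 r) h \<partial>lborel)
        \<le> ennreal (r^2) * indicator (ball 0 r) h" .
  qed
  also have "\<dots> = ennreal (ball_vol r * r^2)"
    using r ball_vol_pos[OF r]
    by (subst nn_integral_cmult_indicator) (simp_all add: emeasure_ball_vol ennreal_mult[symmetric] mult.commute)
  finally show ?thesis .
qed

lemma ball_avg_modulus: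
  assumes r: "r > 0"
  shows "(\<integral>\<^sup>+x. oscillation r x \<partial>lborel) \<le> ennreal (r^2)"
proof -
  have "(\<integral>\<^sup>+x. oscillation r x \<partial>lborel) =
      ennreal (1 / ball_vol r) * (\<integral>\<^sup>+x. (\<integral>\<^sup>+h. ennreal ((w x - w (x + h))^2) * indicator (ball 0 r) h \<partial>lborel) \<partial>lborel)"
    unfolding ball_avg_def by (rule nn_integral_cmult) measurable
  also have "(\<integral>\<^sup>+x. (\<integral>\<^sup>+h. ennreal ((w x - w (x + h))^2) * indicator (ball 0 r) h \<partial>lborel) \<partial>lborel) =
      (\<integral>\<^sup>+h. (\<integral>\<^sup>+x. ennreal ((w x - w (x + h))^2) * indicator (ball 0 r) h \<partial>lborel) \<partial>lborel)"
    by (rule lborel_pair.Fubini') measurable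
  also have "ennreal (1 / ball_vol r) * \<dots> \<le> ennreal (1 / ball_vol r) * ennreal (ball_vol r * r^2)"
    by (intro mult_left_mono local_modulus r) auto
  also have "\<dots> = ennreal (r^2)"
    using ball_vol_pos[OF r] by (simp add: ennreal_mult[symmetric])
  finally show ?thesis .
qed

text \<open>
  A Poincare inequality on balls: after the substitution \<open>k = h + l\<close>, the mean square difference between
  values on two concentric balls only involves shifts \<open>l\<close> shorter than \<open>2 r\<close>. In the constant, \<open>64\<close> is the
  ratio of the two volumes and \<open>32\<close> comes from \<open>(2 r)^3 (2 r)^2\<close>.
\<close>

lemma ball_avg_double_modulus:
  assumes r: "r > 0"
  shows "ball_avg (r / 4) (\<lambda>h. near_sq r x h)
    \<le> ennreal (2048 / (unit_ball_vol 3 * r))"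
proof -
  let ?I = "\<lambda>h. \<integral>\<^sup>+k. ennreal ((w (x + h) - w (x + k))^2) * indicator (ball 0 r) k \<partial>lborel"
  let ?J = "\<lambda>y. \<integral>\<^sup>+l. ennreal ((w y - w (y + l))^2) * indicator (ball 0 (2 * r)) l \<partial>lborel"
  have meas[measurable]: "(\<lambda>(h, k). ennreal ((w (x + h) - w (x + k))^2)) \<in> borel_measurable (borel \<Otimes>\<^sub>M borel)"
    by measurable
  have inner: "?I h * indicator (ball 0 (r / 4)) h
      \<le> ?J (x + h)" for h
  proof (cases "h \<in> ball 0 (r / 4)")
    case True
    have "?I h
        = (\<integral>\<^sup>+l. ennreal ((w (x + h) - w (x + (h + l)))^2) * indicator (ball 0 r) (h + l) \<partial>lborel)"
      by (rule nn_integral_translate[of "\<lambda>k. ennreal ((w (x + h) - w (x + k))^2) * indicator (ball 0 r) k" h, symmetric]) measurable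
    also have "\<dots> \<le> ?J (x + h)"
    proof (intro nn_integral_mono)
      fix l
      have "l \<in> ball 0 (2 * r)" if "h + l \<in> ball 0 r"
        using norm_triangle_ineq4[of "h + l" h] that True r by simp
      then show "ennreal ((w (x + h) - w (x + (h + l)))^2) * indicator (ball 0 r) (h + l)
          \<le> ennreal ((w (x + h) - w (x + h + l))^2) * indicator (ball 0 (2 * r)) l"
        by (auto simp: indicator_def add.assoc)
    qed
    finally show ?thesis using True by simp
  qed simp
  have "(\<integral>\<^sup>+h. ?I h * indicator (ball 0 (r / 4)) h \<partial>lborel)
      \<le> (\<integral>\<^sup>+h. ?J (x + h) \<partial>lborel)"
    by (intro nn_integral_mono inner)
  also have "\<dots> = (\<integral>\<^sup>+h. ?J h \<partial>lborel)"
    by (rule nn_integral_translate[of "\<lambda>h. ?J h" x]) measurable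
  also have "\<dots> = (\<integral>\<^sup>+l. (\<integral>\<^sup>+h. ennreal ((w h - w (h + l))^2) * indicator (ball 0 (2 * r)) l \<partial>lborel) \<partial>lborel)"
    by (rule lborel_pair.Fubini') measurable
  also have "\<dots> \<le> ennreal (ball_vol (2 * r) * (2 * r)^2)"
    using r by (intro local_modulus) auto
  finally have le: "(\<integral>\<^sup>+h. ?I h * indicator (ball 0 (r / 4)) h \<partial>lborel)
      \<le> ennreal (ball_vol (2 * r) * (2 * r)^2)" .
  have "ball_avg (r / 4) (\<lambda>h. near_sq r x h) =
      ennreal (1 / ball_vol (r / 4)) * (ennreal (1 / ball_vol r) *
      (\<integral>\<^sup>+h. ?I h * indicator (ball 0 (r / 4)) h \<partial>lborel))"
    unfolding ball_avg_def mult.assoc by (subst nn_integral_cmult) (auto simp: mult.assoc)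
  also have "\<dots> \<le> ennreal (1 / ball_vol (r / 4)) * (ennreal (1 / ball_vol r) * ennreal (ball_vol (2 * r) * (2 * r)^2))"
    by (intro mult_left_mono le) auto
  also have "\<dots> = ennreal (1 / ball_vol (r / 4) * (1 / ball_vol r * (ball_vol (2 * r) * (2 * r)^2)))"
    using r ball_vol_pos[of r] ball_vol_pos[of "r/4"] ball_vol_pos[of "2*r"]
    by (simp add: ennreal_mult[symmetric])
  also have "1 / ball_vol (r / 4) * (1 / ball_vol r * (ball_vol (2 * r) * (2 * r)^2)) = 2048 / (unit_ball_vol 3 * r)"
    using r unit_ball_vol_3_pos by (simp add: ball_vol_def field_simps power2_eq_square power3_eq_cube)
  finally show ?thesis .
qed

text \<open>
  Young's inequality with weight \<open>s\<close> balances the mean square difference, of order \<open>1 / s^2\<close>, against a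
  constant of order \<open>1 / s\<close>. Writing the radius as \<open>s^2\<close> makes the increment a multiple of \<open>1 / s\<close>.
\<close>

lemma ball_avg_quarter:
  assumes s: "s > 0"
  shows "mean (s^2 / 4) x
    \<le> mean (s^2) x + ennreal ((1024 / unit_ball_vol 3 + 1 / 2) / s)"
proof -
  have young: "ennreal (w (x + h)) \<le> ennreal (w (x + k)) +
      (ennreal (s / 2) * ennreal ((w (x + h) - w (x + k))^2) + ennreal (1 / (2 * s)))" for h k
  proof -
    have "w (x + h) - w (x + k) \<le> s / 2 * (w (x + h) - w (x + k))^2 + 1 / (2 * s)"
      using zero_le_power2[of "s * (w (x + h) - w (x + k)) - 1"] s
      by (simp add: field_simps power2_eq_square)
    then have "ennreal (w (x + h)) \<le> ennreal (w (x + k) + (s / 2 * (w (x + h) - w (x + k))^2 + 1 / (2 * s)))"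
      by (intro ennreal_leI) linarith
    also have "\<dots> = ennreal (w (x + k)) +
      (ennreal (s / 2) * ennreal ((w (x + h) - w (x + k))^2) + ennreal (1 / (2 * s)))"
      using s by (simp add: ennreal_plus w_nonneg ennreal_mult del: times_divide_eq_left times_divide_eq_right)
    finally show ?thesis .
  qed
  let ?m = "mean (s^2) x"
  have s2: "s^2 > 0" "s^2 / 4 > 0" using s by auto
  have "ennreal (w (x + h)) \<le> ?m + (ennreal (s / 2) * near_sq (s^2) x h + ennreal (1 / (2 * s)))" for h
  proof -
    have "ennreal (w (x + h)) = ball_avg (s^2) (\<lambda>k. ennreal (w (x + h)))"
      using s2 by (simp add: ball_avg_const)
    also have "\<dots> \<le> ball_avg (s^2) (\<lambda>k. ennreal (w (x + k)) +
      (ennreal (s / 2) * ennreal ((w (x + h) - w (x + k))^2) + ennreal (1 / (2 * s))))"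
      by (intro ball_avg_mono young)
    also have "\<dots> = ?m + (ennreal (s / 2) * near_sq (s^2) x h + ennreal (1 / (2 * s)))"
      using s2 by (simp add: ball_avg_add ball_avg_cmult ball_avg_const)
    finally show ?thesis .
  qed
  then have "mean (s^2 / 4) x \<le>
      ball_avg (s^2 / 4) (\<lambda>h. ?m + (ennreal (s / 2) * near_sq (s^2) x h + ennreal (1 / (2 * s))))"
    by (rule ball_avg_mono)
  also have "\<dots> = ?m + (ennreal (s / 2) * ball_avg (s^2 / 4) (\<lambda>h. near_sq (s^2) x h) + ennreal (1 / (2 * s)))"
  proof -
    have [measurable]: "(\<lambda>h. near_sq (s^2) x h) \<in> borel_measurable borel"
      unfolding ball_avg_def by measurable
    show ?thesis using s2 by (simp add: ball_avg_add ball_avg_cmult ball_avg_const)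
  qed
  also have "\<dots> \<le> ?m + (ennreal (s / 2) * ennreal (2048 / (unit_ball_vol 3 * s^2)) + ennreal (1 / (2 * s)))"
    by (intro add_left_mono add_right_mono mult_left_mono ball_avg_double_modulus s2) auto
  also have "ennreal (s / 2) * ennreal (2048 / (unit_ball_vol 3 * s^2)) + ennreal (1 / (2 * s))
      = ennreal (s / 2 * (2048 / (unit_ball_vol 3 * s^2)) + 1 / (2 * s))"
    using s unit_ball_vol_3_pos by (simp add: ennreal_plus ennreal_mult del: times_divide_eq_left times_divide_eq_right)
  also have "s / 2 * (2048 / (unit_ball_vol 3 * s^2)) + 1 / (2 * s) = (1024 / unit_ball_vol 3 + 1 / 2) / s"
    using s unit_ball_vol_3_pos by (simp add: field_simps power2_eq_square)
  finally show ?thesis .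
qed

end

text \<open>
  Large enough to bound both the average over the unit ball and the increment in \<open>ball_avg_quarter\<close>.
\<close>

definition sobolev_level :: real where
  "sobolev_level = 1 + 1024 / unit_ball_vol 3"

lemma sobolev_level_pos: "sobolev_level > 0"
  by (auto simp: sobolev_level_def intro!: add_pos_nonneg)

context translation_bounded
begin

text \<open>
  The increments from \<open>ball_avg_quarter\<close> form a geometric series, dominated by its last term.
\<close>

lemma ball_avg_dyadic: "mean ((1 / 2 ^ k)^2) x \<le> ennreal (sobolev_level * 2 ^ k)"
proof (induction k)
  case 0
  have "ennreal (w (x + h)) \<le> ennreal (1 / 2) + ennreal (1 / 2) * ennreal ((w (x + h))^2)" for h
  proof -
    have "w (x + h) \<le> 1 / 2 + 1 / 2 * (w (x + h))^2"
      using zero_le_power2[of "w (x + h) - 1"] by (simp add: power2_eq_square algebra_simps)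
    then have "ennreal (w (x + h)) \<le> ennreal (1 / 2 + 1 / 2 * (w (x + h))^2)" by (rule ennreal_leI)
    then show ?thesis by (simp add: ennreal_plus ennreal_mult del: ennreal_half times_divide_eq_left times_divide_eq_right)
  qed
  then have "mean 1 x \<le> ball_avg 1 (\<lambda>h. ennreal (1 / 2) + ennreal (1 / 2) * ennreal ((w (x + h))^2))"
    by (rule ball_avg_mono)
  also have "\<dots> = ennreal (1 / 2) + ennreal (1 / 2) * ball_avg 1 (\<lambda>h. ennreal ((w (x + h))^2))"
    by (simp add: ball_avg_add ball_avg_cmult ball_avg_const)
  also have "\<dots> \<le> ennreal (1 / 2) + ennreal (1 / 2) * (ennreal (1 / ball_vol 1) * 1)"
  proof (intro add_left_mono mult_left_mono)
    have "(\<integral>\<^sup>+h. ennreal ((w (x + h))^2) * indicator (ball 0 1) h \<partial>lborel) \<le> sq_mass (\<lambda>h. w (x + h))"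
      by (intro nn_integral_mono) (auto simp: indicator_def)
    also have "\<dots> \<le> 1"
      using nn_integral_translate[of "\<lambda>h. ennreal ((w h)^2)" x] w_L2 by simp
    finally show "ball_avg 1 (\<lambda>h. ennreal ((w (x + h))^2)) \<le> ennreal (1 / ball_vol 1) * 1"
      unfolding ball_avg_def by (intro mult_left_mono) auto
  qed auto
  also have "\<dots> = ennreal (1 / 2 + 1 / 2 * (1 / unit_ball_vol 3))"
    using unit_ball_vol_3_pos by (simp add: ennreal_plus ennreal_mult ball_vol_def del: ennreal_half times_divide_eq_left times_divide_eq_right)
  also have "\<dots> \<le> ennreal sobolev_level"
    using unit_ball_vol_3_pos by (intro ennreal_leI) (simp add: sobolev_level_def field_simps)
  finally show ?case by simp
next
  case (Suc k)
  have "mean ((1 / 2 ^ Suc k)^2) x = mean ((1 / 2 ^ k)^2 / 4) x"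
    by (simp add: power2_eq_square mult_ac)
  also have "\<dots> \<le> mean ((1 / 2 ^ k)^2) x + ennreal ((1024 / unit_ball_vol 3 + 1 / 2) / (1 / 2 ^ k))"
    by (rule ball_avg_quarter) simp
  also have "\<dots> \<le> ennreal (sobolev_level * 2 ^ k) + ennreal (sobolev_level * 2 ^ k)"
    by (intro add_mono Suc.IH ennreal_leI) (simp add: sobolev_level_def)
  also have "\<dots> = ennreal (sobolev_level * 2 ^ Suc k)"
    using sobolev_level_pos by (simp add: ennreal_plus[symmetric] del: ennreal_plus)
  finally show ?case .
qed

abbreviation superlevel :: "nat \<Rightarrow> space3 set" where
  "superlevel k \<equiv> {x. w x > 2 * (sobolev_level * 2 ^ k)}"

text \<open>
  Where \<open>w(x)\<close> is more than twice its average, the mean of \<open>w(x) - w(x + h)\<close> is at least \<open>w(x) / 2\<close>. Young's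
  inequality with weight \<open>1 / w(x)\<close> squares the differences and leaves \<open>w(x) / 4\<close> to be absorbed.
\<close>

lemma sq_le_ball_avg_modulus:
  assumes r: "r > 0" and avg: "mean r x \<le> ennreal l"
    and l: "l > 0" and big: "w x > 2 * l"
  shows "ennreal ((w x)^2) \<le> 4 * oscillation r x"
proof (cases "oscillation r x")
  case (real T)
  have wx: "w x > 0" using l big by linarith
  have "ennreal (w x) \<le> ennreal (w (x + h)) + (ennreal (1 / w x) * ennreal ((w x - w (x + h))^2) + ennreal (w x / 4))" for h
  proof -
    have "w x - w (x + h) \<le> 1 / w x * (w x - w (x + h))^2 + w x / 4"
      using zero_le_power2[of "(w x - w (x + h)) - w x / 2"] wx
      by (simp add: field_simps power2_eq_square)
    then have "ennreal (w x) \<le> ennreal (w (x + h) + (1 / w x * (w x - w (x + h))^2 + w x / 4))"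
      by (intro ennreal_leI) linarith
    then show ?thesis using wx by (simp add: ennreal_plus w_nonneg ennreal_mult del: times_divide_eq_left times_divide_eq_right)
  qed
  then have "ball_avg r (\<lambda>h. ennreal (w x)) \<le> ball_avg r (\<lambda>h. ennreal (w (x + h)) + (ennreal (1 / w x) * ennreal ((w x - w (x + h))^2) + ennreal (w x / 4)))"
    by (rule ball_avg_mono)
  also have "\<dots> = mean r x + (ennreal (1 / w x) * ennreal T + ennreal (w x / 4))"
    using r real by (simp add: ball_avg_add ball_avg_cmult ball_avg_const)
  also have "\<dots> \<le> ennreal l + (ennreal (1 / w x) * ennreal T + ennreal (w x / 4))"
    by (intro add_right_mono avg)
  also have "\<dots> = ennreal (l + (1 / w x * T + w x / 4))"
    using l wx real by (simp add: ennreal_plus ennreal_mult del: times_divide_eq_left times_divide_eq_right)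
  finally have "ennreal (w x) \<le> ennreal (l + (1 / w x * T + w x / 4))"
    using r by (simp add: ball_avg_const)
  then have "w x \<le> l + (1 / w x * T + w x / 4)"
    using l wx real by (subst (asm) ennreal_le_iff) auto
  then have "w x \<le> w x / 2 + (1 / w x * T + w x / 4)" using big by linarith
  then have "(w x)^2 \<le> 4 * T" using wx by (simp add: field_simps power2_eq_square)
  then have "ennreal ((w x)^2) \<le> ennreal (4 * T)" by (rule ennreal_leI)
  then show ?thesis using real by (simp add: ennreal_mult)
qed (simp add: ennreal_mult_eq_top_iff)

lemma superlevel_L2_decay:
  "(\<integral>\<^sup>+x. ennreal ((w x)^2) * indicator (superlevel k) x \<partial>lborel) \<le> ennreal (4 / 16 ^ k)"
proof -
  let ?r = "(1 / 2 ^ k)^2 :: real"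
  have [measurable]: "(\<lambda>x. oscillation ?r x) \<in> borel_measurable borel"
    unfolding ball_avg_def by measurable
  have "(\<integral>\<^sup>+x. ennreal ((w x)^2) * indicator (superlevel k) x \<partial>lborel)
      \<le> (\<integral>\<^sup>+x. 4 * oscillation ?r x \<partial>lborel)"
  proof (rule nn_integral_mono)
    fix x
    show "ennreal ((w x)^2) * indicator (superlevel k) x
        \<le> 4 * oscillation ?r x"
      using sq_le_ball_avg_modulus[OF _ ball_avg_dyadic[of k x]] sobolev_level_pos
      by (auto simp: indicator_def)
  qed
  also have "\<dots> = 4 * (\<integral>\<^sup>+x. oscillation ?r x \<partial>lborel)"
    by (rule nn_integral_cmult) measurable
  also have "\<dots> \<le> 4 * ennreal (?r^2)"
    by (intro mult_left_mono ball_avg_modulus) auto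
  also have "\<dots> = ennreal (4 * ?r^2)" by (simp add: ennreal_mult)
  also have "4 * ?r^2 = 4 / 16 ^ k"
    by (simp add: power_divide power_mult[symmetric] power_mult_distrib[symmetric] flip: power_mult)
       (simp add: power_mult)
  finally show ?thesis .
qed

end

lemma ennreal_term_le_suminf: "f k \<le> (\<Sum>k. f k :: ennreal)"
  using sum_le_suminf[of f "{k}"] by simp

text \<open>
  The bound that the sum over dyadic layers produces. The layer at height \<open>2^k\<close> contributes a multiple of
  \<open>(2 powr (p - 2))^k * 16^(-k)\<close>, which is summable exactly for \<open>p < 6\<close>.
\<close>

definition sobolev_const :: "real \<Rightarrow> real" where
  "sobolev_const p = (2 * sobolev_level) powr (p - 2) +
     (4 * sobolev_level) powr (p - 2) * 4 / (1 - 2 powr (p - 2) / 16)"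

context translation_bounded
begin

text \<open>
  If \<open>w(x)\<close> lies between the levels \<open>2 L 2^k\<close> and \<open>2 L 2^(k+1)\<close>, then \<open>w powr (p - 2)\<close> is at most the
  \<open>(p - 2)\<close>-th power of the upper level and \<open>x\<close> belongs to the superlevel set of the lower one.
\<close>

lemma powr_le_level_sum:
  assumes p: "2 < p"
  shows "ennreal (w x powr p) \<le> ennreal ((2 * sobolev_level) powr (p - 2)) * ennreal ((w x)^2) +
    (\<Sum>k. ennreal ((4 * sobolev_level * 2 ^ k) powr (p - 2)) *
      (ennreal ((w x)^2) * indicator (superlevel k) x))"
proof -
  have split: "w x powr p = w x powr (p - 2) * (w x)^2"
  proof -
    have "w x powr p = w x powr (p - 2) * w x powr 2"
      by (simp flip: powr_add)
    then show ?thesis using w_nonneg[of x] by (simp add: powr_numeral)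
  qed
  have le: "ennreal (w x powr p) \<le> ennreal (b powr (p - 2)) * ennreal ((w x)^2)" if "w x \<le> b" for b
  proof -
    have "w x powr (p - 2) \<le> b powr (p - 2)"
      using that p w_nonneg[of x] by (intro powr_mono2) auto
    then show ?thesis
      unfolding split by (subst ennreal_mult[symmetric]) (auto intro!: ennreal_leI mult_right_mono)
  qed
  show ?thesis
  proof (cases "w x \<le> 2 * sobolev_level")
    case True
    then show ?thesis using le[OF True] by (rule_tac add_increasing2) auto
  next
    case False
    obtain n0 where n0: "w x / (2 * sobolev_level) < 2 ^ n0"
      using real_arch_pow[of 2 "w x / (2 * sobolev_level)"] by auto
    define n where "n = (LEAST n. w x \<le> 2 * (sobolev_level * 2 ^ n))"
    have "w x \<le> 2 * (sobolev_level * 2 ^ n0)"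
      using n0 sobolev_level_pos by (simp add: field_simps)
    then have n: "w x \<le> 2 * (sobolev_level * 2 ^ n)" unfolding n_def by (rule LeastI)
    with False have "n \<noteq> 0" by (cases n) auto
    then obtain k where k: "n = Suc k" by (cases n) auto
    then have big: "w x > 2 * (sobolev_level * 2 ^ k)"
      using not_less_Least[of k "\<lambda>n. w x \<le> 2 * (sobolev_level * 2 ^ n)"] by (simp add: n_def)
    let ?f = "\<lambda>k. ennreal ((4 * sobolev_level * 2 ^ k) powr (p - 2)) *
      (ennreal ((w x)^2) * indicator (superlevel k) x)"
    have "ennreal (w x powr p) \<le> ?f k"
      using le[of "4 * sobolev_level * 2 ^ k"] n k big by (simp add: mult_ac)
    also have "\<dots> \<le> (\<Sum>k. ?f k)"
      by (rule ennreal_term_le_suminf[of ?f])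
    finally show ?thesis by (rule_tac add_increasing) auto
  qed
qed

lemma Lp_bound:
  assumes p: "2 < p" "p < 6"
  shows "(\<integral>\<^sup>+x. ennreal (w x powr p) \<partial>lborel) \<le> ennreal (sobolev_const p)"
proof -
  let ?L = sobolev_level
  define q where "q = 2 powr (p - 2) / (16 :: real)"
  define a where "a = (4 * ?L) powr (p - 2) * 4"
  have "2 powr (p - 2) < (2 :: real) powr 4" using p by (intro powr_less_mono) auto
  then have q: "0 \<le> q" "q < 1" by (auto simp: q_def)
  have a: "a \<ge> 0" by (simp add: a_def)
  have "(\<integral>\<^sup>+x. ennreal (w x powr p) \<partial>lborel) \<le>
     (\<integral>\<^sup>+x. ennreal ((2 * ?L) powr (p - 2)) * ennreal ((w x)^2) +
      (\<Sum>k. ennreal ((4 * ?L * 2 ^ k) powr (p - 2)) *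
      (ennreal ((w x)^2) * indicator (superlevel k) x)) \<partial>lborel)"
    using p by (intro nn_integral_mono powr_le_level_sum)
  also have "\<dots> = ennreal ((2 * ?L) powr (p - 2)) * sq_mass w +
      (\<Sum>k. ennreal ((4 * ?L * 2 ^ k) powr (p - 2)) *
      (\<integral>\<^sup>+x. ennreal ((w x)^2) * indicator (superlevel k) x \<partial>lborel))"
    by (subst nn_integral_add) (simp_all add: nn_integral_suminf nn_integral_cmult)
  also have "\<dots> \<le> ennreal ((2 * ?L) powr (p - 2)) * 1 + (\<Sum>k. ennreal (a * q ^ k))"
  proof (intro add_mono mult_left_mono w_L2 suminf_le)
    fix k
    have "ennreal ((4 * ?L * 2 ^ k) powr (p - 2)) *
      (\<integral>\<^sup>+x. ennreal ((w x)^2) * indicator (superlevel k) x \<partial>lborel)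
      \<le> ennreal ((4 * ?L * 2 ^ k) powr (p - 2)) * ennreal (4 / 16 ^ k)"
      by (intro mult_left_mono superlevel_L2_decay) auto
    also have "\<dots> = ennreal ((4 * ?L * 2 ^ k) powr (p - 2) * (4 / 16 ^ k))"
      by (rule ennreal_mult[symmetric]) auto
    also have "(4 * ?L * 2 ^ k) powr (p - 2) * (4 / 16 ^ k) = a * q ^ k"
    proof -
      have "(2 ^ k) powr (p - 2) = (2 powr (p - 2)) ^ k"
        by (simp add: powr_powr mult.commute flip: powr_realpow)
      then show ?thesis using sobolev_level_pos by (simp add: powr_mult a_def q_def power_divide)
    qed
    finally show "ennreal ((4 * ?L * 2 ^ k) powr (p - 2)) *
      (\<integral>\<^sup>+x. ennreal ((w x)^2) * indicator (superlevel k) x \<partial>lborel) \<le> ennreal (a * q ^ k)" .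
  qed auto
  also have "(\<Sum>k. ennreal (a * q ^ k)) = ennreal (a / (1 - q))"
  proof -
    have "(\<lambda>k. a * q ^ k) sums (a * (1 / (1 - q)))"
      using q by (intro sums_mult geometric_sums) auto
    then show ?thesis
      using q a by (subst suminf_ennreal2) (auto simp: sums_iff)
  qed
  also have "ennreal ((2 * ?L) powr (p - 2)) * 1 + ennreal (a / (1 - q)) = ennreal (sobolev_const p)"
    using q a by (simp add: sobolev_const_def a_def q_def ennreal_plus)
  finally show ?thesis .
qed

end

lemma nn_integral_sq_le_H1_norm:
  assumes "u \<in> H1"
  shows "sq_mass (\<lambda>x. cmod (u x)) \<le> ennreal ((H1_norm u)^2)"
proof -
  have "integrable lborel (\<lambda>x. (cmod (u x))^2)" using assms by (simp add: H1_def L2_def)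
  then show ?thesis
    using A_fun_nonneg[of u] by (simp add: nn_integral_eq_integral H1_norm_sq)
qed

text \<open>
  Homogeneity reduces this to the normalized case. The bound \<open>D\<close> instead of the norm itself allows division
  also for functions that vanish almost everywhere.
\<close>

theorem H1_embedding_Lp:
  assumes u: "u \<in> H1" and D: "D > 0" "(H1_norm u)^2 \<le> D" and p: "2 < p" "p < 6"
  shows "(\<integral>\<^sup>+x. ennreal (cmod (u x) powr p) \<partial>lborel) \<le> ennreal (sobolev_const p * D powr (p / 2))"
proof -
  have [measurable]: "u \<in> borel_measurable borel" using u by (rule H1_measurable)
  define w where "w x = cmod (u x) / sqrt D" for x
  have w_sq: "(cmod y / sqrt D)^2 = (1 / D) * (cmod y)^2" for y
    using D(1) by (simp add: power_divide)
  interpret translation_bounded w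
  proof
    show "w \<in> borel_measurable borel" unfolding w_def[abs_def] by measurable
    show "w x \<ge> 0" for x using D(1) by (simp add: w_def)
    have "sq_mass w = (\<integral>\<^sup>+x. ennreal (1 / D) * ennreal ((cmod (u x))^2) \<partial>lborel)"
      using D(1) unfolding w_def w_sq by (subst ennreal_mult) auto
    also have "\<dots> = ennreal (1 / D) * sq_mass (\<lambda>x. cmod (u x))"
      by (rule nn_integral_cmult) measurable
    also have "\<dots> \<le> ennreal (1 / D) * ennreal D"
      using nn_integral_sq_le_H1_norm[OF u] D(2) by (intro mult_left_mono) (auto intro: order_trans ennreal_leI)
    also have "\<dots> = 1" using D(1) by (simp add: ennreal_mult[symmetric])
    finally show "sq_mass w \<le> 1" .
    fix h
    have "sq_mass (\<lambda>x. w x - w (x + h)) \<le> (\<integral>\<^sup>+x. ennreal (1 / D) * ennreal ((cmod (u (x + h) - u x))^2) \<partial>lborel)"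
    proof (rule nn_integral_mono)
      fix x
      have "\<bar>w x - w (x + h)\<bar> \<le> cmod (u (x + h) - u x) / sqrt D"
        using D(1) norm_triangle_ineq3[of "u (x + h)" "u x"]
        by (simp add: w_def norm_minus_commute abs_minus_commute divide_right_mono flip: diff_divide_distrib)
      then have "(w x - w (x + h))^2 \<le> (cmod (u (x + h) - u x) / sqrt D)^2"
        using power_mono[of "\<bar>w x - w (x + h)\<bar>" _ 2] by simp
      then have "ennreal ((w x - w (x + h))^2) \<le> ennreal ((1 / D) * (cmod (u (x + h) - u x))^2)"
        unfolding w_sq[symmetric] by (rule ennreal_leI)
      then show "ennreal ((w x - w (x + h))^2) \<le> ennreal (1 / D) * ennreal ((cmod (u (x + h) - u x))^2)"
        using D(1) by (subst ennreal_mult[symmetric]) simp_all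
    qed
    also have "\<dots> = ennreal (1 / D) * sq_mass (\<lambda>x. cmod (u (x + h) - u x))"
      by (rule nn_integral_cmult) measurable
    also have "\<dots> = ennreal (1 / D) * ennreal (LINT x|lborel. (cmod (u (x + h) - u x))^2)"
      by (subst nn_integral_eq_integral[OF H1_translation_estimate(1)[OF u]]) auto
    also have "\<dots> \<le> ennreal (1 / D) * ennreal ((norm h)^2 * D)"
    proof (intro mult_left_mono ennreal_leI)
      have "(LINT x|lborel. (cmod (u x))^2) \<ge> 0" by simp
      then have "A_fun u \<le> D"
        using D(2) unfolding H1_norm_sq by linarith
      then have "(norm h)^2 * A_fun u \<le> (norm h)^2 * D" by (intro mult_left_mono) auto
      with H1_translation_estimate(2)[OF u, of h]
      show "(LINT x|lborel. (cmod (u (x + h) - u x))^2) \<le> (norm h)^2 * D" by linarith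
    qed auto
    also have "\<dots> = ennreal ((norm h)^2)"
      using D(1) by (simp add: ennreal_mult[symmetric])
    finally show "sq_mass (\<lambda>x. w x - w (x + h)) \<le> ennreal ((norm h)^2)" .
  qed
  have "cmod (u x) powr p = D powr (p / 2) * w x powr p" for x
    using D(1) by (simp add: w_def powr_divide powr_half_sqrt[symmetric] powr_powr)
  then have "(\<integral>\<^sup>+x. ennreal (cmod (u x) powr p) \<partial>lborel) = (\<integral>\<^sup>+x. ennreal (D powr (p / 2)) * ennreal (w x powr p) \<partial>lborel)"
    by (simp add: ennreal_mult)
  also have "\<dots> = ennreal (D powr (p / 2)) * (\<integral>\<^sup>+x. ennreal (w x powr p) \<partial>lborel)"
    by (rule nn_integral_cmult) measurable
  also have "\<dots> \<le> ennreal (D powr (p / 2)) * ennreal (sobolev_const p)"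
    by (intro mult_left_mono Lp_bound p) auto
  also have "\<dots> = ennreal (sobolev_const p * D powr (p / 2))"
    by (simp add: ennreal_mult'' mult.commute)
  finally show ?thesis .
qed

section \<open>The Coulomb energy and continuity along paths\<close>

text \<open>
  On the shell \<open>2^(-k-1) \<le> |z| < 2^(-k)\<close> the integrand is at most \<open>4^(k+1)\<close>, against a volume of
  order \<open>8^(-k)\<close>.
\<close>

lemma inverse_square_locally_integrable:
  "(\<integral>\<^sup>+z. ennreal (1 / (norm z)^2) * indicator (ball (0::space3) 1) z \<partial>lborel) \<le> ennreal (8 * unit_ball_vol 3)"
proof -
  have "(\<integral>\<^sup>+z. ennreal (1 / (norm z)^2) * indicator (ball (0::space3) 1) z \<partial>lborel)
      \<le> (\<integral>\<^sup>+z. (\<Sum>k. ennreal (4 ^ Suc k) * indicator (ball (0::space3) (1 / 2 ^ k)) z) \<partial>lborel)"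
  proof (rule nn_integral_mono)
    fix z :: space3
    let ?f = "\<lambda>k. ennreal (4 ^ Suc k) * indicator (ball (0::space3) (1 / 2 ^ k)) z"
    show "ennreal (1 / (norm z)^2) * indicator (ball 0 1) z \<le> (\<Sum>k. ?f k)"
    proof (cases "z = 0 \<or> z \<notin> ball 0 1")
      case True
      then have "ennreal (1 / (norm z)^2) * indicator (ball 0 1) z = 0" by auto
      then show ?thesis by (simp only: zero_le)
    next
      case False
      then have z: "0 < norm z" "norm z < 1" by auto
      obtain n0 where n0: "(1 / 2) ^ n0 < norm z"
        using real_arch_pow_inv[OF z(1), of "1 / 2"] by auto
      define n where "n = (LEAST n. 1 / 2 ^ n \<le> norm z)"
      have n: "1 / 2 ^ n \<le> norm z"
        unfolding n_def using n0
        by (intro LeastI[of "\<lambda>n. 1 / 2 ^ n \<le> norm z" n0]) (simp add: power_one_over)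
      with z have "n \<noteq> 0" by (cases n) auto
      then obtain k where k: "n = Suc k" by (cases n) auto
      then have lt: "norm z < 1 / 2 ^ k"
        using not_less_Least[of k "\<lambda>n. 1 / 2 ^ n \<le> norm z"] by (simp add: n_def)
      have "1 / (norm z)^2 \<le> 1 / (1 / 2 ^ n)^2"
        using n z by (intro divide_left_mono power_mono) auto
      also have "\<dots> = 4 ^ Suc k"
        unfolding k by (simp add: power_divide power_even_eq[symmetric] power2_eq_square power_mult_distrib[symmetric])
      finally have "ennreal (1 / (norm z)^2) \<le> ?f k"
        using lt by (simp add: ennreal_leI)
      also have "\<dots> \<le> (\<Sum>k. ?f k)"
        by (rule ennreal_term_le_suminf[of ?f])
      finally show ?thesis using z by simp
    qed
  qed
  also have "\<dots> = (\<Sum>k. \<integral>\<^sup>+z. ennreal (4 ^ Suc k) * indicator (ball (0::space3) (1 / 2 ^ k)) z \<partial>lborel)"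
    by (rule nn_integral_suminf) measurable
  also have "\<dots> = (\<Sum>k. ennreal (4 * unit_ball_vol 3 * (1 / 2) ^ k))"
  proof (rule suminf_cong)
    fix k
    have "(\<integral>\<^sup>+z. ennreal (4 ^ Suc k) * indicator (ball (0::space3) (1 / 2 ^ k)) z \<partial>lborel)
        = ennreal (4 ^ Suc k) * ennreal (ball_vol (1 / 2 ^ k))"
      by (subst nn_integral_cmult_indicator) (simp_all add: emeasure_ball_vol)
    also have "\<dots> = ennreal (4 ^ Suc k * ball_vol (1 / 2 ^ k))"
      using ball_vol_pos[of "1 / 2 ^ k"] by (intro ennreal_mult[symmetric]) auto
    also have "4 ^ Suc k * ball_vol (1 / 2 ^ k) = 4 * unit_ball_vol 3 * (1 / 2) ^ k"
    proof -
      have "(8::real) ^ k = 4 ^ k * 2 ^ k" by (simp flip: power_mult_distrib)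
      moreover have "((2::real) ^ k) ^ 3 = (2 ^ 3) ^ k" by (simp only: power_mult[symmetric] mult.commute)
      ultimately show ?thesis by (simp add: ball_vol_def power_divide field_simps)
    qed
    finally show "(\<integral>\<^sup>+z. ennreal (4 ^ Suc k) * indicator (ball (0::space3) (1 / 2 ^ k)) z \<partial>lborel)
        = ennreal (4 * unit_ball_vol 3 * (1 / 2) ^ k)" .
  qed
  also have "\<dots> = ennreal (8 * unit_ball_vol 3)"
  proof -
    have "(\<lambda>k. 4 * unit_ball_vol 3 * (1 / 2) ^ k) sums (4 * unit_ball_vol 3 * (1 / (1 - 1 / 2)))"
      by (intro sums_mult geometric_sums) auto
    then show ?thesis
      using unit_ball_vol_3_pos by (subst suminf_ennreal2) (auto simp: sums_iff)
  qed
  finally show ?thesis .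
qed

definition coulomb_const :: real where
  "coulomb_const = 1 + sobolev_const 4 / 2 + 4 * unit_ball_vol 3"

lemma sobolev_const_nonneg:
  assumes "p < 6"
  shows "sobolev_const p \<ge> 0"
proof -
  have "2 powr (p - 2) < (2 :: real) powr 4" using assms by (intro powr_less_mono) auto
  then show ?thesis by (auto simp: sobolev_const_def intro!: add_nonneg_nonneg divide_nonneg_nonneg)
qed

lemma coulomb_const_nonneg: "coulomb_const \<ge> 0"
  using sobolev_const_nonneg[of 4] unit_ball_vol_3_pos by (simp add: coulomb_const_def)

text \<open>
  At distance at least \<open>1\<close> the kernel is bounded and the mass suffices. Closer to \<open>x\<close>, Young's inequality
  separates \<open>|u|^4\<close>, which the embedding controls by a multiple of \<open>D^2\<close>, from the square of the kernel;
  the weights \<open>1 / (2 D)\<close> and \<open>D / 2\<close> make both contributions proportional to \<open>D\<close>.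
\<close>

lemma coulomb_potential_bound:
  assumes u: "u \<in> H1" and D: "D > 0" "(H1_norm u)^2 \<le> D"
  shows "(\<integral>\<^sup>+y. ennreal ((cmod (u y))^2 / norm (x - y)) \<partial>lborel) \<le> ennreal (coulomb_const * D)"
proof -
  let ?N = "\<integral>\<^sup>+y. ennreal (1 / (norm (x - y))^2) * indicator (ball 0 1) (x - y) \<partial>lborel"
  have [measurable]: "u \<in> borel_measurable borel" using u by (rule H1_measurable)
  have pt: "ennreal ((cmod (u y))^2 / norm (x - y)) \<le> ennreal ((cmod (u y))^2) +
      (ennreal (1 / (2 * D)) * ennreal (cmod (u y) powr 4) +
       ennreal (D / 2) * (ennreal (1 / (norm (x - y))^2) * indicator (ball 0 1) (x - y)))" for y
  proof -
    have "(cmod (u y))^2 / norm (x - y) \<le> (cmod (u y))^2 + (1 / (2 * D) * cmod (u y) powr 4 +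
        D / 2 * (1 / (norm (x - y))^2 * indicator (ball 0 1) (x - y)))"
    proof (cases "norm (x - y) < 1")
      case False
      then have "(cmod (u y))^2 / norm (x - y) \<le> (cmod (u y))^2 / 1"
        by (intro divide_left_mono) auto
      then show ?thesis using False D(1) by (auto intro: add_increasing2)
    next
      case True
      define a where "a = (cmod (u y))^2"
      define b where "b = 1 / norm (x - y)"
      have p4: "cmod (u y) powr 4 = a^2"
        by (simp add: a_def powr_numeral flip: power_mult)
      have "a * b \<le> 1 / (2 * D) * a^2 + D / 2 * b^2"
        using zero_le_power2[of "a - D * b"] D(1) by (simp add: field_simps power2_eq_square)
      moreover have "a \<ge> 0" by (simp add: a_def)
      ultimately have "a * b \<le> a + (1 / (2 * D) * a^2 + D / 2 * b^2)" by linarith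
      then show ?thesis using True p4 by (simp add: a_def b_def power_divide)
    qed
    then have "ennreal ((cmod (u y))^2 / norm (x - y)) \<le> ennreal ((cmod (u y))^2 + (1 / (2 * D) * cmod (u y) powr 4 +
        D / 2 * (1 / (norm (x - y))^2 * indicator (ball 0 1) (x - y))))"
      by (rule ennreal_leI)
    also have "\<dots> = ennreal ((cmod (u y))^2) +
      (ennreal (1 / (2 * D)) * ennreal (cmod (u y) powr 4) +
       ennreal (D / 2) * (ennreal (1 / (norm (x - y))^2) * indicator (ball 0 1) (x - y)))"
      using D(1) by (simp add: ennreal_plus ennreal_mult ennreal_indicator del: times_divide_eq_left times_divide_eq_right)
    finally show ?thesis .
  qed
  have kernel: "?N \<le> ennreal (8 * unit_ball_vol 3)"
  proof -
    have "?N =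
        (\<integral>\<^sup>+z. ennreal (1 / (norm z)^2) * indicator (ball (0::space3) 1) (- z) \<partial>lborel)"
      by (subst nn_integral_translate[of _ x, symmetric]) simp_all
    also have "\<dots> = (\<integral>\<^sup>+z. ennreal (1 / (norm z)^2) * indicator (ball (0::space3) 1) z \<partial>lborel)"
      by (intro nn_integral_cong) (simp add: indicator_def)
    finally show ?thesis using inverse_square_locally_integrable by simp
  qed
  have "(\<integral>\<^sup>+y. ennreal ((cmod (u y))^2 / norm (x - y)) \<partial>lborel) \<le> (\<integral>\<^sup>+y. ennreal ((cmod (u y))^2) +
      (ennreal (1 / (2 * D)) * ennreal (cmod (u y) powr 4) +
       ennreal (D / 2) * (ennreal (1 / (norm (x - y))^2) * indicator (ball 0 1) (x - y))) \<partial>lborel)"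
    by (intro nn_integral_mono pt)
  also have "\<dots> = sq_mass (\<lambda>y. cmod (u y)) +
      (ennreal (1 / (2 * D)) * (\<integral>\<^sup>+y. ennreal (cmod (u y) powr 4) \<partial>lborel) +
       ennreal (D / 2) * ?N)"
    by (simp add: nn_integral_add nn_integral_cmult)
  also have "\<dots> \<le> ennreal D + (ennreal (1 / (2 * D)) * ennreal (sobolev_const 4 * D powr (4 / 2)) +
       ennreal (D / 2) * ennreal (8 * unit_ball_vol 3))"
    using nn_integral_sq_le_H1_norm[OF u] D
    by (intro add_mono mult_left_mono H1_embedding_Lp u kernel) (auto intro: order_trans ennreal_leI)
  also have "\<dots> = ennreal (D + (1 / (2 * D) * (sobolev_const 4 * D powr (4 / 2)) + D / 2 * (8 * unit_ball_vol 3)))"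
    using D(1) sobolev_const_nonneg[of 4] unit_ball_vol_3_pos
    by (simp add: ennreal_plus ennreal_mult del: times_divide_eq_left times_divide_eq_right)
  also have "D + (1 / (2 * D) * (sobolev_const 4 * D powr (4 / 2)) + D / 2 * (8 * unit_ball_vol 3)) = coulomb_const * D"
  proof -
    have "D powr (4 / 2) = D * D" using D(1) by (simp add: powr_numeral power2_eq_square)
    then show ?thesis using D(1) by (simp add: coulomb_const_def algebra_simps)
  qed
  finally show ?thesis .
qed

definition coulomb :: "(space3 \<Rightarrow> real) \<Rightarrow> (space3 \<Rightarrow> real) \<Rightarrow> ennreal" where
  "coulomb f g = (\<integral>\<^sup>+x. \<integral>\<^sup>+y. ennreal (f x * g y / norm (x - y)) \<partial>lborel \<partial>lborel)"

lemma coulomb_commute: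
  assumes [measurable]: "f \<in> borel_measurable borel" "g \<in> borel_measurable borel"
  shows "coulomb f g = coulomb g f"
proof -
  have "coulomb f g = (\<integral>\<^sup>+y. \<integral>\<^sup>+x. ennreal (f x * g y / norm (x - y)) \<partial>lborel \<partial>lborel)"
    unfolding coulomb_def by (rule lborel_pair.Fubini'[symmetric]) measurable
  then show ?thesis
    by (simp add: coulomb_def norm_minus_commute mult.commute)
qed

lemma coulomb_le:
  assumes [measurable]: "f \<in> borel_measurable borel" and f: "\<And>x. f x \<ge> 0" "(\<integral>\<^sup>+x. ennreal (f x) \<partial>lborel) \<le> ennreal c"
    and u: "u \<in> H1" and D: "D > 0" "(H1_norm u)^2 \<le> D" and c: "c \<ge> 0"
  shows "coulomb f (\<lambda>x. (cmod (u x))^2) \<le> ennreal (c * coulomb_const * D)"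
proof -
  have [measurable]: "u \<in> borel_measurable borel" using u by (rule H1_measurable)
  have "coulomb f (\<lambda>x. (cmod (u x))^2) \<le> (\<integral>\<^sup>+x. ennreal (f x) * ennreal (coulomb_const * D) \<partial>lborel)"
    unfolding coulomb_def
  proof (rule nn_integral_mono)
    fix x
    have "(\<integral>\<^sup>+y. ennreal (f x * (cmod (u y))^2 / norm (x - y)) \<partial>lborel) =
        (\<integral>\<^sup>+y. ennreal (f x) * ennreal ((cmod (u y))^2 / norm (x - y)) \<partial>lborel)"
      using f(1)[of x] by (simp add: ennreal_mult flip: times_divide_eq_right)
    also have "\<dots> = ennreal (f x) * (\<integral>\<^sup>+y. ennreal ((cmod (u y))^2 / norm (x - y)) \<partial>lborel)"
      by (rule nn_integral_cmult) measurable
    also have "\<dots> \<le> ennreal (f x) * ennreal (coulomb_const * D)"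
      by (intro mult_left_mono coulomb_potential_bound u D) auto
    finally show "(\<integral>\<^sup>+y. ennreal (f x * (cmod (u y))^2 / norm (x - y)) \<partial>lborel) \<le> ennreal (f x) * ennreal (coulomb_const * D)" .
  qed
  also have "\<dots> = (\<integral>\<^sup>+x. ennreal (f x) \<partial>lborel) * ennreal (coulomb_const * D)"
    by (rule nn_integral_multc) measurable
  also have "\<dots> \<le> ennreal c * ennreal (coulomb_const * D)"
    by (intro mult_right_mono f) auto
  also have "\<dots> = ennreal (c * coulomb_const * D)"
    using c by (simp add: ennreal_mult' mult.assoc)
  finally show ?thesis .
qed

lemma ennreal_B_fun:
  assumes u: "u \<in> H1"
  shows "ennreal (B_fun u) = coulomb (\<lambda>x. (cmod (u x))^2) (\<lambda>x. (cmod (u x))^2)"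
proof -
  have [measurable]: "u \<in> borel_measurable borel" using u by (rule H1_measurable)
  define D where "D = (H1_norm u)^2 + 1"
  have D: "D > 0" "(H1_norm u)^2 \<le> D" by (auto simp: D_def intro: add_nonneg_pos)
  define I where "I x = (LINT y|lborel. (cmod (u x))^2 * (cmod (u y))^2 / norm (x - y))" for x
  have "integrable lborel (\<lambda>y. (cmod (u y))^2 / norm (x - y))" for x
    using coulomb_potential_bound[OF u D, of x] by (intro integrableI_nonneg) (auto intro: le_less_trans)
  from integrable_mult_right[OF this] have inner: "integrable lborel (\<lambda>y. (cmod (u x))^2 * (cmod (u y))^2 / norm (x - y))" for x
    by (metis (no_types, lifting) Bochner_Integration.integrable_cong times_divide_eq_right)
  have eI: "ennreal (I x) = (\<integral>\<^sup>+y. ennreal ((cmod (u x))^2 * (cmod (u y))^2 / norm (x - y)) \<partial>lborel)" for x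
    unfolding I_def by (subst nn_integral_eq_integral[OF inner]) auto
  have I_nonneg: "I x \<ge> 0" for x by (simp add: I_def)
  have [measurable]: "I \<in> borel_measurable borel" unfolding I_def[abs_def] by measurable
  have c: "coulomb (\<lambda>x. (cmod (u x))^2) (\<lambda>x. (cmod (u x))^2) = (\<integral>\<^sup>+x. ennreal (I x) \<partial>lborel)"
    by (simp add: coulomb_def eI)
  have "coulomb (\<lambda>x. (cmod (u x))^2) (\<lambda>x. (cmod (u x))^2) \<le> ennreal (D * coulomb_const * D)"
    using nn_integral_sq_le_H1_norm[OF u] D by (intro coulomb_le[OF _ _ _ u D]) (auto intro: order_trans ennreal_leI)
  then have "integrable lborel I"
    unfolding c using I_nonneg by (intro integrableI_nonneg) (auto intro: le_less_trans)
  from nn_integral_eq_integral[OF this] I_nonneg show ?thesis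
    unfolding c by (simp add: B_fun_def I_def[symmetric])
qed

lemma B_fun_nonneg: "B_fun u \<ge> 0"
  by (simp add: B_fun_def)

lemma coulomb_mono_lincomb:
  assumes [measurable]: "f \<in> borel_measurable borel" "g1 \<in> borel_measurable borel" "g2 \<in> borel_measurable borel"
    and f: "\<And>x. f x \<ge> 0" and g: "\<And>x. g1 x \<ge> 0" "\<And>x. g2 x \<ge> 0" and ab: "a \<ge> 0" "b \<ge> 0"
    and le: "\<And>x. g x \<le> a * g1 x + b * g2 x"
  shows "coulomb f g \<le> ennreal a * coulomb f g1 + ennreal b * coulomb f g2"
proof -
  have "coulomb f g \<le> (\<integral>\<^sup>+x. \<integral>\<^sup>+y. ennreal a * ennreal (f x * g1 y / norm (x - y)) +
      ennreal b * ennreal (f x * g2 y / norm (x - y)) \<partial>lborel \<partial>lborel)"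
    unfolding coulomb_def
  proof (intro nn_integral_mono)
    fix x y
    have "f x * g y / norm (x - y) \<le> f x * (a * g1 y + b * g2 y) / norm (x - y)"
      using f le by (intro divide_right_mono mult_left_mono) auto
    also have "\<dots> = a * (f x * g1 y / norm (x - y)) + b * (f x * g2 y / norm (x - y))"
      by (simp add: algebra_simps add_divide_distrib)
    finally have "ennreal (f x * g y / norm (x - y)) \<le> ennreal (a * (f x * g1 y / norm (x - y)) + b * (f x * g2 y / norm (x - y)))"
      by (rule ennreal_leI)
    then show "ennreal (f x * g y / norm (x - y)) \<le> ennreal a * ennreal (f x * g1 y / norm (x - y)) +
      ennreal b * ennreal (f x * g2 y / norm (x - y))"
      using f g ab by (simp add: ennreal_plus ennreal_mult del: times_divide_eq_left times_divide_eq_right)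
  qed
  also have "\<dots> = ennreal a * coulomb f g1 + ennreal b * coulomb f g2"
    unfolding coulomb_def by (simp add: nn_integral_add nn_integral_cmult)
  finally show ?thesis .
qed

lemma norm_sq_le_near:
  fixes a b :: "'a::real_normed_vector"
  assumes "\<delta> > 0"
  shows "(norm a)^2 \<le> (1 + \<delta>) * (norm b)^2 + (1 + 1 / \<delta>) * (norm (a - b))^2"
proof -
  have "norm a \<le> norm b + norm (a - b)"
    using norm_triangle_ineq[of b "a - b"] by simp
  then have "(norm a)^2 \<le> (norm b + norm (a - b))^2" by (rule power_mono) simp
  also have "\<dots> \<le> (1 + \<delta>) * (norm b)^2 + (1 + 1 / \<delta>) * (norm (a - b))^2"
    using zero_le_power2[of "\<delta> * norm b - norm (a - b)"] assms
    by (simp add: field_simps power2_eq_square)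
  finally show ?thesis .
qed

text \<open>
  Upper semicontinuity with respect to the \<open>H1\<close> distance, uniform on the sphere and with a multiplicative
  error. This is what pointwise inequalities \<open>|a| powr p \<le> (1 + \<delta>) |b| powr p + C |a - b| powr p\<close> give after
  integration. As \<open>u\<close> and \<open>v\<close> may be exchanged, it contains both halves of continuity.
\<close>

definition uniformly_usc :: "real \<Rightarrow> ((space3 \<Rightarrow> complex) \<Rightarrow> real) \<Rightarrow> bool" where
  "uniformly_usc c \<Phi> \<longleftrightarrow> (\<forall>\<delta>>0. \<forall>e>0. \<exists>\<eta>>0. \<forall>u\<in>S_set c. \<forall>v\<in>S_set c.
     H1_norm (\<lambda>x. u x - v x) < \<eta> \<longrightarrow> \<Phi> u \<le> (1 + \<delta>) * \<Phi> v + e)"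

lemma uniformly_uscI:
  assumes C: "\<And>\<delta>. \<delta> > 0 \<Longrightarrow> C \<delta> \<ge> 0" and a: "a > 0"
    and le: "\<And>\<delta> u v r. \<delta> > 0 \<Longrightarrow> u \<in> S_set c \<Longrightarrow> v \<in> S_set c \<Longrightarrow> r > 0 \<Longrightarrow>
      H1_norm (\<lambda>x. u x - v x) < r \<Longrightarrow> \<Phi> u \<le> (1 + \<delta>) * \<Phi> v + C \<delta> * r powr a"
  shows "uniformly_usc c \<Phi>"
  unfolding uniformly_usc_def
proof (intro allI impI)
  fix \<delta> e :: real assume \<delta>: "\<delta> > 0" and "e > 0"
  define \<eta> where "\<eta> = (e / (C \<delta> + 1)) powr (1 / a)"
  have "e / (C \<delta> + 1) > 0" using C[OF \<delta>] \<open>e > 0\<close> by simp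
  then have \<eta>: "\<eta> > 0" "\<eta> powr a = e / (C \<delta> + 1)"
    using C[OF \<delta>] a \<open>e > 0\<close> by (auto simp: \<eta>_def powr_powr)
  have "C \<delta> * \<eta> powr a \<le> e"
    using C[OF \<delta>] \<open>e > 0\<close> unfolding \<eta>(2) by (simp add: field_simps)
  then have "\<forall>u\<in>S_set c. \<forall>v\<in>S_set c. H1_norm (\<lambda>x. u x - v x) < \<eta> \<longrightarrow> \<Phi> u \<le> (1 + \<delta>) * \<Phi> v + e"
    using le[OF \<delta> _ _ \<eta>(1)] by fastforce
  with \<eta>(1) show "\<exists>\<eta>>0. \<forall>u\<in>S_set c. \<forall>v\<in>S_set c.
      H1_norm (\<lambda>x. u x - v x) < \<eta> \<longrightarrow> \<Phi> u \<le> (1 + \<delta>) * \<Phi> v + e" by blast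
qed

lemma S_set_facts:
  assumes "u \<in> S_set c"
  shows "u \<in> H1" "(LINT x|lborel. (cmod (u x))^2) = c" "sq_mass (\<lambda>x. cmod (u x)) = ennreal c" "c \<ge> 0"
proof -
  show H: "u \<in> H1" using assms by (simp add: S_set_def)
  show c: "(LINT x|lborel. (cmod (u x))^2) = c" using assms by (simp add: S_set_def Lnorm_2_sq)
  have "integrable lborel (\<lambda>x. (cmod (u x))^2)" using H by (simp add: H1_def L2_def)
  then show "sq_mass (\<lambda>x. cmod (u x)) = ennreal c"
    by (simp add: nn_integral_eq_integral c)
  show "c \<ge> 0" using c by (metis Bochner_Integration.integral_nonneg zero_le_power2)
qed

lemma uniformly_usc_A: "uniformly_usc c A_fun"
proof (rule uniformly_uscI[where C="\<lambda>\<delta>. 1 + 1 / \<delta>" and a=2])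
  fix \<delta> r :: real and u v
  assume \<delta>: "\<delta> > 0" and uv: "u \<in> S_set c" "v \<in> S_set c" and r: "r > 0" "H1_norm (\<lambda>x. u x - v x) < r"
  note u = S_set_facts(1)[OF uv(1)] and v = S_set_facts(1)[OF uv(2)]
  have i: "integrable lborel (\<lambda>x. (norm (weak_grad u x))^2)" "integrable lborel (\<lambda>x. (norm (weak_grad v x))^2)"
    "integrable lborel (\<lambda>x. (norm (weak_grad u x - weak_grad v x))^2)"
    using H1_weak_grad(2)[OF u] H1_weak_grad(2)[OF v] L2_diff[OF H1_weak_grad(2)[OF u] H1_weak_grad(2)[OF v]]
    by (auto simp: L2_def)
  have "A_fun u \<le> (LINT x|lborel. (1 + \<delta>) * (norm (weak_grad v x))^2 + (1 + 1 / \<delta>) * (norm (weak_grad u x - weak_grad v x))^2)"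
    unfolding A_fun_def using i by (intro integral_mono norm_sq_le_near \<delta>) auto
  also have "\<dots> = (1 + \<delta>) * A_fun v + (1 + 1 / \<delta>) * A_fun (\<lambda>x. u x - v x)"
    using i by (simp add: A_fun_def[of v] H1_diff(2)[OF u v])
  finally have le: "A_fun u \<le> (1 + \<delta>) * A_fun v + (1 + 1 / \<delta>) * A_fun (\<lambda>x. u x - v x)" .
  have "A_fun (\<lambda>x. u x - v x) \<le> r powr 2"
  proof -
    have "0 \<le> (LINT x|lborel. (cmod (u x - v x))^2)" by simp
    then have "A_fun (\<lambda>x. u x - v x) \<le> (H1_norm (\<lambda>x. u x - v x))^2" unfolding H1_norm_sq by linarith
    also have "\<dots> \<le> r^2" using r H1_norm_nonneg by (intro power_mono) auto
    finally show ?thesis using r by (simp add: powr_numeral)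
  qed
  then have "(1 + 1 / \<delta>) * A_fun (\<lambda>x. u x - v x) \<le> (1 + 1 / \<delta>) * r powr 2"
    using \<delta> by (intro mult_left_mono) auto
  with le show "A_fun u \<le> (1 + \<delta>) * A_fun v + (1 + 1 / \<delta>) * r powr 2" by linarith
qed auto

lemma uniformly_usc_B: "uniformly_usc c B_fun"
proof (rule uniformly_uscI[where C="\<lambda>\<delta>. (1 + sqrt (1 + \<delta>)) *
    (1 + 1 / (sqrt (1 + \<delta>) - 1)) * (\<bar>c\<bar> * coulomb_const)" and a=2])
  fix \<delta>0 r :: real and u v
  assume \<delta>0: "\<delta>0 > 0" and uv: "u \<in> S_set c" "v \<in> S_set c" and r: "r > 0" "H1_norm (\<lambda>x. u x - v x) < r"
  \<comment> \<open>The energy is quadratic in the density, so the relative error \<open>\<delta>\<close> enters twice.\<close>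
  define \<delta> where "\<delta> = sqrt (1 + \<delta>0) - 1"
  have \<delta>: "\<delta> > 0" "(1 + \<delta>) * (1 + \<delta>) = 1 + \<delta>0" using \<delta>0 by (auto simp: \<delta>_def)
  let ?C = "(1 + sqrt (1 + \<delta>0)) * (1 + 1 / (sqrt (1 + \<delta>0) - 1)) * (\<bar>c\<bar> * coulomb_const)"
  have C: "?C = (2 + \<delta>) * (1 + 1 / \<delta>) * (\<bar>c\<bar> * coulomb_const)" by (simp add: \<delta>_def)
  have C0: "?C \<ge> 0" unfolding C using \<delta> coulomb_const_nonneg by simp
  note u = S_set_facts(1)[OF uv(1)] and v = S_set_facts(1)[OF uv(2)] and c = S_set_facts(4)[OF uv(1)]
  define w where "w x = u x - v x" for x
  have w: "w \<in> H1" using H1_diff(1)[OF u v] by (simp add: w_def[abs_def])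
  have [measurable]: "u \<in> borel_measurable borel" "v \<in> borel_measurable borel" "w \<in> borel_measurable borel"
    using u v w by (auto simp: H1_def L2_def)
  let ?u = "\<lambda>x. (cmod (u x))^2" and ?v = "\<lambda>x. (cmod (v x))^2" and ?w = "\<lambda>x. (cmod (w x))^2"
  have r2: "r^2 > 0" "(H1_norm w)^2 \<le> r^2"
    using r H1_norm_nonneg by (auto simp: w_def[abs_def] intro!: power_mono)
  let ?E = "c * coulomb_const * r^2"
  have E0: "?E \<ge> 0" using c coulomb_const_nonneg by simp
  have near: "?u x \<le> (1 + \<delta>) * ?v x + (1 + 1 / \<delta>) * ?w x" for x
    using norm_sq_le_near[OF \<delta>(1)] by (simp add: w_def)
  have \<delta>': "1 + \<delta> \<ge> 0" "1 + 1 / \<delta> \<ge> 0" using \<delta> by auto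
  have uw: "coulomb ?u ?w \<le> ennreal ?E"
    using S_set_facts(3)[OF uv(1)] by (intro coulomb_le w r2 c) auto
  have vw: "coulomb ?v ?w \<le> ennreal ?E"
    using S_set_facts(3)[OF uv(2)] by (intro coulomb_le w r2 c) auto
  have "coulomb ?v ?u \<le> ennreal (1 + \<delta>) * coulomb ?v ?v + ennreal (1 + 1 / \<delta>) * coulomb ?v ?w"
    by (intro coulomb_mono_lincomb near \<delta>') auto
  also have "\<dots> \<le> ennreal (1 + \<delta>) * ennreal (B_fun v) + ennreal (1 + 1 / \<delta>) * ennreal ?E"
    unfolding ennreal_B_fun[OF v] by (intro add_left_mono mult_left_mono vw) auto
  also have "\<dots> = ennreal ((1 + \<delta>) * B_fun v + (1 + 1 / \<delta>) * ?E)"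
    using \<delta>' E0 B_fun_nonneg[of v] by (simp add: ennreal_plus ennreal_mult del: times_divide_eq_left times_divide_eq_right)
  finally have vu: "coulomb ?v ?u \<le> ennreal ((1 + \<delta>) * B_fun v + (1 + 1 / \<delta>) * ?E)" .
  have "ennreal (B_fun u) \<le> ennreal (1 + \<delta>) * coulomb ?u ?v + ennreal (1 + 1 / \<delta>) * coulomb ?u ?w"
    unfolding ennreal_B_fun[OF u] by (intro coulomb_mono_lincomb near \<delta>') auto
  also have "coulomb ?u ?v = coulomb ?v ?u" by (rule coulomb_commute) measurable
  also have "ennreal (1 + \<delta>) * coulomb ?v ?u + ennreal (1 + 1 / \<delta>) * coulomb ?u ?w \<le>
      ennreal (1 + \<delta>) * ennreal ((1 + \<delta>) * B_fun v + (1 + 1 / \<delta>) * ?E) + ennreal (1 + 1 / \<delta>) * ennreal ?E"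
    by (intro add_mono mult_left_mono vu uw) auto
  also have "\<dots> = ennreal ((1 + \<delta>) * ((1 + \<delta>) * B_fun v + (1 + 1 / \<delta>) * ?E) + (1 + 1 / \<delta>) * ?E)"
    using \<delta>' E0 B_fun_nonneg[of v]
    by (simp only: ennreal_mult[symmetric] ennreal_plus[symmetric] mult_nonneg_nonneg add_nonneg_nonneg)
  also have "(1 + \<delta>) * ((1 + \<delta>) * B_fun v + (1 + 1 / \<delta>) * ?E) + (1 + 1 / \<delta>) * ?E
      = ((1 + \<delta>) * (1 + \<delta>)) * B_fun v + (2 + \<delta>) * (1 + 1 / \<delta>) * ?E"
    using \<delta>(1) by (simp add: field_simps)
  also have "\<dots> = (1 + \<delta>0) * B_fun v + ?C * r powr 2"
    unfolding C using c r(1) by (simp add: \<delta>(2) powr_numeral)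
  finally show "B_fun u \<le> (1 + \<delta>0) * B_fun v + ?C * r powr 2"
    using C0 \<delta>0 B_fun_nonneg[of v] by (subst (asm) ennreal_le_iff) auto
qed (use coulomb_const_nonneg in auto)

definition Lp_mass :: "real \<Rightarrow> (space3 \<Rightarrow> complex) \<Rightarrow> real" where
  "Lp_mass p u = (LINT x|lborel. cmod (u x) powr p)"

lemma Lp_mass_nonneg: "Lp_mass p u \<ge> 0"
  by (simp add: Lp_mass_def)

lemma integrable_Lp:
  assumes u: "u \<in> H1" and p: "2 < p" "p < 6"
  shows "integrable lborel (\<lambda>x. cmod (u x) powr p)"
proof -
  have [measurable]: "u \<in> borel_measurable borel" using u by (rule H1_measurable)
  have "(H1_norm u)^2 + 1 > 0" by (auto intro: add_nonneg_pos)
  from H1_embedding_Lp[OF u this _ p] show ?thesis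
    by (intro integrableI_nonneg) (auto intro: le_less_trans)
qed

lemma convex_powr_nonneg:
  fixes x y p :: real
  assumes p: "p > 1" and \<theta>: "0 < \<theta>" "\<theta> < 1" and xy: "x \<ge> 0" "y \<ge> 0"
  shows "((1 - \<theta>) * x + \<theta> * y) powr p \<le> (1 - \<theta>) * x powr p + \<theta> * y powr p"
proof -
  have small: "t powr p \<le> t" if "0 < t" "t < 1" for t :: real
    using powr_mono'[of 1 p t] that p by simp
  consider "x = 0" | "y = 0" | "x > 0" "y > 0" using xy by linarith
  then show ?thesis
  proof cases
    case 1
    then show ?thesis
      using small[of \<theta>] \<theta> xy by (simp add: powr_mult mult_right_mono)
  next
    case 2
    then show ?thesis
      using small[of "1 - \<theta>"] \<theta> xy by (simp add: powr_mult mult_right_mono)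
  next
    case 3
    then show ?thesis
      using convex_onD[OF powr_convex, of p \<theta> x y] p \<theta> by simp
  qed
qed

text \<open>
  Convexity of the power, applied to \<open>|b| + |a - b| = (1 - \<theta>) (|b| / (1 - \<theta>)) + \<theta> (|a - b| / \<theta>)\<close>.
\<close>

lemma powr_le_near:
  fixes a b :: "'a::real_normed_vector"
  assumes p: "p > 1" and \<theta>: "0 < \<theta>" "\<theta> < 1"
  shows "norm a powr p \<le> (1 - \<theta>) powr (1 - p) * norm b powr p + \<theta> powr (1 - p) * norm (a - b) powr p"
proof -
  let ?x = "norm b / (1 - \<theta>)" and ?y = "norm (a - b) / \<theta>"
  have "norm a \<le> norm b + norm (a - b)"
    using norm_triangle_ineq[of b "a - b"] by simp
  then have "norm a powr p \<le> (norm b + norm (a - b)) powr p" using p by (intro powr_mono2) auto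
  also have "norm b + norm (a - b) = (1 - \<theta>) * ?x + \<theta> * ?y" using \<theta> by simp
  also have "\<dots> powr p \<le> (1 - \<theta>) * ?x powr p + \<theta> * ?y powr p"
    using p \<theta> by (intro convex_powr_nonneg) auto
  also have "(1 - \<theta>) * ?x powr p = (1 - \<theta>) powr (1 - p) * norm b powr p"
    using \<theta> by (simp add: powr_divide powr_diff)
  also have "\<theta> * ?y powr p = \<theta> powr (1 - p) * norm (a - b) powr p"
    using \<theta> by (simp add: powr_divide powr_diff)
  finally show ?thesis .
qed

lemma uniformly_usc_Lp:
  assumes p: "2 < p" "p < 6"
  shows "uniformly_usc c (Lp_mass p)"
proof (rule uniformly_uscI[where C="\<lambda>\<delta>. (1 - (1 + \<delta>) powr (1 / (1 - p))) powr (1 - p) * sobolev_const p" and a=p])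
  fix \<delta> r :: real and u v
  assume \<delta>: "\<delta> > 0" and uv: "u \<in> S_set c" "v \<in> S_set c" and r: "r > 0" "H1_norm (\<lambda>x. u x - v x) < r"
  define \<theta> where "\<theta> = 1 - (1 + \<delta>) powr (1 / (1 - p))"
  have "(1 + \<delta>) powr (1 / (1 - p)) < (1 + \<delta>) powr 0"
    using \<delta> p by (intro powr_less_mono) auto
  then have \<theta>: "0 < \<theta>" "\<theta> < 1" using \<delta> by (auto simp: \<theta>_def)
  have \<theta>p: "(1 - \<theta>) powr (1 - p) = 1 + \<delta>" using \<delta> p by (simp add: \<theta>_def powr_powr)
  define C where "C = \<theta> powr (1 - p) * sobolev_const p"
  note u = S_set_facts(1)[OF uv(1)] and v = S_set_facts(1)[OF uv(2)]
  note w = H1_diff(1)[OF u v]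
  note i = integrable_Lp[OF u p] integrable_Lp[OF v p] integrable_Lp[OF w p]
  have "Lp_mass p u \<le>
      (LINT x|lborel. (1 + \<delta>) * cmod (v x) powr p + \<theta> powr (1 - p) * cmod (u x - v x) powr p)"
    unfolding Lp_mass_def
  proof (rule integral_mono)
    show "cmod (u x) powr p \<le> (1 + \<delta>) * cmod (v x) powr p + \<theta> powr (1 - p) * cmod (u x - v x) powr p" for x
      using powr_le_near[OF _ \<theta>, of p "u x" "v x"] p by (simp add: \<theta>p)
  qed (use i in auto)
  also have "\<dots> = (1 + \<delta>) * Lp_mass p v + \<theta> powr (1 - p) * Lp_mass p (\<lambda>x. u x - v x)"
    using i by (simp add: Lp_mass_def)
  also have "\<dots> \<le> (1 + \<delta>) * Lp_mass p v + C * r powr p"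
  proof -
    have "(H1_norm (\<lambda>x. u x - v x))^2 \<le> r^2" using r H1_norm_nonneg by (intro power_mono) auto
    from H1_embedding_Lp[OF w _ this p] r
    have "ennreal (Lp_mass p (\<lambda>x. u x - v x)) \<le> ennreal (sobolev_const p * (r^2) powr (p / 2))"
      by (simp add: nn_integral_eq_integral[OF i(3)] Lp_mass_def)
    moreover have "(r^2) powr (p / 2) = r powr p"
      using r by (simp add: powr_powr flip: powr_numeral)
    ultimately have "Lp_mass p (\<lambda>x. u x - v x) \<le> sobolev_const p * r powr p"
      using sobolev_const_nonneg[OF p(2)] by simp
    then show ?thesis unfolding C_def mult.assoc by (intro add_left_mono mult_left_mono) auto
  qed
  finally show "Lp_mass p u \<le> (1 + \<delta>) * Lp_mass p v
      + (1 - (1 + \<delta>) powr (1 / (1 - p))) powr (1 - p) * sobolev_const p * r powr p"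
    by (simp only: C_def \<theta>_def)
qed (use p sobolev_const_nonneg in auto)

lemma uniformly_usc_continuous_along_path:
  assumes \<Phi>: "uniformly_usc c \<Phi>" "\<And>u. \<Phi> u \<ge> 0" and g: "g \<in> C01 (S_set c)"
  shows "continuous_on {0..1} (\<lambda>t. \<Phi> (g t))"
  unfolding continuous_on_def
proof (intro ballI tendstoI)
  fix t :: real and e :: real assume t: "t \<in> {0..1}" and e: "e > 0"
  have gS: "g s \<in> S_set c" if "s \<in> {0..1}" for s using g that by (auto simp: C01_def)
  define X where "X = \<Phi> (g t) + e"
  define \<delta> where "\<delta> = e / (4 * X)"
  have X: "X > 0" using \<Phi>(2)[of "g t"] e by (simp add: X_def)
  then have \<delta>: "\<delta> > 0" "\<delta> * X = e / 4" using e by (auto simp: \<delta>_def)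
  have "e / 4 > 0" using e by simp
  from \<Phi>(1)[unfolded uniformly_usc_def, rule_format, OF \<delta>(1) this] obtain \<eta> where \<eta>: "\<eta> > 0"
    and near: "\<forall>u\<in>S_set c. \<forall>v\<in>S_set c.
      H1_norm (\<lambda>x. u x - v x) < \<eta> \<longrightarrow> \<Phi> u \<le> (1 + \<delta>) * \<Phi> v + e / 4"
    by blast
  note near = near[rule_format]
  have "((\<lambda>s. H1_norm (\<lambda>x. g s x - g t x)) \<longlongrightarrow> 0) (at t within {0..1})"
    using g t by (auto simp: C01_def)
  then have "eventually (\<lambda>s. H1_norm (\<lambda>x. g s x - g t x) < \<eta>) (at t within {0..1})"
    using \<eta> by (rule order_tendstoD(2))
  moreover have "eventually (\<lambda>s. s \<in> {0..1}) (at t within {0..1})"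
    by (simp add: eventually_at_filter)
  ultimately show "eventually (\<lambda>s. dist (\<Phi> (g s)) (\<Phi> (g t)) < e) (at t within {0..1})"
  proof eventually_elim
    case (elim s)
    have 1: "\<Phi> (g s) \<le> (1 + \<delta>) * \<Phi> (g t) + e / 4" using near[OF gS gS] elim t by auto
    have 2: "\<Phi> (g t) \<le> (1 + \<delta>) * \<Phi> (g s) + e / 4"
      using near[OF gS gS] elim t H1_norm_minus_commute[OF S_set_facts(1)[OF gS] S_set_facts(1)[OF gS], of s t] by auto
    have 3: "\<delta> * \<Phi> (g t) \<le> e / 4"
      unfolding \<delta>(2)[symmetric] using \<delta>(1) e by (intro mult_left_mono) (auto simp: X_def)
    with 1 have 4: "\<Phi> (g s) \<le> \<Phi> (g t) + e / 2" by (simp add: algebra_simps)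
    then have "\<delta> * \<Phi> (g s) \<le> e / 4"
      unfolding \<delta>(2)[symmetric] using \<delta>(1) e by (intro mult_left_mono) (auto simp: X_def)
    with 2 have "\<Phi> (g t) \<le> \<Phi> (g s) + e / 2" by (simp add: algebra_simps)
    with 4 e show ?case by (simp add: dist_real_def)
  qed
qed

section \<open>Dilations\<close>

lemma sq_integral_rescale:
  fixes f :: "space3 \<Rightarrow> 'b::euclidean_space"
  assumes [measurable]: "f \<in> borel_measurable borel" and t: "t > 0"
  shows "(LINT x|lborel. (norm (a *\<^sub>R f (t *\<^sub>R x)))^2) = a^2 / t ^ 3 * (LINT x|lborel. (norm (f x))^2)"
  using integral_lborel_affine[of "\<lambda>x. (norm (f x))^2" t 0] t
  by (simp add: power_mult_distrib field_simps power3_eq_cube)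

lemma nn_sq_integral_rescale:
  fixes f :: "space3 \<Rightarrow> real"
  assumes [measurable]: "f \<in> borel_measurable borel" and t: "t > 0"
  shows "sq_mass (\<lambda>x. a * f (t *\<^sub>R x)) = ennreal (a^2 / t ^ 3) * sq_mass f"
proof -
  have "sq_mass (\<lambda>x. a * f (t *\<^sub>R x)) = ennreal (a^2) * sq_mass (\<lambda>x. f (t *\<^sub>R x))"
    by (simp add: power_mult_distrib ennreal_mult nn_integral_cmult)
  moreover have "sq_mass f = ennreal (t ^ 3) * sq_mass (\<lambda>x. f (t *\<^sub>R x))"
    using nn_integral_lborel_affine[of "\<lambda>x. ennreal ((f x)^2)" t 0] t by simp
  moreover have "ennreal (a^2 / t ^ 3) * ennreal (t ^ 3) = ennreal (a^2)"
    using t by (simp add: ennreal_mult[symmetric])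
  ultimately show ?thesis by (simp add: mult.assoc[symmetric])
qed

lemma L2_rescale:
  fixes f :: "space3 \<Rightarrow> 'b::euclidean_space"
  assumes "f \<in> L2" and t: "t > 0"
  shows "(\<lambda>x. a *\<^sub>R f (t *\<^sub>R x)) \<in> L2"
proof -
  have [measurable]: "f \<in> borel_measurable borel" using assms by (simp add: L2_def)
  have "integrable lborel (\<lambda>x. (norm (f (t *\<^sub>R x)))^2)"
    using integrable_lborel_affine[of "\<lambda>x. (norm (f x))^2" t 0] assms by (simp add: L2_def)
  then show ?thesis by (simp add: L2_def power_mult_distrib)
qed

lemma weak_gradient_rescale:
  assumes w: "is_weak_gradient u v" and L: "u \<in> L2" "v \<in> L2" and t: "t > 0"
  shows "is_weak_gradient (\<lambda>x. a *\<^sub>R u (t *\<^sub>R x)) (\<lambda>x. (a * t) *\<^sub>R v (t *\<^sub>R x))"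
  unfolding is_weak_gradient_def
proof (intro conjI allI impI)
  show "locally_integrable (\<lambda>x. a *\<^sub>R u (t *\<^sub>R x))" "locally_integrable (\<lambda>x. (a * t) *\<^sub>R v (t *\<^sub>R x))"
    by (intro locally_integrable_L2 L2_rescale L t)+
  fix \<phi> i assume \<phi>: "test_function \<phi>"
  have [measurable]: "u \<in> borel_measurable borel" "v \<in> borel_measurable borel" "\<phi> \<in> borel_measurable borel"
    using L \<phi> by (auto simp: L2_def test_function_measurable)
  define D where "D x = frechet_derivative \<phi> (at x) (axis i 1)" for x
  have [measurable]: "D \<in> borel_measurable borel"
    using test_function_derivative_continuous[OF \<phi>, of "axis i 1"]
    by (auto simp: D_def[abs_def] intro: borel_measurable_continuous_onI)
  have [measurable]: "(\<lambda>x. v x $ i) \<in> borel_measurable borel"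
    using locally_integrable_nth[OF locally_integrable_L2[OF L(2)], of i] by (simp add: locally_integrable_def)
  define \<psi> where "\<psi> x = \<phi> ((1 / t) *\<^sub>R x)" for x
  have \<psi>: "test_function \<psi>"
    unfolding \<psi>_def using test_function_affine[OF \<phi>, of "1 / t" 1 0] t by simp
  have D\<psi>: "frechet_derivative \<psi> (at x) (axis i 1) = (1 / t) * D ((1 / t) *\<^sub>R x)" for x
  proof -
    have lin: "linear (frechet_derivative \<phi> (at y))" for y
      using test_function_has_derivative[OF \<phi>] has_derivative_linear by blast
    have "((\<lambda>x. (1 / t) *\<^sub>R x) has_derivative (\<lambda>h. (1 / t) *\<^sub>R h)) (at x)"
      by (auto intro!: derivative_eq_intros)
    from has_derivative_compose[OF this test_function_has_derivative[OF \<phi>]]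
    have "(\<psi> has_derivative (\<lambda>h. frechet_derivative \<phi> (at ((1 / t) *\<^sub>R x)) ((1 / t) *\<^sub>R h))) (at x)"
      by (simp add: \<psi>_def[abs_def])
    from frechet_derivative_at[OF this, symmetric] show ?thesis
      by (simp only: linear_scale[OF lin] D_def real_scaleR_def)
  qed
  have "(LINT x|lborel. D x *\<^sub>R (a *\<^sub>R u (t *\<^sub>R x))) = (1 / t) ^ 3 *\<^sub>R (LINT x|lborel. D ((1 / t) *\<^sub>R x) *\<^sub>R (a *\<^sub>R u x))"
    using integral_lborel_affine[of "\<lambda>x. D x *\<^sub>R (a *\<^sub>R u (t *\<^sub>R x))" "1 / t" 0] t by simp
  also have "(LINT x|lborel. D ((1 / t) *\<^sub>R x) *\<^sub>R (a *\<^sub>R u x)) = (LINT x|lborel. (t * a) *\<^sub>R (frechet_derivative \<psi> (at x) (axis i 1) *\<^sub>R u x))"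
    using t by (simp add: D\<psi> mult.commute)
  also have "\<dots> = (t * a) *\<^sub>R (LINT x|lborel. frechet_derivative \<psi> (at x) (axis i 1) *\<^sub>R u x)"
    by (rule integral_scaleR_right)
  also have "(LINT x|lborel. frechet_derivative \<psi> (at x) (axis i 1) *\<^sub>R u x) = - (LINT x|lborel. \<psi> x *\<^sub>R (v x $ i))"
    using w \<psi> by (simp add: is_weak_gradient_def)
  finally have 1: "(LINT x|lborel. D x *\<^sub>R (a *\<^sub>R u (t *\<^sub>R x))) = (1 / t) ^ 3 *\<^sub>R (t * a) *\<^sub>R - (LINT x|lborel. \<psi> x *\<^sub>R (v x $ i))" .
  have "(LINT x|lborel. \<phi> x *\<^sub>R (((a * t) *\<^sub>R v (t *\<^sub>R x)) $ i)) =
      (1 / t) ^ 3 *\<^sub>R (LINT x|lborel. \<psi> x *\<^sub>R ((a * t) *\<^sub>R (v x $ i)))"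
    using integral_lborel_affine[of "\<lambda>x. \<phi> x *\<^sub>R ((a * t) *\<^sub>R (v (t *\<^sub>R x) $ i))" "1 / t" 0] t by (simp add: \<psi>_def)
  also have "(LINT x|lborel. \<psi> x *\<^sub>R ((a * t) *\<^sub>R (v x $ i))) = (a * t) *\<^sub>R (LINT x|lborel. \<psi> x *\<^sub>R (v x $ i))"
    by (subst integral_scaleR_right[symmetric]) (simp only: scaleR_left_commute)
  finally show "(LINT x|lborel. frechet_derivative \<phi> (at x) (axis i 1) *\<^sub>R (a *\<^sub>R u (t *\<^sub>R x))) =
      - (LINT x|lborel. \<phi> x *\<^sub>R (((a * t) *\<^sub>R v (t *\<^sub>R x)) $ i))"
    unfolding D_def[symmetric] 1 by (simp add: mult.commute)
qed

text \<open>
  The dilation of exponent \<open>3 / 2\<close>, which preserves the \<open>L2\<close> norm in dimension three.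
\<close>

definition dilate :: "real \<Rightarrow> (space3 \<Rightarrow> complex) \<Rightarrow> space3 \<Rightarrow> complex" where
  "dilate t u = (\<lambda>x. (t powr (3 / 2)) *\<^sub>R u (t *\<^sub>R x))"

lemma dilate_1: "dilate 1 u = u"
  by (simp add: dilate_def)

lemma dilate_H1:
  assumes u: "u \<in> H1" and t: "t > 0"
  shows "dilate t u \<in> L2" "(\<lambda>x. (t powr (5 / 2)) *\<^sub>R weak_grad u (t *\<^sub>R x)) \<in> L2"
    "is_weak_gradient (dilate t u) (\<lambda>x. (t powr (5 / 2)) *\<^sub>R weak_grad u (t *\<^sub>R x))"
proof -
  note w = H1_weak_grad[OF u]
  show "dilate t u \<in> L2" "(\<lambda>x. (t powr (5 / 2)) *\<^sub>R weak_grad u (t *\<^sub>R x)) \<in> L2"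
    unfolding dilate_def by (intro L2_rescale t w H1_L2 u)+
  have "t powr (3 / 2) * t = t powr (5 / 2)"
    using t powr_add[of t "3 / 2" 1] by simp
  then show "is_weak_gradient (dilate t u) (\<lambda>x. (t powr (5 / 2)) *\<^sub>R weak_grad u (t *\<^sub>R x))"
    unfolding dilate_def using weak_gradient_rescale[OF w(1) H1_L2[OF u] w(2) t, of "t powr (3 / 2)"] by simp
qed

lemma dilate_S_set:
  assumes u: "u \<in> S_set c" and t: "t > 0"
  shows "dilate t u \<in> S_set c"
proof -
  note H = S_set_facts(1)[OF u]
  have [measurable]: "u \<in> borel_measurable borel" using H by (simp add: H1_def L2_def)
  have "(t powr (3 / 2))^2 = t ^ 3"
    using t by (simp add: powr_powr flip: powr_numeral)
  then have "(LINT x|lborel. (cmod (dilate t u x))^2) = c"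
    unfolding dilate_def using sq_integral_rescale[of u t "t powr (3 / 2)"] t S_set_facts(2)[OF u] by simp
  with H1I(1)[OF dilate_H1[OF H t]] show ?thesis by (simp add: S_set_def Lnorm_2_sq)
qed

lemma A_fun_dilate:
  assumes u: "u \<in> H1" and t: "t > 0"
  shows "A_fun (dilate t u) = t^2 * A_fun u"
proof -
  have [measurable]: "weak_grad u \<in> borel_measurable borel" using H1_weak_grad(2)[OF u] by (simp add: L2_def)
  have "(t powr (5 / 2))^2 = t ^ 5"
    using t by (simp add: powr_powr flip: powr_numeral)
  then show ?thesis
    unfolding A_fun_eq[OF dilate_H1[OF assms]]
    using sq_integral_rescale[of "weak_grad u" t "t powr (5 / 2)"] t
    by (simp add: A_fun_def power_eq_if field_simps)
qed

lemma Lp_dilate: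
  assumes u: "u \<in> H1" and t: "t > 0"
  shows "Lp_mass p (dilate t u) = t powr (3 * (p - 2) / 2) * Lp_mass p u"
proof -
  have [measurable]: "u \<in> borel_measurable borel" using u by (rule H1_measurable)
  have "Lp_mass p u = t ^ 3 * (LINT x|lborel. cmod (u (t *\<^sub>R x)) powr p)"
    using integral_lborel_affine[of "\<lambda>x. cmod (u x) powr p" t 0] t by (simp add: Lp_mass_def)
  moreover have "Lp_mass p (dilate t u) = t powr (3 / 2 * p) * (LINT x|lborel. cmod (u (t *\<^sub>R x)) powr p)"
    by (simp add: Lp_mass_def dilate_def powr_mult powr_powr)
  moreover have "t powr (3 * (p - 2) / 2) * t ^ 3 = t powr (3 / 2 * p)"
  proof -
    have "t powr (3 * (p - 2) / 2) * t ^ 3 = t powr (3 * (p - 2) / 2) * t powr 3"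
      using t by (simp add: powr_numeral)
    also have "\<dots> = t powr (3 * (p - 2) / 2 + 3)" by (rule powr_add[symmetric])
    also have "3 * (p - 2) / 2 + 3 = 3 / 2 * p" by (simp add: field_simps)
    finally show ?thesis .
  qed
  ultimately show ?thesis by (simp add: mult.assoc[symmetric])
qed

lemma B_fun_dilate:
  assumes u: "u \<in> H1" and t: "t > 0"
  shows "B_fun (dilate t u) = t * B_fun u"
proof -
  have [measurable]: "u \<in> borel_measurable borel" using u by (rule H1_measurable)
  define I where "I x = (LINT y|lborel. (cmod (u x))^2 * (cmod (u y))^2 / norm (x - y))" for x
  have [measurable]: "I \<in> borel_measurable borel" unfolding I_def[abs_def] by measurable
  have t3: "(t powr (3 / 2))^2 = t ^ 3"
    using t by (simp add: powr_powr flip: powr_numeral)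
  have "(LINT y|lborel. (cmod (dilate t u x))^2 * (cmod (dilate t u y))^2 / norm (x - y)) = t ^ 4 * I (t *\<^sub>R x)" for x
  proof -
    let ?J = "LINT y|lborel. (cmod (u (t *\<^sub>R x)))^2 * (cmod (u (t *\<^sub>R y)))^2 / norm (t *\<^sub>R x - t *\<^sub>R y)"
    have n: "norm (t *\<^sub>R x - t *\<^sub>R y) = t * norm (x - y)" for y
      using t by (simp flip: scaleR_diff_right)
    have "(LINT y|lborel. (cmod (dilate t u x))^2 * (cmod (dilate t u y))^2 / norm (x - y)) =
        (LINT y|lborel. t ^ 7 * ((cmod (u (t *\<^sub>R x)))^2 * (cmod (u (t *\<^sub>R y)))^2 / norm (t *\<^sub>R x - t *\<^sub>R y)))"
    proof (rule Bochner_Integration.integral_cong)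
      fix y
      have m: "(cmod (dilate t u z))^2 = t ^ 3 * (cmod (u (t *\<^sub>R z)))^2" for z
        by (simp add: dilate_def power_mult_distrib t3)
      have "t ^ 7 = t * (t ^ 3 * t ^ 3)" by (simp add: power_eq_if)
      then show "(cmod (dilate t u x))^2 * (cmod (dilate t u y))^2 / norm (x - y) =
          t ^ 7 * ((cmod (u (t *\<^sub>R x)))^2 * (cmod (u (t *\<^sub>R y)))^2 / norm (t *\<^sub>R x - t *\<^sub>R y))"
        using t unfolding m n by simp
    qed simp
    also have "\<dots> = t ^ 7 * ?J"
      by (rule integral_mult_right_zero)
    also have "I (t *\<^sub>R x) = t ^ 3 * ?J"
      unfolding I_def
      using integral_lborel_affine[of "\<lambda>y. (cmod (u (t *\<^sub>R x)))^2 * (cmod (u y))^2 / norm (t *\<^sub>R x - y)" t 0] t by simp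
    then have "t ^ 7 * ?J = t ^ 4 * I (t *\<^sub>R x)"
      by (simp add: power_eq_if)
    finally show ?thesis .
  qed
  then have "B_fun (dilate t u) = (LINT x|lborel. t ^ 4 * I (t *\<^sub>R x))"
    by (simp add: B_fun_def)
  also have "\<dots> = t * (t ^ 3 * (LINT x|lborel. I (t *\<^sub>R x)))" by (simp add: power_eq_if)
  also have "t ^ 3 * (LINT x|lborel. I (t *\<^sub>R x)) = B_fun u"
    using integral_lborel_affine[of I t 0] t by (simp add: B_fun_def I_def[symmetric])
  finally show ?thesis .
qed

lemma powr_le_endpoints:
  fixes a b s k :: real
  assumes "0 < a" "s \<in> {a..b}"
  shows "s powr k \<le> a powr k + b powr k"
proof (cases "k \<ge> 0")
  case True
  then have "s powr k \<le> b powr k" using assms by (intro powr_mono2) auto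
  then show ?thesis by (simp add: add_increasing)
next
  case False
  then have "s powr k \<le> a powr k" using assms by (intro powr_mono2') auto
  then show ?thesis by (simp add: add_increasing2)
qed

lemma test_function_rescale_continuous:
  assumes \<phi>: "test_function \<phi>" and a: "0 < a" and X: "\<And>n. X n \<in> {a..b}" "X \<longlonglongrightarrow> t" and t: "t \<in> {a..b}"
  shows "(\<lambda>n. sq_mass (\<lambda>x. X n powr k * \<phi> (X n *\<^sub>R x) - t powr k * \<phi> (t *\<^sub>R x))) \<longlonglongrightarrow> 0"
proof -
  let ?d = "\<lambda>n x. X n powr k * \<phi> (X n *\<^sub>R x) - t powr k * \<phi> (t *\<^sub>R x)"
  have [measurable]: "\<phi> \<in> borel_measurable borel" using \<phi> by (rule test_function_measurable)
  obtain M where M: "M > 0" "\<bar>\<phi> x\<bar> \<le> M" for x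
    using test_function_bounded[OF \<phi>] by blast
  obtain R where R: "\<And>x. \<phi> x \<noteq> 0 \<Longrightarrow> norm x \<le> R"
    using test_function_support_bounded[OF \<phi>] by blast
  define P where "P = a powr k + b powr k"
  have P: "s powr k \<le> P" if "s \<in> {a..b}" for s
    unfolding P_def by (rule powr_le_endpoints[OF a that])
  let ?B = "cball (0::space3) (R / a)"
  have [measurable]: "?B \<in> sets borel" by (intro borel_closed closed_cball)
  have one: "\<bar>s powr k * \<phi> (s *\<^sub>R x)\<bar> \<le> P * M * indicator ?B x" if s: "s \<in> {a..b}" for s x
  proof (cases "\<phi> (s *\<^sub>R x) = 0")
    case True
    have "P \<ge> 0" by (simp add: P_def)
    with True M show ?thesis by (simp add: indicator_def)
  next
    case False
    then have "s * norm x \<le> R" using R[of "s *\<^sub>R x"] s a by simp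
    moreover have "a * norm x \<le> s * norm x" using s by (intro mult_right_mono) auto
    ultimately have "x \<in> ?B" using a by (simp add: field_simps)
    moreover have "s powr k * \<bar>\<phi> (s *\<^sub>R x)\<bar> \<le> P * M"
      using P[OF s] M by (intro mult_mono) (auto simp: P_def)
    ultimately show ?thesis by (simp add: abs_mult)
  qed
  have "(\<lambda>n. sq_mass (?d n))
      \<longlonglongrightarrow> (\<integral>\<^sup>+x. 0 \<partial>(lborel :: space3 measure))"
  proof (rule nn_integral_dominated_convergence[where w="\<lambda>x. ennreal ((2 * P * M)^2) * indicator ?B x"])
    show "AE x in lborel. ennreal ((?d n x)^2)
        \<le> ennreal ((2 * P * M)^2) * indicator ?B x" for n
    proof (rule AE_I2)
      fix x
      have "\<bar>?d n x\<bar> \<le> 2 * P * M * indicator ?B x"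
        using one[OF X(1), of n x] one[OF t, of x] by linarith
      from power_mono[OF this, of 2] have "(?d n x)^2 \<le> (2 * P * M)^2 * indicator ?B x"
        by (auto simp: indicator_def)
      from ennreal_leI[OF this] show "ennreal ((?d n x)^2)
        \<le> ennreal ((2 * P * M)^2) * indicator ?B x"
        by (simp add: ennreal_mult ennreal_indicator)
    qed
    show "AE x in lborel. (\<lambda>n. ennreal ((?d n x)^2)) \<longlonglongrightarrow> 0"
    proof (rule AE_I2)
      fix x
      have "isCont \<phi> y" for y
        using test_function_continuous[OF \<phi>] by (simp add: continuous_on_eq_continuous_at)
      then have p1: "(\<lambda>n. \<phi> (X n *\<^sub>R x)) \<longlonglongrightarrow> \<phi> (t *\<^sub>R x)"
        by (rule isCont_tendsto_compose) (intro tendsto_scaleR X(2) tendsto_const)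
      have p2: "(\<lambda>n. X n powr k) \<longlonglongrightarrow> t powr k"
        using t a by (intro tendsto_powr X(2) tendsto_const) auto
      have "(\<lambda>n. ennreal ((?d n x)^2))
          \<longlonglongrightarrow> ennreal ((t powr k * \<phi> (t *\<^sub>R x) - t powr k * \<phi> (t *\<^sub>R x))^2)"
        by (intro tendsto_ennrealI tendsto_power tendsto_diff tendsto_mult tendsto_const p1 p2)
      then show "(\<lambda>n. ennreal ((?d n x)^2)) \<longlonglongrightarrow> 0"
        by simp
    qed
    show "(\<integral>\<^sup>+x. ennreal ((2 * P * M)^2) * indicator ?B x \<partial>lborel) < \<infinity>"
    proof -
      have "(\<integral>\<^sup>+x. ennreal ((2 * P * M)^2) * indicator ?B x \<partial>lborel) = ennreal ((2 * P * M)^2) * emeasure lborel ?B"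
        by (rule nn_integral_cmult_indicator) simp
      also have "\<dots> < \<infinity>"
        using emeasure_lborel_cball_finite[of "0::space3" "R / a"]
        unfolding infinity_ennreal_def by (intro ennreal_mult_less_top[THEN iffD2]) auto
      finally show ?thesis .
    qed
    show "(\<lambda>x. ennreal ((?d n x)^2)) \<in> borel_measurable lborel" for n
      by measurable
    show "(\<lambda>x. ennreal ((2 * P * M)^2) * indicator ?B x) \<in> borel_measurable lborel"
      by measurable
  qed simp
  then show ?thesis by simp
qed

text \<open>
  Dilations with factors in \<open>{a..b}\<close> are uniformly bounded on \<open>L2\<close>, so convergence on the dense set of test
  functions suffices.
\<close>

lemma real_rescale_continuous:
  fixes f :: "space3 \<Rightarrow> real"
  assumes f: "f \<in> L2" and a: "0 < a" and X: "\<And>n. X n \<in> {a..b}" "X \<longlonglongrightarrow> t" and t: "t \<in> {a..b}"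
  shows "(\<lambda>n. LINT x|lborel. (X n powr k * f (X n *\<^sub>R x) - t powr k * f (t *\<^sub>R x))^2) \<longlonglongrightarrow> 0"
proof -
  have [measurable]: "f \<in> borel_measurable borel" using f by (simp add: L2_def)
  have f2: "integrable lborel (\<lambda>x. (f x)^2)" using f by (simp add: L2_def)
  define C where "C = (a powr k + b powr k)^2 / a ^ 3 + 1"
  have C: "C > 0" using a by (auto simp: C_def intro!: add_nonneg_pos)
  have scale: "(s powr k)^2 / s ^ 3 \<le> C" if "s \<in> {a..b}" for s
  proof -
    have "s powr k \<le> a powr k + b powr k" by (rule powr_le_endpoints[OF a that])
    then have "(s powr k)^2 / s ^ 3 \<le> (a powr k + b powr k)^2 / a ^ 3"
      using that a by (intro frac_le power_mono) auto
    then show ?thesis by (simp add: C_def)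
  qed
  let ?E = "\<lambda>n. sq_mass (\<lambda>x. X n powr k * f (X n *\<^sub>R x) - t powr k * f (t *\<^sub>R x))"
  show ?thesis
  proof (rule LIMSEQ_I)
    fix e :: real assume e: "e > 0"
    have "e / (12 * C) > 0" using e C by simp
    obtain \<phi> where \<phi>: "test_function \<phi>" "sq_mass (\<lambda>x. f x - \<phi> x) < ennreal (e / (12 * C))"
      using approximableE[OF test_functions_dense_L2[OF _ f2] \<open>e / (12 * C) > 0\<close>] by auto
    have [measurable]: "\<phi> \<in> borel_measurable borel" using \<phi>(1) by (rule test_function_measurable)
    let ?e = "sq_mass (\<lambda>x. f x - \<phi> x)"
    have near: "sq_mass (\<lambda>x. s powr k * f (s *\<^sub>R x) - s powr k * \<phi> (s *\<^sub>R x)) \<le> ennreal (e / 12)"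
      if s: "s \<in> {a..b}" for s
    proof -
      have "sq_mass (\<lambda>x. s powr k * f (s *\<^sub>R x) - s powr k * \<phi> (s *\<^sub>R x)) =
          ennreal ((s powr k)^2 / s ^ 3) * ?e"
        using nn_sq_integral_rescale[of "\<lambda>x. f x - \<phi> x" s "s powr k"] s a by (simp add: right_diff_distrib)
      also have "\<dots> \<le> ennreal C * ennreal (e / (12 * C))"
        using scale[OF s] \<phi>(2) by (intro mult_mono ennreal_leI) auto
      also have "\<dots> = ennreal (e / 12)" using C e by (simp add: ennreal_mult[symmetric])
      finally show ?thesis .
    qed
    let ?T = "\<lambda>n. sq_mass (\<lambda>x. X n powr k * \<phi> (X n *\<^sub>R x) - t powr k * \<phi> (t *\<^sub>R x))"
    have "ennreal (e / 16) > 0" using e by simp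
    with test_function_rescale_continuous[OF \<phi>(1) a X t, of k]
    have "eventually (\<lambda>n. ?T n < ennreal (e / 16)) sequentially" by (rule order_tendstoD(2))
    then obtain N where N: "?T n < ennreal (e / 16)" if "n \<ge> N" for n
      by (auto simp: eventually_sequentially)
    have two: "2 * ennreal y = ennreal (2 * y)" if "y \<ge> 0" for y
      using that by (simp add: ennreal_mult)
    have "norm ((LINT x|lborel. (X n powr k * f (X n *\<^sub>R x) - t powr k * f (t *\<^sub>R x))^2) - 0) < e" if "n \<ge> N" for n
    proof -
      have "?E n \<le> 2 * sq_mass (\<lambda>x. X n powr k * f (X n *\<^sub>R x) - X n powr k * \<phi> (X n *\<^sub>R x)) +
          2 * sq_mass (\<lambda>x. X n powr k * \<phi> (X n *\<^sub>R x) - t powr k * f (t *\<^sub>R x))"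
        by (rule nn_integral_sq_diff_triangle) measurable
      also have "\<dots> \<le> 2 * ennreal (e / 12) + 2 * (2 * ennreal (e / 16) + 2 * ennreal (e / 12))"
      proof (intro add_mono mult_left_mono near X)
        have "sq_mass (\<lambda>x. X n powr k * \<phi> (X n *\<^sub>R x) - t powr k * f (t *\<^sub>R x)) \<le>
          2 * ?T n + 2 * sq_mass (\<lambda>x. t powr k * \<phi> (t *\<^sub>R x) - t powr k * f (t *\<^sub>R x))"
          by (rule nn_integral_sq_diff_triangle) measurable
        also have "\<dots> \<le> 2 * ennreal (e / 16) + 2 * ennreal (e / 12)"
          using near[OF t] less_imp_le[OF N[OF that]]
          by (intro add_mono mult_left_mono) (auto simp: power2_commute)
        finally show "sq_mass (\<lambda>x. X n powr k * \<phi> (X n *\<^sub>R x) - t powr k * f (t *\<^sub>R x))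
          \<le> 2 * ennreal (e / 16) + 2 * ennreal (e / 12)" .
      qed auto
      also have "\<dots> = ennreal (2 * (e / 12) + 2 * (2 * (e / 16) + 2 * (e / 12)))"
        using e by (simp add: two ennreal_plus[symmetric] del: ennreal_plus)
      also have "\<dots> < ennreal e" using e by (intro ennreal_lessI) auto
      finally have lt: "?E n < ennreal e" .
      then have "integrable lborel (\<lambda>x. (X n powr k * f (X n *\<^sub>R x) - t powr k * f (t *\<^sub>R x))^2)"
        by (intro integrableI_nonneg) (auto intro: less_trans)
      from lt[unfolded nn_integral_eq_integral[OF this AE_I2[OF zero_le_power2]]]
      show ?thesis by (simp add: ennreal_less_iff)
    qed
    then show "\<exists>N. \<forall>n\<ge>N. norm ((LINT x|lborel. (X n powr k * f (X n *\<^sub>R x) - t powr k * f (t *\<^sub>R x))^2) - 0) < e"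
      by blast
  qed
qed

lemma rescale_continuous:
  fixes f :: "space3 \<Rightarrow> 'b::euclidean_space"
  assumes f: "f \<in> L2" and a: "0 < a" and X: "\<And>n. X n \<in> {a..b}" "X \<longlonglongrightarrow> t" and t: "t \<in> {a..b}"
  shows "(\<lambda>n. LINT x|lborel. (norm ((X n powr k) *\<^sub>R f (X n *\<^sub>R x) - (t powr k) *\<^sub>R f (t *\<^sub>R x)))^2) \<longlonglongrightarrow> 0"
proof -
  have [measurable]: "f \<in> borel_measurable borel" using f by (simp add: L2_def)
  have fb: "(\<lambda>x. f x \<bullet> b) \<in> L2" if "b \<in> Basis" for b
    using that by (intro L2_compose_contraction[OF f]) (auto intro: norm_nth_le Basis_le_norm)
  have sq: "(norm y)^2 = (\<Sum>b\<in>Basis. (y \<bullet> b)^2)" for y :: 'b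
    by (subst power2_norm_eq_inner, subst euclidean_inner) (simp add: power2_eq_square)
  have "(LINT x|lborel. (norm ((X n powr k) *\<^sub>R f (X n *\<^sub>R x) - (t powr k) *\<^sub>R f (t *\<^sub>R x)))^2) =
      (\<Sum>b\<in>Basis. LINT x|lborel. (X n powr k * (f (X n *\<^sub>R x) \<bullet> b) - t powr k * (f (t *\<^sub>R x) \<bullet> b))^2)" for n
  proof -
    have "X n > 0" "t > 0" using X(1)[of n] t a by auto
    then have "integrable lborel (\<lambda>x. (X n powr k * (f (X n *\<^sub>R x) \<bullet> b) - t powr k * (f (t *\<^sub>R x) \<bullet> b))^2)" if "b \<in> Basis" for b
      using L2_diff[OF L2_rescale[OF fb[OF that], of "X n" "X n powr k"] L2_rescale[OF fb[OF that], of t "t powr k"]]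
      by (simp add: L2_def)
    then show ?thesis
      by (simp add: sq inner_diff_left)
  qed
  moreover have "(\<lambda>n. \<Sum>b\<in>Basis. LINT x|lborel. (X n powr k * (f (X n *\<^sub>R x) \<bullet> b) - t powr k * (f (t *\<^sub>R x) \<bullet> b))^2)
      \<longlonglongrightarrow> (\<Sum>b\<in>(Basis::'b set). 0)"
    by (intro tendsto_sum real_rescale_continuous[OF fb a X t])
  ultimately show ?thesis by simp
qed

lemma dilation_path:
  assumes u: "u \<in> S_set c" and ab: "0 < a" "a \<le> b"
  shows "(\<lambda>r. dilate (a + r * (b - a)) u) \<in> C01 (S_set c)"
proof -
  have H: "u \<in> H1" using u by (rule S_set_facts(1))
  define \<tau> where "\<tau> r = a + r * (b - a)" for r
  have \<tau>: "\<tau> r \<in> {a..b}" "\<tau> r > 0" if "r \<in> {0..1}" for r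
  proof -
    have "0 \<le> r * (b - a)" "r * (b - a) \<le> 1 * (b - a)"
      using that ab by (intro mult_nonneg_nonneg mult_right_mono; simp)+
    then show "\<tau> r \<in> {a..b}" "\<tau> r > 0" using ab by (auto simp: \<tau>_def)
  qed
  have "((\<lambda>s. H1_norm (\<lambda>x. dilate (\<tau> s) u x - dilate (\<tau> r) u x)) \<longlongrightarrow> 0) (at r within {0..1})" if r: "r \<in> {0..1}" for r
    unfolding tendsto_at_iff_sequentially comp_def
  proof (intro allI impI)
    fix Y :: "nat \<Rightarrow> real" assume Y: "\<forall>i. Y i \<in> {0..1} - {r}" "Y \<longlonglongrightarrow> r"
    let ?U = "\<lambda>n. LINT x|lborel. (norm ((\<tau> (Y n) powr (3 / 2)) *\<^sub>R u (\<tau> (Y n) *\<^sub>R x) - (\<tau> r powr (3 / 2)) *\<^sub>R u (\<tau> r *\<^sub>R x)))^2"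
    let ?V = "\<lambda>n. LINT x|lborel. (norm ((\<tau> (Y n) powr (5 / 2)) *\<^sub>R weak_grad u (\<tau> (Y n) *\<^sub>R x) - (\<tau> r powr (5 / 2)) *\<^sub>R weak_grad u (\<tau> r *\<^sub>R x)))^2"
    let ?d = "\<lambda>n x. dilate (\<tau> (Y n)) u x - dilate (\<tau> r) u x"
    have X: "\<tau> (Y n) \<in> {a..b}" for n using Y(1) by (intro \<tau>) auto
    have lim: "(\<lambda>n. \<tau> (Y n)) \<longlonglongrightarrow> \<tau> r" unfolding \<tau>_def by (intro tendsto_intros Y)
    have "(H1_norm (?d n))^2 =
      ?U n +
      ?V n" for n
    proof -
      have p: "\<tau> (Y n) > 0" "\<tau> r > 0" using Y(1) r by (auto intro: \<tau>)
      note D1 = dilate_H1[OF H p(1)] and D2 = dilate_H1[OF H p(2)]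
      show ?thesis
        unfolding H1_norm_sq A_fun_eq[OF L2_diff[OF D1(1) D2(1)] L2_diff[OF D1(2) D2(2)] weak_gradient_diff[OF D1(3) D2(3)]]
        by (simp add: dilate_def)
    qed
    moreover have "(\<lambda>n. ?U n +
      ?V n) \<longlonglongrightarrow> 0 + 0"
      by (intro tendsto_add rescale_continuous[OF H1_L2[OF H] ab(1) X lim \<tau>(1)[OF r]]
          rescale_continuous[OF H1_weak_grad(2)[OF H] ab(1) X lim \<tau>(1)[OF r]])
    ultimately have "(\<lambda>n. (H1_norm (?d n))^2) \<longlonglongrightarrow> 0"
      by simp
    from tendsto_real_sqrt[OF this] show "(\<lambda>n. H1_norm (?d n)) \<longlonglongrightarrow> 0"
      by (simp add: H1_norm_nonneg)
  qed
  then show ?thesis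
    using dilate_S_set[OF u \<tau>(2)] by (auto simp: C01_def \<tau>_def)
qed

section \<open>Fibres and the mountain pass level\<close>

text \<open>
  The value of \<open>F\<close> along the dilations of a function, in terms of its three integrals.
\<close>

definition fibre :: "real \<Rightarrow> real \<Rightarrow> real \<Rightarrow> real \<Rightarrow> real \<Rightarrow> real" where
  "fibre p A B N t = 1 / 2 * (t^2 * A) + 1 / 4 * (t * B) - 1 / p * (t powr (3 * (p - 2) / 2) * N)"

lemma F_fun_eq: "p > 0 \<Longrightarrow> F_fun p u = fibre p (A_fun u) (B_fun u) (Lp_mass p u) 1"
  by (simp add: F_fun_def fibre_def Lnorm_powr Lp_mass_def)

lemma Q_fun_eq: "p > 0 \<Longrightarrow> Q_fun p u = A_fun u + 1 / 4 * B_fun u - 3 * (p - 2) / (2 * p) * Lp_mass p u"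
  by (simp add: Q_fun_def Lnorm_powr Lp_mass_def)

lemma F_fun_dilate:
  assumes "u \<in> H1" "t > 0" "p > 0"
  shows "F_fun p (dilate t u) = fibre p (A_fun u) (B_fun u) (Lp_mass p u) t"
  using assms by (simp add: F_fun_eq fibre_def A_fun_dilate B_fun_dilate Lp_dilate)

lemma fibre_derivative:
  assumes "t > 0" "p > 0"
  shows "(fibre p A B N has_real_derivative
    t * A + 1 / 4 * B - 3 * (p - 2) / (2 * p) * t powr (3 * (p - 2) / 2 - 1) * N) (at t)"
  unfolding fibre_def[abs_def]
  by (rule derivative_eq_intros refl | use assms in \<open>simp; fail\<close>)+

text \<open>
  The derivative at \<open>t\<close> is at most \<open>t powr (q - 1)\<close> times the left-hand side of the hypothesis, because \<open>t\<close>
  and \<open>1\<close> are at most \<open>t powr (q - 1)\<close> for \<open>t \<ge> 1\<close>. For \<open>t \<le> 1\<close> these comparisons are reversed, which gives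
  \<open>fibre_le_before\<close>.
\<close>

lemma fibre_le_after:
  assumes p: "10 / 3 < p" and AB: "A \<ge> 0" "B \<ge> 0" and Q: "A + 1 / 4 * B - 3 * (p - 2) / (2 * p) * N \<le> 0"
    and t: "1 \<le> t"
  shows "fibre p A B N t \<le> fibre p A B N 1"
proof (rule DERIV_nonpos_imp_nonincreasing[OF t])
  fix x :: real assume x: "1 \<le> x" "x \<le> t"
  let ?q = "3 * (p - 2) / 2 - 1"
  let ?D = "x * A + 1 / 4 * B - 3 * (p - 2) / (2 * p) * x powr ?q * N"
  have "x powr 1 \<le> x powr ?q" "x powr 0 \<le> x powr ?q"
    using x p by (intro powr_mono; simp)+
  then have "x * A \<le> x powr ?q * A" "1 * B \<le> x powr ?q * B"
    using x AB by (intro mult_right_mono; simp)+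
  then have "?D \<le> x powr ?q * A + 1 / 4 * (x powr ?q * B) - 3 * (p - 2) / (2 * p) * x powr ?q * N"
    by simp
  also have "\<dots> = x powr ?q * (A + 1 / 4 * B - 3 * (p - 2) / (2 * p) * N)"
    by (simp add: algebra_simps)
  also have "\<dots> \<le> 0" using Q by (intro mult_nonneg_nonpos) auto
  finally have "?D \<le> 0" .
  then show "\<exists>y. DERIV (fibre p A B N) x :> y \<and> y \<le> 0"
    using fibre_derivative[of x p A B N] x p by auto
qed

lemma fibre_le_before:
  assumes p: "10 / 3 < p" and AB: "A \<ge> 0" "B \<ge> 0" and Q: "A + 1 / 4 * B - 3 * (p - 2) / (2 * p) * N \<ge> 0"
    and t: "0 < t" "t \<le> 1"
  shows "fibre p A B N t \<le> fibre p A B N 1"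
proof (rule DERIV_nonneg_imp_nondecreasing[OF t(2)])
  fix x :: real assume x: "t \<le> x" "x \<le> 1"
  let ?q = "3 * (p - 2) / 2 - 1"
  let ?D = "x * A + 1 / 4 * B - 3 * (p - 2) / (2 * p) * x powr ?q * N"
  have "x powr ?q \<le> x powr 1" "x powr ?q \<le> x powr 0"
    using x t p by (intro powr_mono'; simp)+
  then have "x powr ?q * A \<le> x * A" "x powr ?q * B \<le> 1 * B"
    using x t AB by (intro mult_right_mono; simp)+
  have "0 \<le> x powr ?q * (A + 1 / 4 * B - 3 * (p - 2) / (2 * p) * N)"
    using Q by (intro mult_nonneg_nonneg) auto
  also have "\<dots> = x powr ?q * A + 1 / 4 * (x powr ?q * B) - 3 * (p - 2) / (2 * p) * x powr ?q * N"
    by (simp add: algebra_simps)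
  also have "\<dots> \<le> ?D"
    using \<open>x powr ?q * A \<le> x * A\<close> \<open>x powr ?q * B \<le> 1 * B\<close> by simp
  finally have "?D \<ge> 0" .
  then show "\<exists>y. DERIV (fibre p A B N) x :> y \<and> 0 \<le> y"
    using fibre_derivative[of x p A B N] x t p by auto
qed

lemma fibre_eventually_negative:
  assumes p: "10 / 3 < p" and AB: "A \<ge> 0" "B \<ge> 0" and N: "N > 0"
  obtains t where "t \<ge> 1" "fibre p A B N t < 0"
proof -
  define q where "q = 3 * (p - 2) / 2"
  have q: "q > 2" using p by (simp add: q_def)
  define M where "M = A / 2 + B / 4"
  have M: "M \<ge> 0" using AB by (simp add: M_def)
  \<comment> \<open>At this factor \<open>t powr (q - 2)\<close> outweighs the ratio of the coefficients.\<close>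
  define s where "s = M * p / N + 1"
  have s: "s \<ge> 1" "M * p / N < s" using M N p by (auto simp: s_def)
  define t where "t = s powr (1 / (q - 2))"
  have t: "t \<ge> 1" using s q by (simp add: t_def ge_one_powr_ge_zero)
  have "t powr q = t powr (q - 2) * t powr 2" by (simp flip: powr_add)
  also have "t powr (q - 2) = s" using s q by (simp add: t_def powr_powr)
  finally have tq: "t powr q = s * t^2" using t by (simp add: powr_numeral)
  have "t * B \<le> t^2 * B"
    using t AB by (intro mult_right_mono) (auto simp: power2_eq_square)
  then have "fibre p A B N t \<le> t^2 * M - 1 / p * (t powr q * N)"
    by (simp add: fibre_def q_def M_def algebra_simps)
  also have "\<dots> = t^2 * (M - s * N / p)"
    by (simp add: tq algebra_simps)
  also have "\<dots> < 0"
  proof -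
    have "M < s * N / p" using s(2) N p by (simp add: field_simps)
    then show ?thesis using t by (simp add: mult_pos_neg)
  qed
  finally show ?thesis using t that by blast
qed

text \<open>
  The embedding is essential here: the Bochner integral of a function that is not integrable is \<open>0\<close>.
\<close>

lemma Lp_mass_pos:
  assumes u: "u \<in> S_set c" and c: "c > 0" and p: "2 < p" "p < 6"
  shows "Lp_mass p u > 0"
proof -
  have "Lp_mass p u \<noteq> 0"
  proof
    assume "Lp_mass p u = 0"
    then have "AE x in lborel. cmod (u x) powr p = 0"
      using integral_nonneg_eq_0_iff_AE[OF integrable_Lp[OF S_set_facts(1)[OF u] p]]
      by (simp add: Lp_mass_def)
    then have "AE x in lborel. (cmod (u x))^2 = 0" by eventually_elim simp
    then have "(LINT x|lborel. (cmod (u x))^2) = 0" by (rule integral_eq_zero_AE)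
    with S_set_facts(2)[OF u] c show False by simp
  qed
  with Lp_mass_nonneg[of p u] show ?thesis by simp
qed

lemma A_set_iff: "u \<in> A_set c K \<longleftrightarrow> u \<in> S_set c \<and> A_fun u \<le> K"
  by (simp add: A_set_def Lnorm_2_sq A_fun_def)

text \<open>
  The dilations of \<open>u\<close> with factors in \<open>{a..b}\<close>, traversed linearly, serve as a competitor for the
  mountain pass level.
\<close>

lemma gamma_level_le_fibre_max:
  assumes p: "10 / 3 < p" and u: "u \<in> S_set c" and ab: "0 < a" "a \<le> b"
    and start: "a^2 * A_fun u \<le> K" and finish: "fibre p (A_fun u) (B_fun u) (Lp_mass p u) b < 0"
    and le: "\<And>t. a \<le> t \<Longrightarrow> fibre p (A_fun u) (B_fun u) (Lp_mass p u) t \<le> M"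
  obtains g where "g \<in> Gamma_set p c K" "g 0 = dilate a u" "gamma_level p c K \<le> ereal M"
proof -
  define g where "g r = dilate (a + r * (b - a)) u" for r
  have H: "u \<in> H1" using u by (rule S_set_facts(1))
  have "g \<in> C01 (S_set c)" unfolding g_def[abs_def] by (rule dilation_path[OF u ab])
  moreover have "g 0 \<in> A_set c K"
    using dilate_S_set[OF u ab(1)] start by (simp add: g_def A_set_iff A_fun_dilate H ab)
  moreover have "F_fun p (g 1) < 0"
    using finish ab p by (simp add: g_def F_fun_dilate H)
  ultimately have g: "g \<in> Gamma_set p c K" by (simp add: Gamma_set_def)
  have "F_fun p (g r) \<le> M" if "r \<in> {0..1}" for r
  proof -
    have "a \<le> a + r * (b - a)" using that ab by simp
    with le[OF this] ab p show ?thesis by (simp add: g_def F_fun_dilate H)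
  qed
  then have "(SUP r\<in>{0..1}. ereal (F_fun p (g r))) \<le> ereal M"
    by (intro SUP_least) simp
  then have "gamma_level p c K \<le> ereal M"
    unfolding gamma_level_def by (rule order_trans[OF INF_lower[OF g]])
  with g show ?thesis by (intro that[of g]) (auto simp: g_def)
qed

lemma gamma_level_le_F_on_V:
  assumes p: "10 / 3 < p" "p < 6" and c: "c > 0" and K: "K > 0" and u: "u \<in> V_set p c"
  shows "gamma_level p c K \<le> ereal (F_fun p u)"
proof -
  have S: "u \<in> S_set c" and Q: "Q_fun p u = 0" using u by (auto simp: V_set_def)
  let ?f = "fibre p (A_fun u) (B_fun u) (Lp_mass p u)"
  have N: "Lp_mass p u > 0" using Lp_mass_pos[OF S c] p by simp
  have Q0: "A_fun u + 1 / 4 * B_fun u - 3 * (p - 2) / (2 * p) * Lp_mass p u = 0"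
    using Q p by (simp add: Q_fun_eq)
  have max: "?f t \<le> F_fun p u" if "t > 0" for t
  proof -
    have "?f t \<le> ?f 1"
    proof (cases "t \<le> 1")
      case True
      then show ?thesis
        using that Q0 by (intro fibre_le_before p A_fun_nonneg B_fun_nonneg) auto
    next
      case False
      then show ?thesis
        using Q0 by (intro fibre_le_after p A_fun_nonneg B_fun_nonneg) auto
    qed
    then show ?thesis using p by (simp add: F_fun_eq)
  qed
  obtain b where b: "b \<ge> 1" "?f b < 0"
    using fibre_eventually_negative[OF p(1) A_fun_nonneg B_fun_nonneg N] .
  \<comment> \<open>Small enough for the path to start in the set \<open>A_set c K\<close>.\<close>
  define a where "a = min 1 (sqrt (K / (A_fun u + 1)))"
  have A1: "A_fun u + 1 > 0" using A_fun_nonneg[of u] by linarith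
  have a: "0 < a" "a \<le> 1" using K A1 by (auto simp: a_def)
  have "a^2 * A_fun u \<le> K"
  proof -
    have "a^2 \<le> (sqrt (K / (A_fun u + 1)))^2" using a by (intro power_mono) (auto simp: a_def)
    also have "\<dots> = K / (A_fun u + 1)" using K A1 by simp
    finally have "a^2 * A_fun u \<le> K / (A_fun u + 1) * A_fun u"
      by (intro mult_right_mono A_fun_nonneg)
    also have "\<dots> \<le> K" using K A1 A_fun_nonneg[of u] by (simp add: field_simps)
    finally show ?thesis .
  qed
  with a b max show ?thesis
    using gamma_level_le_fibre_max[OF p(1) S, of a b K "F_fun p u"] by force
qed

text \<open>
  If \<open>Q(u) < 0\<close>, then \<open>F\<close> stays below \<open>F(u)\<close> along all dilations with factor \<open>t \<ge> 1\<close>. They form an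
  admissible path starting at \<open>u\<close> itself, so the level is at most \<open>F(u)\<close>, the value at an endpoint.
\<close>

lemma Q_fun_nonneg_at_start:
  assumes p: "10 / 3 < p" "p < 6" and c: "c > 0" and K: "mountain_pass_constant p c K"
    and u: "u \<in> A_set c K"
  shows "Q_fun p u \<ge> 0"
proof (rule ccontr)
  assume "\<not> ?thesis"
  then have Q: "A_fun u + 1 / 4 * B_fun u - 3 * (p - 2) / (2 * p) * Lp_mass p u \<le> 0"
    using p by (simp add: Q_fun_eq)
  have S: "u \<in> S_set c" and AK: "A_fun u \<le> K" using u by (auto simp: A_set_iff)
  let ?f = "fibre p (A_fun u) (B_fun u) (Lp_mass p u)"
  have N: "Lp_mass p u > 0" using Lp_mass_pos[OF S c] p by simp
  have max: "?f t \<le> F_fun p u" if "1 \<le> t" for t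
    using fibre_le_after[OF p(1) A_fun_nonneg B_fun_nonneg Q that] p by (simp add: F_fun_eq)
  obtain b where b: "b \<ge> 1" "?f b < 0"
    using fibre_eventually_negative[OF p(1) A_fun_nonneg B_fun_nonneg N] .
  obtain g where g: "g \<in> Gamma_set p c K" "g 0 = dilate 1 u" "gamma_level p c K \<le> ereal (F_fun p u)"
    using gamma_level_le_fibre_max[OF p(1) S _ b(1) _ b(2), of K "F_fun p u"] AK max by auto
  have "ereal (F_fun p u) \<le> ereal (max (F_fun p (g 0)) (F_fun p (g 1)))"
    using g(2) by (simp add: dilate_1)
  also have "\<dots> < gamma_level p c K" using K g(1) by (simp add: mountain_pass_constant_def)
  finally show False using g(3) by simp
qed

text \<open>
  Eliminating the \<open>Lp\<close> term from \<open>F\<close> and \<open>Q\<close> leaves \<open>A\<close> and \<open>B\<close> with coefficients that are positive for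
  \<open>p > 10 / 3\<close>.
\<close>

lemma Q_fun_neg_of_F_fun_neg:
  assumes p: "10 / 3 < p" and F: "F_fun p u < 0"
  shows "Q_fun p u < 0"
proof -
  have "Q_fun p u = 3 * (p - 2) / 2 * F_fun p u - (3 * p - 10) / 4 * A_fun u - (3 * p - 8) / 8 * B_fun u"
    using p by (simp add: Q_fun_def F_fun_def field_simps)
  moreover have "3 * (p - 2) / 2 * F_fun p u < 0" using p F by (intro mult_pos_neg) auto
  moreover have "(3 * p - 10) / 4 * A_fun u \<ge> 0" "(3 * p - 8) / 8 * B_fun u \<ge> 0"
    using p A_fun_nonneg[of u] B_fun_nonneg[of u] by (auto intro!: mult_nonneg_nonneg)
  ultimately show ?thesis by linarith
qed

lemma path_meets_V:
  assumes p: "10 / 3 < p" "p < 6" and c: "c > 0" and K: "mountain_pass_constant p c K"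
    and g: "g \<in> Gamma_set p c K"
  obtains t where "t \<in> {0..1}" "g t \<in> V_set p c"
proof -
  have gC: "g \<in> C01 (S_set c)" and g0: "g 0 \<in> A_set c K" and g1: "F_fun p (g 1) < 0"
    using g by (auto simp: Gamma_set_def)
  have "continuous_on {0..1} (\<lambda>t. A_fun (g t))" "continuous_on {0..1} (\<lambda>t. B_fun (g t))"
    "continuous_on {0..1} (\<lambda>t. Lp_mass p (g t))"
    using p by (intro uniformly_usc_continuous_along_path[OF uniformly_usc_A A_fun_nonneg gC]
        uniformly_usc_continuous_along_path[OF uniformly_usc_B B_fun_nonneg gC]
        uniformly_usc_continuous_along_path[OF uniformly_usc_Lp Lp_mass_nonneg gC]; simp)+
  then have "continuous_on {0..1} (\<lambda>t. A_fun (g t) + 1 / 4 * B_fun (g t)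
      - 3 * (p - 2) / (2 * p) * Lp_mass p (g t))"
    by (intro continuous_intros)
  then have "continuous_on {0..1} (\<lambda>t. Q_fun p (g t))"
    using p by (simp add: Q_fun_eq)
  moreover have "Q_fun p (g 1) \<le> 0" "0 \<le> Q_fun p (g 0)"
    using Q_fun_neg_of_F_fun_neg[OF p(1) g1] Q_fun_nonneg_at_start[OF p c K g0] by simp_all
  ultimately obtain t where t: "0 \<le> t" "t \<le> 1" "Q_fun p (g t) = 0"
    using IVT2'[of "\<lambda>t. Q_fun p (g t)" 1 0 0] by auto
  moreover have "g t \<in> S_set c" using gC t by (auto simp: C01_def)
  ultimately show ?thesis by (intro that[of t]) (auto simp: V_set_def)
qed

theorem lemma2p3:
  fixes p c K :: real
  assumes "10 / 3 < p" and "p < 6" and "c > 0"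
    and "mountain_pass_constant p c K"
  shows "gamma_level p c K = (INF u\<in>V_set p c. ereal (F_fun p u))"
proof (rule antisym)
  have "K > 0" using assms by (simp add: mountain_pass_constant_def)
  then show "gamma_level p c K \<le> (INF u\<in>V_set p c. ereal (F_fun p u))"
    by (intro INF_greatest gamma_level_le_F_on_V assms)
next
  show "(INF u\<in>V_set p c. ereal (F_fun p u)) \<le> gamma_level p c K"
    unfolding gamma_level_def
  proof (rule INF_greatest)
    fix g assume "g \<in> Gamma_set p c K"
    then obtain t where t: "t \<in> {0..1}" "g t \<in> V_set p c"
      using path_meets_V[OF assms] by blast
    have "(INF u\<in>V_set p c. ereal (F_fun p u)) \<le> ereal (F_fun p (g t))"
      using t(2) by (rule INF_lower)
    also have "\<dots> \<le> (SUP t\<in>{0..1}. ereal (F_fun p (g t)))"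
      using t(1) by (rule SUP_upper)
    finally show "(INF u\<in>V_set p c. ereal (F_fun p u)) \<le> (SUP t\<in>{0..1}. ereal (F_fun p (g t)))" .
  qed
qed

end
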